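(* Let $\mathcal H$ be a Hilbert function space on a set $\Omega$ with normalized complete Nevanlinna--Pick kernel, and suppose that $\mathrm{Mult}(\mathcal H)$ has the column-row property. Then every $h\in\mathcal H\odot\mathcal H$ can be factored as $h=fg$ for some $f,g\in\mathcal H$. Moreover, if the column-row property holds continuously with constant $c$, then $f,g$ can be chosen so that $\|f\|_{\mathcal H}\|g\|_{\mathcal H}\leq c\,\|h\|_{\mathcal H\odot\mathcal H}$. In particular, the latter conclusion holds for $\mathcal H=\mathcal D$ (the Dirichlet space on the unit disk) and for $\mathcal H=H^2_d$ (the Drury--Arveson space) for every finite $d$: for each of these spaces there is a finite constant $c$ (depending on the space), with which the column-row property holds continuously, such that every $h\in\mathcal H\odot\mathcal H$ can be factored as $h=fg$ with $f,g\in\mathcal H$ and $\|f\|_{\mathcal H}\|g\|_{\mathcal H}\leq c\,\|h\|_{\mathcal H\odot\mathcal H}$.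
   Context: A normalized complete Nevanlinna--Pick (CNP) kernel on a set $\Omega$ is a function $k:\Omega\times\Omega\to\mathbb C$ of the form $$k(x,y)=\frac{1}{1-u(x)u(y)^*},\qquad u(x)u(y)^*=\sum_n u_n(x)\overline{u_n(y)},$$ where $u$ is any function from $\Omega$ into the open unit ball $\mathbb B^d$ of $\mathbb C^d$; $d=\infty$ is allowed, in which case $u$ maps $\Omega$ into $\ell^2(\mathbb N)$ with $\|u(x)\|^2=\sum_{n=1}^\infty|u_n(x)|^2<1$ for all $x\in\Omega$. A Hilbert function space with kernel $k$ is the reproducing kernel Hilbert space $\mathcal H=\mathcal H(k)$ of complex-valued functions on $\Omega$. $\mathrm{Mult}(\mathcal H)$ denotes the algebra of functions $\varphi:\Omega\to\mathbb C$ such that $\varphi g\in\mathcal H$ for every $g\in\mathcal H$. The weak product of $\mathcal H$ with itself is $$\mathcal H\odot\mathcal H=\Big\{\sum_{i=1}^\infty f_ig_i: f_i,g_i\in\mathcal H,\ \sum_{i=1}^\infty\|f_i\|_{\mathcal H}\|g_i\|_{\mathcal H}<\infty\Big\}$$ (sums taken pointwise on $\Omega$), with norm $$\|h\|_{\mathcal H\odot\mathcal H}=\inf\Big\{\sum_{i=1}^\infty\|f_i\|_{\mathcal H}\|g_i\|_{\mathcal H}: h=\sum_{i=1}^\infty f_ig_i\Big\}.$$ Column-row property: for a sequence $\Phi=(\varphi_n)_{n=1}^\infty$ in $\mathrm{Mult}(\mathcal H)$, consider the column operator $M_\Phi^C: f\mapsto(\varphi_1f,\varphi_2f,\dots)^T$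 from $\mathcal H$ to $\mathcal H\otimes\ell^2$ and the row operator $M_\Phi^R:(f_1,f_2,\dots)^T\mapsto\sum_{n=1}^\infty\varphi_nf_n$ from $\mathcal H\otimes\ell^2$ to $\mathcal H$. $\mathrm{Mult}(\mathcal H)$ has the column-row property if, whenever $M_\Phi^C$ is bounded, $M_\Phi^R$ is also bounded. The column-row property holds continuously with constant $c$ if $\|M_\Phi^R\|\le c\,\|M_\Phi^C\|$ for every such sequence $\Phi$. The Drury--Arveson space $H^2_d$ is the reproducing kernel Hilbert space on the open unit ball $\mathbb B^d\subset\mathbb C^d$ with kernel $(1-zw^* )^{-1}$, where $zw^*=\sum_j z_j\overline{w_j}$. The Dirichlet space $\mathcal D$ is the space of holomorphic functions $f(z)=\sum_{n\ge0}a_nz^n$ on the unit disk with $\|f\|_{\mathcal D}^2=\sum_{n\ge0}(n+1)|a_n|^2<\infty$. Known from earlier work: the column-row property holds continuously for $\mathcal D$ with a constant $c\le\sqrt{18}$ (Trent), and for $H^2_d$, $d$ finite, with a constant $c_d$ depending on $d$ (Aleman, Hartz, McCarthy, Richter). *)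

theory Defs
  imports "HOL-Complex_Analysis.Complex_Analysis"
begin

text \<open>
  A complex-valued function on a set is represented by a total function that vanishes off
  that set, so that functions on the set correspond bijectively to their representatives.
  Sequences are indexed from 0 instead of 1.
\<close>

record 'a hfs =
  points :: "'a set"
  elems :: "('a \<Rightarrow> complex) set"
  ip :: "('a \<Rightarrow> complex) \<Rightarrow> ('a \<Rightarrow> complex) \<Rightarrow> complex"

definition hnorm :: "'a hfs \<Rightarrow> ('a \<Rightarrow> complex) \<Rightarrow> real" where
  "hnorm H f = sqrt (Re (ip H f f))"

locale hilbert_function_space =
  fixes H :: "'a hfs" and k :: "'a \<Rightarrow> 'a \<Rightarrow> complex"
  assumes elems_support: "f \<in> elems H \<Longrightarrow> x \<notin> points H \<Longrightarrow> f x = 0"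
    and zero_in: "(\<lambda>x. 0) \<in> elems H"
    and add_in: "f \<in> elems H \<Longrightarrow> g \<in> elems H \<Longrightarrow> (\<lambda>x. f x + g x) \<in> elems H"
    and scale_in: "f \<in> elems H \<Longrightarrow> (\<lambda>x. a * f x) \<in> elems H"
    and ip_add: "f \<in> elems H \<Longrightarrow> g \<in> elems H \<Longrightarrow> h \<in> elems H \<Longrightarrow>
      ip H (\<lambda>x. f x + g x) h = ip H f h + ip H g h"
    and ip_scale: "f \<in> elems H \<Longrightarrow> g \<in> elems H \<Longrightarrow> ip H (\<lambda>x. a * f x) g = a * ip H f g"
    and ip_cnj: "f \<in> elems H \<Longrightarrow> g \<in> elems H \<Longrightarrow> ip H g f = cnj (ip H f g)"
    and ip_pos: "f \<in> elems H \<Longrightarrow> f \<noteq> (\<lambda>x. 0) \<Longrightarrow> Re (ip H f f) > 0"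
    and complete: "(\<And>n::nat. F n \<in> elems H) \<Longrightarrow>
      (\<And>e. e > 0 \<Longrightarrow> \<exists>N. \<forall>m\<ge>N. \<forall>n\<ge>N. hnorm H (\<lambda>x. F m x - F n x) < e) \<Longrightarrow>
      \<exists>f\<in>elems H. (\<lambda>n. hnorm H (\<lambda>x. F n x - f x)) \<longlonglongrightarrow> 0"
    and kernel_in: "y \<in> points H \<Longrightarrow> (\<lambda>x. if x \<in> points H then k x y else 0) \<in> elems H"
    and reproducing: "f \<in> elems H \<Longrightarrow> y \<in> points H \<Longrightarrow>
      f y = ip H f (\<lambda>x. if x \<in> points H then k x y else 0)"

text \<open>
  A map into the open unit ball of \<open>\<complex>\<^sup>d\<close> with finite \<open>d\<close> is a map into the unit ball of
  the square-summable sequences whose coordinates beyond \<open>d\<close> vanish, so \<open>d = \<infinity>\<close> covers all cases.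
\<close>

definition normalized_cnp_kernel :: "'a set \<Rightarrow> ('a \<Rightarrow> 'a \<Rightarrow> complex) \<Rightarrow> bool" where
  "normalized_cnp_kernel \<Omega> k \<longleftrightarrow>
    (\<exists>u :: 'a \<Rightarrow> nat \<Rightarrow> complex.
      (\<forall>x\<in>\<Omega>. summable (\<lambda>n. (cmod (u x n))\<^sup>2) \<and> (\<Sum>n. (cmod (u x n))\<^sup>2) < 1) \<and>
      (\<forall>x\<in>\<Omega>. \<forall>y\<in>\<Omega>. k x y = 1 / (1 - (\<Sum>n. u x n * cnj (u y n)))))"

definition multipliers :: "'a hfs \<Rightarrow> ('a \<Rightarrow> complex) set" where
  "multipliers H = {\<phi>. (\<forall>x. x \<notin> points H \<longrightarrow> \<phi> x = 0) \<and>
     (\<forall>g\<in>elems H. (\<lambda>x. \<phi> x * g x) \<in> elems H)}"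

definition weak_product_repr ::
    "'a hfs \<Rightarrow> ('a \<Rightarrow> complex) \<Rightarrow> (nat \<Rightarrow> 'a \<Rightarrow> complex) \<Rightarrow> (nat \<Rightarrow> 'a \<Rightarrow> complex) \<Rightarrow> bool" where
  "weak_product_repr H h f g \<longleftrightarrow>
     (\<forall>i. f i \<in> elems H \<and> g i \<in> elems H) \<and>
     summable (\<lambda>i. hnorm H (f i) * hnorm H (g i)) \<and>
     (\<forall>x. (\<lambda>i. f i x * g i x) sums h x)"

definition weak_product :: "'a hfs \<Rightarrow> ('a \<Rightarrow> complex) set" where
  "weak_product H = {h. \<exists>f g. weak_product_repr H h f g}"

definition weak_product_norm :: "'a hfs \<Rightarrow> ('a \<Rightarrow> complex) \<Rightarrow> real" where
  "weak_product_norm H h =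
     Inf {(\<Sum>i. hnorm H (f i) * hnorm H (g i)) | f g. weak_product_repr H h f g}"

text \<open>The Hilbert space tensor product \<open>H \<otimes> \<ell>\<^sup>2\<close>, as square-summable sequences in \<open>H\<close>.\<close>

definition tensor_l2 :: "'a hfs \<Rightarrow> (nat \<Rightarrow> 'a \<Rightarrow> complex) set" where
  "tensor_l2 H = {F. (\<forall>n. F n \<in> elems H) \<and> summable (\<lambda>n. (hnorm H (F n))\<^sup>2)}"

definition tensor_l2_norm :: "'a hfs \<Rightarrow> (nat \<Rightarrow> 'a \<Rightarrow> complex) \<Rightarrow> real" where
  "tensor_l2_norm H F = sqrt (\<Sum>n. (hnorm H (F n))\<^sup>2)"

definition bounded_operator ::
    "'v set \<Rightarrow> ('v \<Rightarrow> real) \<Rightarrow> 'w set \<Rightarrow> ('w \<Rightarrow> real) \<Rightarrow> ('v \<Rightarrow> 'w) \<Rightarrow> bool" where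
  "bounded_operator V nV W nW T \<longleftrightarrow>
     (\<forall>v\<in>V. T v \<in> W) \<and> (\<exists>C. \<forall>v\<in>V. nW (T v) \<le> C * nV v)"

definition operator_norm ::
    "'v set \<Rightarrow> ('v \<Rightarrow> real) \<Rightarrow> ('w \<Rightarrow> real) \<Rightarrow> ('v \<Rightarrow> 'w) \<Rightarrow> real" where
  "operator_norm V nV nW T = Inf {C. 0 \<le> C \<and> (\<forall>v\<in>V. nW (T v) \<le> C * nV v)}"

definition column_op :: "(nat \<Rightarrow> 'a \<Rightarrow> complex) \<Rightarrow> ('a \<Rightarrow> complex) \<Rightarrow> nat \<Rightarrow> 'a \<Rightarrow> complex" where
  "column_op \<Phi> f = (\<lambda>n x. \<Phi> n x * f x)"

definition row_op :: "(nat \<Rightarrow> 'a \<Rightarrow> complex) \<Rightarrow> (nat \<Rightarrow> 'a \<Rightarrow> complex) \<Rightarrow> 'a \<Rightarrow> complex" where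
  "row_op \<Phi> F = (\<lambda>x. \<Sum>n. \<Phi> n x * F n x)"

definition column_bounded :: "'a hfs \<Rightarrow> (nat \<Rightarrow> 'a \<Rightarrow> complex) \<Rightarrow> bool" where
  "column_bounded H \<Phi> \<longleftrightarrow>
     bounded_operator (elems H) (hnorm H) (tensor_l2 H) (tensor_l2_norm H) (column_op \<Phi>)"

definition column_norm :: "'a hfs \<Rightarrow> (nat \<Rightarrow> 'a \<Rightarrow> complex) \<Rightarrow> real" where
  "column_norm H \<Phi> = operator_norm (elems H) (hnorm H) (tensor_l2_norm H) (column_op \<Phi>)"

text \<open>
  The series defining the row operator is taken pointwise. For bounded row operators this
  agrees with convergence in \<open>H\<close>: the bound on finitely supported sequences makes the
  partial sums Cauchy in norm.
\<close>

definition row_bounded :: "'a hfs \<Rightarrow> (nat \<Rightarrow> 'a \<Rightarrow> complex) \<Rightarrow> bool" where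
  "row_bounded H \<Phi> \<longleftrightarrow>
     (\<forall>F\<in>tensor_l2 H. \<forall>x\<in>points H. summable (\<lambda>n. \<Phi> n x * F n x)) \<and>
     bounded_operator (tensor_l2 H) (tensor_l2_norm H) (elems H) (hnorm H) (row_op \<Phi>)"

definition row_norm :: "'a hfs \<Rightarrow> (nat \<Rightarrow> 'a \<Rightarrow> complex) \<Rightarrow> real" where
  "row_norm H \<Phi> = operator_norm (tensor_l2 H) (tensor_l2_norm H) (hnorm H) (row_op \<Phi>)"

definition column_row_property :: "'a hfs \<Rightarrow> bool" where
  "column_row_property H \<longleftrightarrow>
     (\<forall>\<Phi>. (\<forall>n. \<Phi> n \<in> multipliers H) \<longrightarrow> column_bounded H \<Phi> \<longrightarrow> row_bounded H \<Phi>)"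

definition column_row_constant :: "'a hfs \<Rightarrow> real \<Rightarrow> bool" where
  "column_row_constant H c \<longleftrightarrow>
     (\<forall>\<Phi>. (\<forall>n. \<Phi> n \<in> multipliers H) \<longrightarrow> column_bounded H \<Phi> \<longrightarrow>
        row_bounded H \<Phi> \<and> row_norm H \<Phi> \<le> c * column_norm H \<Phi>)"

definition taylor_coeff :: "(complex \<Rightarrow> complex) \<Rightarrow> nat \<Rightarrow> complex" where
  "taylor_coeff f n = (deriv ^^ n) f 0 / fact n"

definition dirichlet_space :: "complex hfs" where
  "dirichlet_space = \<lparr>
     points = ball 0 1,
     elems = {f. f holomorphic_on ball 0 1 \<and> (\<forall>z. z \<notin> ball 0 1 \<longrightarrow> f z = 0) \<and>
                 summable (\<lambda>n. real (n + 1) * (cmod (taylor_coeff f n))\<^sup>2)},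
     ip = (\<lambda>f g. \<Sum>n. of_nat (n + 1) * taylor_coeff f n * cnj (taylor_coeff g n)) \<rparr>"

definition drury_arveson_kernel :: "complex ^ 'd \<Rightarrow> complex ^ 'd \<Rightarrow> complex" where
  "drury_arveson_kernel z w = inverse (1 - (\<Sum>j\<in>UNIV. z $ j * cnj (w $ j)))"

definition is_drury_arveson_space :: "(complex ^ 'd) hfs \<Rightarrow> bool" where
  "is_drury_arveson_space H \<longleftrightarrow>
     points H = ball 0 1 \<and> hilbert_function_space H drury_arveson_kernel"

end

theory Submission
  imports Defs "HOL-Combinatorics.Multiset_Permutations"
begin

text \<open>
  Factorization. The space \<open>H\<close> is a quotient of the full Fock space, the square-summable functions
  on words in the coordinates of \<open>u\<close>. After balancing norms in \<open>h = \<Sum>\<^sub>i f\<^sub>i g\<^sub>i\<close>, lift the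
  sequence of the \<open>f\<^sub>i\<close> to one vector of the Fock space with multiplicity. A vector there equals a
  scalar Fock series times a unit wandering vector of the shift-invariant subspace that it
  generates; in \<open>H\<close> this reads \<open>f\<^sub>i = \<phi>\<^sub>i F\<close>, where the \<open>\<phi>\<^sub>i\<close> form a contractive column of multipliers.
  Hence \<open>h = F (\<Sum>\<^sub>i \<phi>\<^sub>i g\<^sub>i)\<close>, and the second factor lies in \<open>H\<close> because the row operator is bounded.
  For the sharp constant, pass to a weak cluster point along representations of \<open>h\<close>
  with almost minimal norm.

  Column-row constants. For a weight that is an average of multiplicative functions of the exponent,
  Lagrange's identity bounds the norm of a row \<open>\<Sum>\<^sub>n \<psi>\<^sub>n h\<^sub>n\<close> by the sum over all \<open>n, m\<close> of the
  norms of \<open>\<psi>\<^sub>n h\<^sub>m\<close>, which the column norm controls. The weights of both spaces become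
  comparable to such averages (beta integrals) after division by a power of the degree, and
  applying a power of the Euler operator to a product brings them into this form:
  Leibniz' rule spreads the derivatives, and differentiated columns stay bounded for the divided weights.
\<close>

section \<open>Hilbert function spaces\<close>

text \<open>Noncommuting letters make the factorization possible. Appending distinct words of equal
  length gives isometries with orthogonal ranges, so the shifts of a wandering unit vector are
  orthonormal and span a copy of the scalar Fock space; the coefficients of the given vector in this
  copy become F. The constant \<open>c\<close> then enters only in the second factor.

  For the constants, the obstacle is that the weights themselves are not averages of multiplicative
  functions. Such an average satisfies w(1)^2 <= w(0) w(2), which n + 1 violates (4 > 3). The
  Drury-Arveson weight \<alpha>! / |\<alpha>|! is 1 at all multiples of a unit vector; this would
  force the averaging measure to sit at (1, ..., 1), against the value 1/2 at e_1 + e_2 when d >= 2.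
  The weights are divided by (deg + 1)^(2N), with N = 1 for D and N = d for H^2_d. A second obstacle
  is that multipliers are infinite series whose truncations need not be uniformly bounded; Fejer
  means reduce them to polynomials without loss in the constant.\<close>

context hilbert_function_space
begin

lemma diff_in: "f \<in> elems H \<Longrightarrow> g \<in> elems H \<Longrightarrow> (\<lambda>x. f x - g x) \<in> elems H"
  using add_in[OF _ scale_in[of g "-1"], of f] by simp

lemma sum_in:
  assumes "\<And>i. i \<in> S \<Longrightarrow> F i \<in> elems H"
  shows "(\<lambda>x. \<Sum>i\<in>S. F i x) \<in> elems H"
  using assms
proof (induction S rule: infinite_finite_induct)
  case (insert i S)
  then show ?case using add_in[of "F i" "\<lambda>x. \<Sum>i\<in>S. F i x"] by simp
qed (use zero_in in auto)

lemma ip_zero_left: "g \<in> elems H \<Longrightarrow> ip H (\<lambda>x. 0) g = 0"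
  using ip_scale[OF zero_in, of g 0] by simp

lemma ip_add_right:
  assumes f: "f \<in> elems H" and g: "g \<in> elems H" and h: "h \<in> elems H"
  shows "ip H h (\<lambda>x. f x + g x) = ip H h f + ip H h g"
  unfolding ip_cnj[OF add_in[OF f g] h] ip_cnj[OF f h] ip_cnj[OF g h] ip_add[OF f g h] by simp

lemma ip_scale_right:
  assumes f: "f \<in> elems H" and g: "g \<in> elems H"
  shows "ip H g (\<lambda>x. a * f x) = cnj a * ip H g f"
  unfolding ip_cnj[OF scale_in[OF f] g] ip_cnj[OF f g] ip_scale[OF f g] by simp

lemma ip_diff:
  assumes "f \<in> elems H" "g \<in> elems H" "h \<in> elems H"
  shows "ip H (\<lambda>x. f x - g x) h = ip H f h - ip H g h"
  using ip_add[OF assms(1) scale_in[OF assms(2), of "-1"] assms(3)] ip_scale[OF assms(2,3), of "-1"]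
  by simp

lemma ip_diff_right:
  assumes "f \<in> elems H" "g \<in> elems H" "h \<in> elems H"
  shows "ip H h (\<lambda>x. f x - g x) = ip H h f - ip H h g"
  using ip_add_right[OF assms(1) scale_in[OF assms(2), of "-1"] assms(3)]
    ip_scale_right[OF assms(2,3), of "-1"]
  by simp

lemma ip_sum:
  assumes "\<And>i. i \<in> S \<Longrightarrow> F i \<in> elems H" "g \<in> elems H"
  shows "ip H (\<lambda>x. \<Sum>i\<in>S. F i x) g = (\<Sum>i\<in>S. ip H (F i) g)"
  using assms
proof (induction S rule: infinite_finite_induct)
  case (insert i S)
  then show ?case using ip_add[of "F i" "\<lambda>x. \<Sum>i\<in>S. F i x" g] sum_in[of S F] by simp
qed (use ip_zero_left in auto)

lemma ip_self: "f \<in> elems H \<Longrightarrow> ip H f f = of_real ((hnorm H f)\<^sup>2)"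
proof -
  assume f: "f \<in> elems H"
  have "Im (ip H f f) = 0"
    using ip_cnj[OF f f] by (metis add.inverse_neutral cnj.simps(2) equal_neg_zero)
  moreover have "Re (ip H f f) \<ge> 0"
    using ip_pos[OF f] ip_zero_left[OF zero_in] by (cases "f = (\<lambda>x. 0)") auto
  ultimately show ?thesis by (simp add: hnorm_def complex_eq_iff)
qed

lemma hnorm_nonneg: "f \<in> elems H \<Longrightarrow> hnorm H f \<ge> 0"
  using ip_pos[of f] ip_zero_left[OF zero_in]
  unfolding hnorm_def by (cases "f = (\<lambda>x. 0)") auto

lemma hnorm_zero [simp]: "hnorm H (\<lambda>x. 0) = 0"
  using ip_zero_left[OF zero_in] by (simp add: hnorm_def)

lemma hnorm_eq_0: "f \<in> elems H \<Longrightarrow> hnorm H f = 0 \<longleftrightarrow> f = (\<lambda>x. 0)"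
proof -
  assume f: "f \<in> elems H"
  have "hnorm H f > 0" if "f \<noteq> (\<lambda>x. 0)"
    using ip_pos[OF f that] by (simp add: hnorm_def)
  then show ?thesis by fastforce
qed

lemma hnorm_sq: "f \<in> elems H \<Longrightarrow> (hnorm H f)\<^sup>2 = Re (ip H f f)"
  using ip_self by simp

lemma hnorm_scale: "f \<in> elems H \<Longrightarrow> hnorm H (\<lambda>x. a * f x) = cmod a * hnorm H f"
proof -
  assume f: "f \<in> elems H"
  have "ip H (\<lambda>x. a * f x) (\<lambda>x. a * f x) = a * cnj a * ip H f f"
    using f by (simp add: ip_scale ip_scale_right scale_in)
  then have "(hnorm H (\<lambda>x. a * f x))\<^sup>2 = (cmod a * hnorm H f)\<^sup>2"
    unfolding ip_self[OF f] ip_self[OF scale_in[OF f]] complex_norm_square[symmetric]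
    unfolding of_real_mult[symmetric] of_real_eq_iff by (simp add: power_mult_distrib)
  then show ?thesis
    using hnorm_nonneg[OF f] hnorm_nonneg[OF scale_in[OF f]]
    by (metis norm_ge_zero power2_eq_imp_eq zero_le_mult_iff)
qed

lemma hnorm_uminus: "f \<in> elems H \<Longrightarrow> hnorm H (\<lambda>x. - f x) = hnorm H f"
  using hnorm_scale[of f "-1"] by simp

lemma hnorm_minus_commute:
  "f \<in> elems H \<Longrightarrow> g \<in> elems H \<Longrightarrow> hnorm H (\<lambda>x. f x - g x) = hnorm H (\<lambda>x. g x - f x)"
  using hnorm_uminus[OF diff_in[of f g]] by simp

lemma hnorm_add_sq:
  assumes "f \<in> elems H" "g \<in> elems H"
  shows "(hnorm H (\<lambda>x. f x + g x))\<^sup>2 = (hnorm H f)\<^sup>2 + (hnorm H g)\<^sup>2 + 2 * Re (ip H f g)"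
proof -
  have "Re (ip H g f) = Re (ip H f g)" using ip_cnj[OF assms] by simp
  then show ?thesis
    using assms unfolding hnorm_sq[OF add_in[OF assms]] hnorm_sq[OF assms(1)] hnorm_sq[OF assms(2)]
    by (simp add: add_in ip_add ip_add_right)
qed

lemma hnorm_diff_sq:
  assumes "f \<in> elems H" "g \<in> elems H"
  shows "(hnorm H (\<lambda>x. f x - g x))\<^sup>2 = (hnorm H f)\<^sup>2 + (hnorm H g)\<^sup>2 - 2 * Re (ip H f g)"
  using hnorm_add_sq[OF assms(1) scale_in[OF assms(2), of "-1"]]
    ip_scale_right[OF assms(2,1), of "-1"] hnorm_uminus[OF assms(2)] by simp

lemma cauchy_schwarz:
  assumes f: "f \<in> elems H" and g: "g \<in> elems H"
  shows "cmod (ip H f g) \<le> hnorm H f * hnorm H g"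
proof (cases "hnorm H g = 0")
  case True
  then have "ip H f g = 0" using hnorm_eq_0[OF g] ip_cnj[OF g f] ip_zero_left[OF f] by auto
  then show ?thesis using True by simp
next
  case False
  define G where "G = (hnorm H g)\<^sup>2"
  have G: "G > 0" using False by (simp add: G_def)
  define a where "a = ip H f g / of_real G"
  have "0 \<le> (hnorm H (\<lambda>x. f x - a * g x))\<^sup>2" by simp
  also have "\<dots> = (hnorm H f)\<^sup>2 + (cmod a)\<^sup>2 * G - 2 * Re (cnj a * ip H f g)"
    using hnorm_diff_sq[OF f scale_in[OF g]] ip_scale_right[OF g f] hnorm_scale[OF g]
    by (simp add: G_def power_mult_distrib)
  also have "Re (cnj a * ip H f g) = (cmod (ip H f g))\<^sup>2 / G"
    unfolding a_def cmod_power2 by (simp add: power2_eq_square add_divide_distrib)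
  also have "(cmod a)\<^sup>2 * G = (cmod (ip H f g))\<^sup>2 / G"
    using G by (simp add: a_def norm_divide power_divide power2_eq_square)
  finally have "(cmod (ip H f g))\<^sup>2 / G \<le> (hnorm H f)\<^sup>2" by simp
  then have "(cmod (ip H f g))\<^sup>2 \<le> (hnorm H f * hnorm H g)\<^sup>2"
    using G by (simp add: divide_le_eq G_def power_mult_distrib)
  then show ?thesis
    using hnorm_nonneg[OF f] hnorm_nonneg[OF g] by (meson power2_le_imp_le zero_le_mult_iff)
qed

lemma hnorm_triangle:
  assumes f: "f \<in> elems H" and g: "g \<in> elems H"
  shows "hnorm H (\<lambda>x. f x + g x) \<le> hnorm H f + hnorm H g"
proof (rule power2_le_imp_le)
  have "Re (ip H f g) \<le> hnorm H f * hnorm H g"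
    using cauchy_schwarz[OF assms] complex_Re_le_cmod order_trans by blast
  then show "(hnorm H (\<lambda>x. f x + g x))\<^sup>2 \<le> (hnorm H f + hnorm H g)\<^sup>2"
    by (simp add: hnorm_add_sq[OF assms] power2_sum)
qed (use hnorm_nonneg f g in auto)

lemma hnorm_triangle_diff:
  assumes f: "f \<in> elems H" and g: "g \<in> elems H"
  shows "\<bar>hnorm H f - hnorm H g\<bar> \<le> hnorm H (\<lambda>x. f x - g x)"
  using hnorm_triangle[OF diff_in[OF f g] g] hnorm_triangle[OF diff_in[OF g f] f]
    hnorm_minus_commute[OF f g] by simp

section \<open>Limits, Riesz representation and membership by duality\<close>

lemma ip_limit:
  assumes F: "\<And>n. F n \<in> elems H" and f: "f \<in> elems H" and g: "g \<in> elems H"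
    and lim: "(\<lambda>n. hnorm H (\<lambda>x. F n x - f x)) \<longlonglongrightarrow> 0"
  shows "(\<lambda>n. ip H (F n) g) \<longlonglongrightarrow> ip H f g"
proof -
  have "(\<lambda>n. ip H (F n) g - ip H f g) \<longlonglongrightarrow> 0"
  proof (rule Lim_null_comparison)
    show "\<forall>\<^sub>F n in sequentially. norm (ip H (F n) g - ip H f g) \<le> hnorm H (\<lambda>x. F n x - f x) * hnorm H g"
      using cauchy_schwarz[OF diff_in[OF F f] g] ip_diff[OF F f g] by simp
    show "(\<lambda>n. hnorm H (\<lambda>x. F n x - f x) * hnorm H g) \<longlonglongrightarrow> 0"
      using tendsto_mult_right[OF lim, of "hnorm H g"] by simp
  qed
  then show ?thesis by (simp add: LIM_zero_iff)
qed

lemma hnorm_limit: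
  assumes F: "\<And>n. F n \<in> elems H" and f: "f \<in> elems H"
    and lim: "(\<lambda>n. hnorm H (\<lambda>x. F n x - f x)) \<longlonglongrightarrow> 0"
  shows "(\<lambda>n. hnorm H (F n)) \<longlonglongrightarrow> hnorm H f"
proof -
  have "(\<lambda>n. hnorm H (F n) - hnorm H f) \<longlonglongrightarrow> 0"
    by (rule Lim_null_comparison[OF _ lim]) (use hnorm_triangle_diff[OF F f] in simp)
  then show ?thesis by (simp add: LIM_zero_iff)
qed

lemma point_limit:
  assumes F: "\<And>n. F n \<in> elems H" and f: "f \<in> elems H"
    and lim: "(\<lambda>n. hnorm H (\<lambda>x. F n x - f x)) \<longlonglongrightarrow> 0"
  shows "(\<lambda>n. F n x) \<longlonglongrightarrow> f x"
proof (cases "x \<in> points H")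
  case True
  then show ?thesis
    using ip_limit[OF F f kernel_in[OF True] lim]
    unfolding reproducing[OF F True, symmetric] reproducing[OF f True, symmetric] by blast
next
  case False
  then have "F n x = f x" for n using elems_support[OF F False] elems_support[OF f False] by simp
  then show ?thesis by simp
qed

text \<open>Minimizes ||w||^2 - 2 Re m over the graph: minimizing sequences are Cauchy by the
  parallelogram law, and optimality makes the limit represent the functional. A relation
  \<open>V\<close> spares choosing a function on a subspace; the bound makes it single-valued. The
  last conclusion places \<open>a\<close> in the closed span of the domain, so the lemma can also
  serve as an orthogonal projection.\<close>

lemma riesz_graph:
  fixes V :: "(('a \<Rightarrow> complex) \<times> complex) set"
  assumes ne: "V \<noteq> {}"
    and V: "\<And>w m. (w, m) \<in> V \<Longrightarrow> w \<in> elems H"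
    and V_add: "\<And>w m w' m'. (w, m) \<in> V \<Longrightarrow> (w', m') \<in> V \<Longrightarrow> ((\<lambda>x. w x + w' x), m + m') \<in> V"
    and V_scale: "\<And>w m a. (w, m) \<in> V \<Longrightarrow> ((\<lambda>x. a * w x), cnj a * m) \<in> V"
    and bound: "\<And>w m. (w, m) \<in> V \<Longrightarrow> cmod m \<le> C * hnorm H w"
    and C: "C \<ge> 0"
  shows "\<exists>a\<in>elems H. hnorm H a \<le> C \<and> (\<forall>w m. (w, m) \<in> V \<longrightarrow> ip H a w = m) \<and>
    (\<forall>g\<in>elems H. (\<forall>w m. (w, m) \<in> V \<longrightarrow> ip H w g = 0) \<longrightarrow> ip H a g = 0)"
proof -
  define J :: "('a \<Rightarrow> complex) \<times> complex \<Rightarrow> real" where "J = (\<lambda>p. (hnorm H (fst p))\<^sup>2 - 2 * Re (snd p))"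
  have J_ge: "J p \<ge> - C\<^sup>2" if "p \<in> V" for p
  proof -
    obtain w m where p: "p = (w, m)" by (cases p)
    have "Re m \<le> C * hnorm H w" using bound that p complex_Re_le_cmod order_trans by blast
    moreover have "0 \<le> (hnorm H w - C)\<^sup>2" by simp
    ultimately show ?thesis unfolding J_def p by (simp add: power2_diff mult.commute mult.left_commute)
  qed
  define \<mu> where "\<mu> = Inf (J ` V)"
  have bdd: "bdd_below (J ` V)" using J_ge by (auto intro!: bdd_belowI[of _ "- C\<^sup>2"])
  have mu_le: "\<mu> \<le> J p" if "p \<in> V" for p
    unfolding \<mu>_def using cInf_lower[OF _ bdd] that by auto
  have "\<exists>p\<in>V. J p < \<mu> + inverse (real (Suc n))" for n
  proof -
    have "Inf (J ` V) < \<mu> + inverse (real (Suc n))" unfolding \<mu>_def by simp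
    from cInf_lessD[OF _ this] ne show ?thesis by blast
  qed
  then obtain P where P: "\<And>n. P n \<in> V" "\<And>n. J (P n) < \<mu> + inverse (real (Suc n))"
    by metis
  define W where "W = (\<lambda>n. fst (P n))"
  define M where "M = (\<lambda>n. snd (P n))"
  have WM: "(W n, M n) \<in> V" for n using P(1) by (simp add: W_def M_def)
  have W: "W n \<in> elems H" for n using V[OF WM] .
  have par: "(hnorm H (\<lambda>x. W n x - W m x))\<^sup>2 \<le> 2 * inverse (real (Suc n)) + 2 * inverse (real (Suc m))" for n m
  proof -
    \<comment> \<open>The midpoint stays in \<open>V\<close>, so its value is at least \<mu>; this
      is the lower bound that the parallelogram law needs.\<close>
    define q where "q = ((\<lambda>x. 1/2 * (W n x + W m x)), cnj (1/2) * (M n + M m))"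
    have "q \<in> V" unfolding q_def using V_scale[OF V_add[OF WM WM], of "1/2"] .
    then have "\<mu> \<le> J q" by (rule mu_le)
    moreover have "4 * J q = (hnorm H (\<lambda>x. W n x + W m x))\<^sup>2 - 4 * Re (M n + M m)"
    proof -
      have "hnorm H (fst q) = hnorm H (\<lambda>x. W n x + W m x) / 2"
        unfolding q_def fst_conv by (subst hnorm_scale[OF add_in[OF W W]]) simp
      moreover have "Re (snd q) = Re (M n + M m) / 2" by (simp add: q_def)
      ultimately show ?thesis unfolding J_def by (simp only: power_divide) (simp add: field_simps)
    qed
    moreover have "(hnorm H (\<lambda>x. W n x + W m x))\<^sup>2 + (hnorm H (\<lambda>x. W n x - W m x))\<^sup>2
        = 2 * (hnorm H (W n))\<^sup>2 + 2 * (hnorm H (W m))\<^sup>2"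
      using hnorm_add_sq[OF W W] hnorm_diff_sq[OF W W] by simp
    moreover have "(hnorm H (W i))\<^sup>2 - 2 * Re (M i) < \<mu> + inverse (real (Suc i))" for i
      using P(2)[of i] unfolding J_def W_def M_def .
    from this[of n] this[of m] have "2 * (hnorm H (W n))\<^sup>2 + 2 * (hnorm H (W m))\<^sup>2 - 4 * Re (M n + M m)
        \<le> 4 * \<mu> + 2 * inverse (real (Suc n)) + 2 * inverse (real (Suc m))" by simp
    ultimately show ?thesis by linarith
  qed
  have "\<exists>N. \<forall>m\<ge>N. \<forall>n\<ge>N. hnorm H (\<lambda>x. W m x - W n x) < e" if "e > 0" for e
  proof -
    have "e\<^sup>2 / 4 > 0" using that by simp
    from reals_Archimedean[OF this] obtain N where N: "inverse (real (Suc N)) < e\<^sup>2 / 4" by blast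
    have "hnorm H (\<lambda>x. W m x - W n x) < e" if "m \<ge> N" "n \<ge> N" for m n
    proof -
      have "inverse (real (Suc m)) \<le> inverse (real (Suc N))" "inverse (real (Suc n)) \<le> inverse (real (Suc N))"
        using that by (simp_all add: le_imp_inverse_le)
      then have "(hnorm H (\<lambda>x. W m x - W n x))\<^sup>2 < e\<^sup>2" using par[of m n] N by linarith
      then show ?thesis by (rule power2_less_imp_less) (use \<open>e > 0\<close> in simp)
    qed
    then show ?thesis by blast
  qed
  then obtain a where a: "a \<in> elems H" and lim: "(\<lambda>n. hnorm H (\<lambda>x. W n x - a x)) \<longlonglongrightarrow> 0"
    using complete[of W] W by blast
  have ip_a: "ip H a w = m" if wm: "(w, m) \<in> V" for w m
  proof -
    have w: "w \<in> elems H" using V[OF wm] .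
    define b where "b = (\<lambda>n. ip H (W n) w - m)"
    have key: "(cmod (b n))\<^sup>2 \<le> inverse (real (Suc n)) * (hnorm H w)\<^sup>2" for n
    proof (cases "hnorm H w = 0")
      case True
      then have "b n = 0" using bound[OF wm] cauchy_schwarz[OF W w, of n] by (simp add: b_def)
      then show ?thesis by simp
    next
      case False
      define G where "G = (hnorm H w)\<^sup>2"
      have G: "G > 0" using False by (simp add: G_def)
      \<comment> \<open>The minimizer of the quadratic obtained by moving from \<open>W n\<close> in
        direction \<open>w\<close>; the gain |b n|^2 / G cannot exceed the gap 1/(n + 1) to the
        infimum.\<close>
      define t where "t = - b n / of_real G"
      have "((\<lambda>x. W n x + t * w x), M n + cnj t * m) \<in> V"
        using V_add[OF WM V_scale[OF wm]] .
      from mu_le[OF this]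
      have "\<mu> \<le> (hnorm H (\<lambda>x. W n x + t * w x))\<^sup>2 - 2 * Re (M n + cnj t * m)"
        unfolding J_def by simp
      also have "\<dots> = (hnorm H (W n))\<^sup>2 - 2 * Re (M n) + (cmod t)\<^sup>2 * G + 2 * Re (cnj t * b n)"
        using hnorm_add_sq[OF W scale_in[OF w]] hnorm_scale[OF w] ip_scale_right[OF w W]
        by (simp add: b_def G_def power_mult_distrib algebra_simps)
      also have "(cmod t)\<^sup>2 * G = (cmod (b n))\<^sup>2 / G"
        using G by (simp add: t_def norm_divide power_divide power2_eq_square)
      also have "Re (cnj t * b n) = - (cmod (b n))\<^sup>2 / G"
        unfolding t_def cmod_power2 by (simp add: power2_eq_square add_divide_distrib diff_divide_distrib)
      finally have "\<mu> + (cmod (b n))\<^sup>2 / G \<le> J (P n)" unfolding J_def W_def M_def by simp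
      then have "(cmod (b n))\<^sup>2 / G \<le> inverse (real (Suc n))" using P(2)[of n] by simp
      then show ?thesis using G unfolding G_def by (simp add: divide_le_eq)
    qed
    have "(\<lambda>n. inverse (real (Suc n)) * (hnorm H w)\<^sup>2) \<longlonglongrightarrow> 0"
      using tendsto_mult_right[OF LIMSEQ_inverse_real_of_nat, of "(hnorm H w)\<^sup>2"] by simp
    then have "(\<lambda>n. (cmod (b n))\<^sup>2) \<longlonglongrightarrow> 0"
      by (rule Lim_null_comparison[rotated]) (use key in simp)
    then have "(\<lambda>n. sqrt ((cmod (b n))\<^sup>2)) \<longlonglongrightarrow> sqrt 0" by (rule tendsto_real_sqrt)
    then have "(\<lambda>n. cmod (b n)) \<longlonglongrightarrow> 0" by simp
    then have "b \<longlonglongrightarrow> 0" by (rule tendsto_norm_zero_cancel)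
    have "b \<longlonglongrightarrow> ip H a w - m"
      unfolding b_def by (rule tendsto_diff[OF ip_limit[OF W a w lim] tendsto_const])
    from LIMSEQ_unique[OF this \<open>b \<longlonglongrightarrow> 0\<close>] have "ip H a w - m = 0" .
    then show ?thesis by simp
  qed
  have "hnorm H a \<le> C"
  proof -
    have l1: "(\<lambda>n. Re (cnj (ip H (W n) a))) \<longlonglongrightarrow> Re (cnj (ip H a a))"
      by (rule tendsto_Re[OF tendsto_cnj[OF ip_limit[OF W a a lim]]])
    have l2: "(\<lambda>n. C * hnorm H (W n)) \<longlonglongrightarrow> C * hnorm H a"
      by (rule tendsto_mult_left[OF hnorm_limit[OF W a lim]])
    have "Re (cnj (ip H (W n) a)) \<le> C * hnorm H (W n)" for n
      using ip_a[OF WM, of n] ip_cnj[OF W a, of n] bound[OF WM, of n] complex_Re_le_cmod[of "M n"] by simp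
    then have "Re (cnj (ip H a a)) \<le> C * hnorm H a"
      using LIMSEQ_le[OF l1 l2] by blast
    then have "hnorm H a * hnorm H a \<le> C * hnorm H a"
      using hnorm_sq[OF a] by (simp add: power2_eq_square)
    then show ?thesis using hnorm_nonneg[OF a] C by (cases "hnorm H a = 0") (auto simp: mult_le_cancel_right)
  qed
  moreover have "ip H a g = 0" if g: "g \<in> elems H" and o: "\<forall>w m. (w, m) \<in> V \<longrightarrow> ip H w g = 0" for g
  proof -
    have "ip H (W n) g = 0" for n using o WM by blast
    then show ?thesis using ip_limit[OF W a g lim] by (simp add: LIMSEQ_const_iff)
  qed
  ultimately show ?thesis using ip_a a by (intro bexI[of _ a] conjI) simp_all
qed

text \<open>Inner products are prescribed on a family of generators instead of a subspace. The
  scalars are conjugated because \<open>ip\<close> is antilinear in its second argument.\<close>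

lemma riesz_family:
  assumes v: "\<And>s. s \<in> X \<Longrightarrow> v s \<in> elems H" and C: "C \<ge> 0"
    and bound: "\<And>S c. finite S \<Longrightarrow> S \<subseteq> X \<Longrightarrow>
      cmod (\<Sum>s\<in>S. cnj (c s) * l s) \<le> C * hnorm H (\<lambda>x. \<Sum>s\<in>S. c s * v s x)"
  shows "\<exists>a\<in>elems H. hnorm H a \<le> C \<and> (\<forall>s\<in>X. ip H a (v s) = l s) \<and>
    (\<forall>g\<in>elems H. (\<forall>s\<in>X. ip H (v s) g = 0) \<longrightarrow> ip H a g = 0)"
proof -
  define V where "V = {((\<lambda>x. \<Sum>s\<in>S. c s * v s x), (\<Sum>s\<in>S. cnj (c s) * l s)) | S c. finite S \<and> S \<subseteq> X}"
  \<comment> \<open>Padding with zero coefficients puts two combinations over one index set, so that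
    they can be added.\<close>
  have extend: "((\<lambda>x. \<Sum>s\<in>S. c s * v s x) = (\<lambda>x. \<Sum>s\<in>T. (if s \<in> S then c s else 0) * v s x)) \<and>
      (\<Sum>s\<in>S. cnj (c s) * l s) = (\<Sum>s\<in>T. cnj (if s \<in> S then c s else 0) * l s)"
    if "finite T" "S \<subseteq> T" for S T c
  proof -
    have "(\<Sum>s\<in>S. c s * v s x) = (\<Sum>s\<in>T. (if s \<in> S then c s else 0) * v s x)" for x
      by (rule sum.mono_neutral_cong_left) (use that in auto)
    moreover have "(\<Sum>s\<in>S. cnj (c s) * l s) = (\<Sum>s\<in>T. cnj (if s \<in> S then c s else 0) * l s)"
      by (rule sum.mono_neutral_cong_left) (use that in auto)
    ultimately show ?thesis by blast
  qed
  have "\<exists>a\<in>elems H. hnorm H a \<le> C \<and> (\<forall>w m. (w, m) \<in> V \<longrightarrow> ip H a w = m) \<and>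
    (\<forall>g\<in>elems H. (\<forall>w m. (w, m) \<in> V \<longrightarrow> ip H w g = 0) \<longrightarrow> ip H a g = 0)"
  proof (rule riesz_graph[of V C])
    have "((\<lambda>x. \<Sum>s\<in>{}. (0::complex) * v s x), (\<Sum>s\<in>{}. cnj 0 * l s)) \<in> V"
      unfolding V_def by (intro CollectI exI[of _ "{}"] exI[of _ "\<lambda>_. 0"]) simp
    then show "V \<noteq> {}" by blast
    show "w \<in> elems H" if "(w, m) \<in> V" for w m
      using that v unfolding V_def by (auto intro!: sum_in scale_in)
    show "cmod m \<le> C * hnorm H w" if "(w, m) \<in> V" for w m
      using that bound unfolding V_def by auto
    show "((\<lambda>x. a * w x), cnj a * m) \<in> V" if wm: "(w, m) \<in> V" for w m a
    proof -
      obtain S c where S: "finite S" "S \<subseteq> X" "w = (\<lambda>x. \<Sum>s\<in>S. c s * v s x)" "m = (\<Sum>s\<in>S. cnj (c s) * l s)"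
        using wm unfolding V_def by blast
      have "(\<lambda>x. a * w x) = (\<lambda>x. \<Sum>s\<in>S. (a * c s) * v s x)" "cnj a * m = (\<Sum>s\<in>S. cnj (a * c s) * l s)"
        unfolding S by (simp_all add: sum_distrib_left mult.assoc)
      then show ?thesis unfolding V_def
        using S(1,2) by (intro CollectI exI[of _ S] exI[of _ "\<lambda>s. a * c s"]) simp
    qed
    show "((\<lambda>x. w x + w' x), m + m') \<in> V" if wm: "(w, m) \<in> V" and wm': "(w', m') \<in> V" for w m w' m'
    proof -
      obtain S c where S: "finite S" "S \<subseteq> X" "w = (\<lambda>x. \<Sum>s\<in>S. c s * v s x)" "m = (\<Sum>s\<in>S. cnj (c s) * l s)"
        using wm unfolding V_def by blast
      obtain S' c' where S': "finite S'" "S' \<subseteq> X" "w' = (\<lambda>x. \<Sum>s\<in>S'. c' s * v s x)" "m' = (\<Sum>s\<in>S'. cnj (c' s) * l s)"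
        using wm' unfolding V_def by blast
      let ?T = "S \<union> S'"
      let ?d = "\<lambda>s. (if s \<in> S then c s else 0) + (if s \<in> S' then c' s else 0)"
      note e = extend[of ?T S c, OF finite_UnI[OF S(1) S'(1)] Un_upper1]
        and e' = extend[of ?T S' c', OF finite_UnI[OF S(1) S'(1)] Un_upper2]
      have "(\<lambda>x. w x + w' x) = (\<lambda>x. \<Sum>s\<in>?T. ?d s * v s x)"
        unfolding S(3) S'(3) conjunct1[OF e, THEN fun_cong] conjunct1[OF e', THEN fun_cong]
        by (simp only: sum.distrib distrib_right)
      moreover have "m + m' = (\<Sum>s\<in>?T. cnj (?d s) * l s)"
        unfolding S(4) S'(4) conjunct2[OF e] conjunct2[OF e']
        by (simp only: sum.distrib distrib_right complex_cnj_add)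
      ultimately show ?thesis unfolding V_def
        using S(1,2) S'(1,2) by (intro CollectI exI[of _ ?T] exI[of _ ?d]) simp
    qed
  qed (fact C)
  then obtain a where a: "a \<in> elems H" "hnorm H a \<le> C" "\<And>w m. (w, m) \<in> V \<Longrightarrow> ip H a w = m"
    "\<And>g. g \<in> elems H \<Longrightarrow> \<forall>w m. (w, m) \<in> V \<longrightarrow> ip H w g = 0 \<Longrightarrow> ip H a g = 0"
    by (elim bexE conjE) simp
  have l: "ip H a (v s) = l s" if "s \<in> X" for s
  proof -
    have "((\<lambda>x. \<Sum>s\<in>{s}. (\<lambda>_. 1) s * v s x), (\<Sum>s\<in>{s}. cnj ((\<lambda>_. 1) s) * l s)) \<in> V"
      unfolding V_def using that by (intro CollectI exI[of _ "{s}"] exI[of _ "\<lambda>_. 1"]) simp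
    then have "(v s, l s) \<in> V" by simp
    then show ?thesis by (rule a(3))
  qed
  have "ip H a g = 0" if g: "g \<in> elems H" and o: "\<forall>s\<in>X. ip H (v s) g = 0" for g
  proof (rule a(4)[OF g], intro allI impI)
    fix w m assume "(w, m) \<in> V"
    then obtain S c where S: "S \<subseteq> X" "w = (\<lambda>x. \<Sum>s\<in>S. c s * v s x)" unfolding V_def by blast
    show "ip H w g = 0" unfolding S(2)
      by (subst ip_sum) (use S(1) v g o in \<open>auto simp: scale_in ip_scale subset_iff\<close>)
  qed
  with l show ?thesis by (intro bexI[of _ a] conjI ballI impI a(1,2)) simp_all
qed

text \<open>A function is recovered from its bounded action on the span of the kernels. This gives
  membership for functions known only pointwise: images of Fock space vectors, and pointwise
  limits.\<close>

lemma kernel_criterion: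
  assumes supp: "\<And>x. x \<notin> points H \<Longrightarrow> f x = 0" and C: "C \<ge> 0"
    and bound: "\<And>S c. finite S \<Longrightarrow> S \<subseteq> points H \<Longrightarrow>
      cmod (\<Sum>y\<in>S. cnj (c y) * f y) \<le>
      C * hnorm H (\<lambda>x. \<Sum>y\<in>S. c y * (if x \<in> points H then k x y else 0))"
  shows "f \<in> elems H \<and> hnorm H f \<le> C"
proof -
  define v where "v = (\<lambda>y x. if x \<in> points H then k x y else 0)"
  have v: "v s \<in> elems H" if "s \<in> points H" for s
    unfolding v_def by (rule kernel_in[OF that])
  have b: "cmod (\<Sum>y\<in>S. cnj (c y) * f y) \<le> C * hnorm H (\<lambda>x. \<Sum>y\<in>S. c y * v y x)"
    if "finite S" "S \<subseteq> points H" for S c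
    unfolding v_def by (rule bound[OF that])
  have "\<exists>a\<in>elems H. hnorm H a \<le> C \<and> (\<forall>y\<in>points H. ip H a (v y) = f y) \<and>
    (\<forall>g\<in>elems H. (\<forall>y\<in>points H. ip H (v y) g = 0) \<longrightarrow> ip H a g = 0)"
    by (rule riesz_family[of "points H" v C f, OF v C b])
  then obtain a where a: "a \<in> elems H" "hnorm H a \<le> C" "\<forall>y\<in>points H. ip H a (v y) = f y"
    by (elim bexE conjE) simp
  have "a = f"
  proof
    fix y
    show "a y = f y"
      using bspec[OF a(3), of y] reproducing[OF a(1), of y] elems_support[OF a(1), of y] supp[of y]
      unfolding v_def by (cases "y \<in> points H") simp_all
  qed
  then show ?thesis using a by simp
qed

end

section \<open>Square-summable families\<close>

text \<open>Encoded as a Hilbert function space, with the Kronecker delta as kernel, so that the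
  Cauchy-Schwarz and Riesz lemmas above apply to it. The index type is arbitrary because words and
  pairs of a word and a natural number both occur.\<close>

definition ell2 :: "'i hfs" where
  "ell2 = \<lparr>points = UNIV, elems = {a. (\<lambda>i. (cmod (a i))\<^sup>2) summable_on UNIV},
     ip = (\<lambda>a b. \<Sum>\<^sub>\<infinity>i. a i * cnj (b i))\<rparr>"

lemma ell2_iff: "a \<in> elems ell2 \<longleftrightarrow> (\<lambda>i. (cmod (a i))\<^sup>2) summable_on UNIV"
  and ell2_ip: "ip ell2 a b = (\<Sum>\<^sub>\<infinity>i. a i * cnj (b i))"
  and ell2_points [simp]: "points ell2 = UNIV"
  by (simp_all add: ell2_def)

lemma ell2_prod_summable:
  assumes "a \<in> elems ell2" "b \<in> elems ell2"
  shows "(\<lambda>i. a i * b i) summable_on UNIV"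
  by (rule abs_summable_summable[OF abs_summable_product])
    (use assms in \<open>simp_all add: ell2_iff norm_mult power2_eq_square\<close>)

lemma ell2_cnj: "a \<in> elems ell2 \<Longrightarrow> (\<lambda>i. cnj (a i)) \<in> elems ell2"
  by (simp add: ell2_iff)

lemma ell2_ip_has_sum:
  assumes "a \<in> elems ell2" "b \<in> elems ell2"
  shows "((\<lambda>i. a i * cnj (b i)) has_sum ip ell2 a b) UNIV"
  unfolding ell2_ip by (rule has_sum_infsum[OF ell2_prod_summable[OF assms(1) ell2_cnj[OF assms(2)]]])

lemma infsum_of_real_complex: "(\<Sum>\<^sub>\<infinity>i\<in>A. complex_of_real (f i)) = of_real (infsum f A)"
proof (cases "f summable_on A")
  case True
  then show ?thesis by (intro infsumI has_sum_of_real has_sum_infsum)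
next
  case False
  then have "\<not> (\<lambda>i. complex_of_real (f i)) summable_on A"
    using summable_on_Re[of "\<lambda>i. complex_of_real (f i)" A] by auto
  with False show ?thesis by (simp add: infsum_not_exists)
qed

lemma ell2_ip_self: "ip ell2 a a = of_real (\<Sum>\<^sub>\<infinity>i. (cmod (a i))\<^sup>2)"
proof -
  have "ip ell2 a a = (\<Sum>\<^sub>\<infinity>i. of_real ((cmod (a i))\<^sup>2))"
    unfolding ell2_ip by (simp add: complex_norm_square del: of_real_power)
  also have "\<dots> = of_real (\<Sum>\<^sub>\<infinity>i. (cmod (a i))\<^sup>2)" by (rule infsum_of_real_complex)
  finally show ?thesis .
qed

lemma ell2_hnorm_sq: "(hnorm ell2 a)\<^sup>2 = (\<Sum>\<^sub>\<infinity>i. (cmod (a i))\<^sup>2)"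
  unfolding hnorm_def ell2_ip_self by (simp add: infsum_nonneg)

lemma ell2_hnorm_nonneg [simp]: "0 \<le> hnorm ell2 a"
  unfolding hnorm_def ell2_ip_self by (simp add: infsum_nonneg)

lemma ell2_has_sum_norm:
  "a \<in> elems ell2 \<Longrightarrow> ((\<lambda>i. (cmod (a i))\<^sup>2) has_sum (hnorm ell2 a)\<^sup>2) UNIV"
  unfolding ell2_hnorm_sq ell2_iff by simp

lemma ell2_finite_sum_le:
  "a \<in> elems ell2 \<Longrightarrow> finite S \<Longrightarrow> (\<Sum>i\<in>S. (cmod (a i))\<^sup>2) \<le> (hnorm ell2 a)\<^sup>2"
  by (rule finite_sum_le_has_sum[OF ell2_has_sum_norm]) auto

lemma ell2_point_le: "a \<in> elems ell2 \<Longrightarrow> cmod (a i) \<le> hnorm ell2 a"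
  by (rule power2_le_imp_le) (use ell2_finite_sum_le[of a "{i}"] in auto)

lemma ell2_boundI:
  assumes bound: "\<And>S. finite S \<Longrightarrow> (\<Sum>i\<in>S. (cmod (a i))\<^sup>2) \<le> B" and C: "C \<ge> 0" "B \<le> C\<^sup>2"
  shows "a \<in> elems ell2" "hnorm ell2 a \<le> C"
proof -
  show a: "a \<in> elems ell2" unfolding ell2_iff
    by (rule nonneg_bdd_above_summable_on) (use bound in \<open>auto intro!: bdd_aboveI2\<close>)
  have "(hnorm ell2 a)\<^sup>2 \<le> B" unfolding ell2_hnorm_sq
    by (rule infsum_le_finite_sums) (use a bound ell2_iff in auto)
  then show "hnorm ell2 a \<le> C" by (rule power2_le_imp_le[OF order_trans]) (use C in auto)
qed

lemma ell2_add:
  assumes "a \<in> elems ell2" "b \<in> elems ell2"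
  shows "(\<lambda>i. a i + b i) \<in> elems ell2"
  unfolding ell2_iff
proof (rule summable_on_comparison_test)
  show "(\<lambda>i. 2 * (cmod (a i))\<^sup>2 + 2 * (cmod (b i))\<^sup>2) summable_on UNIV"
    using assms unfolding ell2_iff
    by (rule summable_on_add[OF summable_on_cmult_right summable_on_cmult_right])
  show "(cmod (a i + b i))\<^sup>2 \<le> 2 * (cmod (a i))\<^sup>2 + 2 * (cmod (b i))\<^sup>2" for i
  proof -
    have "(cmod (a i + b i))\<^sup>2 \<le> (cmod (a i) + cmod (b i))\<^sup>2"
      by (intro power_mono norm_triangle_ineq) auto
    then show ?thesis
      using sum_squares_bound[of "cmod (a i)" "cmod (b i)"] by (simp add: power2_sum)
  qed
qed auto

lemma ell2_scale: "a \<in> elems ell2 \<Longrightarrow> (\<lambda>i. c * a i) \<in> elems ell2"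
  unfolding ell2_iff by (simp add: norm_mult power_mult_distrib summable_on_cmult_right)

lemma ell2_diff: "a \<in> elems ell2 \<Longrightarrow> b \<in> elems ell2 \<Longrightarrow> (\<lambda>i. a i - b i) \<in> elems ell2"
  using ell2_add[OF _ ell2_scale[of b "-1"], of a] by simp

lemma ell2_complete:
  fixes F :: "nat \<Rightarrow> 'i \<Rightarrow> complex"
  assumes F: "\<And>n. F n \<in> elems ell2"
    and cauchy: "\<And>e. e > 0 \<Longrightarrow> \<exists>N. \<forall>m\<ge>N. \<forall>n\<ge>N. hnorm ell2 (\<lambda>x. F m x - F n x) < e"
  shows "\<exists>f\<in>elems ell2. (\<lambda>n. hnorm ell2 (\<lambda>x. F n x - f x)) \<longlonglongrightarrow> 0"
proof -
  have "Cauchy (\<lambda>n. F n i)" for i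
  proof (rule metric_CauchyI)
    fix e :: real assume "e > 0"
    with cauchy obtain N where N: "\<And>m n. m \<ge> N \<Longrightarrow> n \<ge> N \<Longrightarrow> hnorm ell2 (\<lambda>x. F m x - F n x) < e" by blast
    show "\<exists>N. \<forall>m\<ge>N. \<forall>n\<ge>N. dist (F m i) (F n i) < e"
    proof (intro exI[of _ N] allI impI)
      fix m n assume "m \<ge> N" "n \<ge> N"
      then show "dist (F m i) (F n i) < e"
        using N[of m n] ell2_point_le[OF ell2_diff[OF F[of m] F[of n]], of i] by (simp add: dist_norm)
    qed
  qed
  then have "\<exists>l. (\<lambda>n. F n i) \<longlonglongrightarrow> l" for i
    using Cauchy_convergent convergent_def by blast
  then obtain f where f: "\<And>i. (\<lambda>n. F n i) \<longlonglongrightarrow> f i" by metis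
  \<comment> \<open>A Fatou argument: bounds on finite partial sums survive the coordinatewise
    limit.\<close>
  have key: "(\<lambda>x. F n x - f x) \<in> elems ell2 \<and> hnorm ell2 (\<lambda>x. F n x - f x) \<le> e"
    if N: "\<And>m. m \<ge> N \<Longrightarrow> hnorm ell2 (\<lambda>x. F n x - F m x) < e" and e: "e > 0" for n N e
  proof -
    have "(\<Sum>i\<in>S. (cmod (F n i - f i))\<^sup>2) \<le> e\<^sup>2" if "finite S" for S
    proof (rule tendsto_upperbound)
      show "(\<lambda>m. \<Sum>i\<in>S. (cmod (F n i - F m i))\<^sup>2) \<longlonglongrightarrow> (\<Sum>i\<in>S. (cmod (F n i - f i))\<^sup>2)"
        by (intro tendsto_intros f)
      have "(\<Sum>i\<in>S. (cmod (F n i - F m i))\<^sup>2) \<le> e\<^sup>2" if "m \<ge> N" for m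
      proof -
        have "(hnorm ell2 (\<lambda>x. F n x - F m x))\<^sup>2 \<le> e\<^sup>2"
          using N[OF that] by (intro power_mono) auto
        then show ?thesis
          using ell2_finite_sum_le[OF ell2_diff[OF F[of n] F[of m]] \<open>finite S\<close>] by linarith
      qed
      then show "\<forall>\<^sub>F m in sequentially. (\<Sum>i\<in>S. (cmod (F n i - F m i))\<^sup>2) \<le> e\<^sup>2"
        using eventually_sequentially by blast
    qed auto
    then show ?thesis using ell2_boundI[of "\<lambda>x. F n x - f x" "e\<^sup>2" e] e by simp
  qed
  have lim: "(\<lambda>n. hnorm ell2 (\<lambda>x. F n x - f x)) \<longlonglongrightarrow> 0"
  proof (rule LIMSEQ_I)
    fix e :: real assume e: "e > 0"
    then have "e / 2 > 0" by simp
    with cauchy obtain N where N: "\<And>m n. m \<ge> N \<Longrightarrow> n \<ge> N \<Longrightarrow> hnorm ell2 (\<lambda>x. F m x - F n x) < e / 2" by blast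
    have "norm (hnorm ell2 (\<lambda>x. F n x - f x) - 0) < e" if "n \<ge> N" for n
      using key[of N n "e / 2"] N[OF that] e by simp
    then show "\<exists>N. \<forall>n\<ge>N. norm (hnorm ell2 (\<lambda>x. F n x - f x) - 0) < e" by blast
  qed
  obtain N where N: "\<And>m n. m \<ge> N \<Longrightarrow> n \<ge> N \<Longrightarrow> hnorm ell2 (\<lambda>x. F m x - F n x) < 1"
    using cauchy[of 1] by auto
  have "(\<lambda>x. F N x - f x) \<in> elems ell2" using key[of N N 1] N by simp
  from ell2_diff[OF F[of N] this] have "f \<in> elems ell2" by simp
  with lim show ?thesis by blast
qed

lemma ell2_hilbert: "hilbert_function_space ell2 (\<lambda>x y. of_bool (x = y))"
proof -
  have delta: "(\<lambda>i. of_bool (i = y)) \<in> elems ell2" for y :: 'i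
    unfolding ell2_iff
    by (rule finite_nonzero_values_imp_summable_on) (rule finite_subset[of _ "{y}"], auto)
  show ?thesis
  proof
    fix a b c :: "'i \<Rightarrow> complex" and z :: complex
    assume a: "a \<in> elems ell2" and b: "b \<in> elems ell2"
    show "ip ell2 b a = cnj (ip ell2 a b)"
      unfolding ell2_ip infsum_cnj[symmetric] by (simp add: mult.commute)
    show "ip ell2 (\<lambda>x. z * a x) b = z * ip ell2 a b"
      by (rule has_sum_unique[OF ell2_ip_has_sum[OF ell2_scale[OF a] b]])
        (use has_sum_cmult_right[OF ell2_ip_has_sum[OF a b], of z] in \<open>simp add: mult.assoc\<close>)
    assume c: "c \<in> elems ell2"
    show "ip ell2 (\<lambda>x. a x + b x) c = ip ell2 a c + ip ell2 b c"
      by (rule has_sum_unique[OF ell2_ip_has_sum[OF ell2_add[OF a b] c]])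
        (use has_sum_add[OF ell2_ip_has_sum[OF a c] ell2_ip_has_sum[OF b c]] in \<open>simp add: distrib_right\<close>)
  next
    fix a :: "'i \<Rightarrow> complex" assume a: "a \<in> elems ell2" "a \<noteq> (\<lambda>x. 0)"
    then obtain i where i: "a i \<noteq> 0" by auto
    have "0 < (cmod (a i))\<^sup>2" using i by simp
    also have "\<dots> \<le> (hnorm ell2 a)\<^sup>2" using ell2_finite_sum_le[OF a(1), of "{i}"] by simp
    finally show "Re (ip ell2 a a) > 0" unfolding ell2_ip_self ell2_hnorm_sq by simp
  next
    fix F :: "nat \<Rightarrow> 'i \<Rightarrow> complex"
    assume "\<And>n. F n \<in> elems ell2"
      "\<And>e. e > 0 \<Longrightarrow> \<exists>N. \<forall>m\<ge>N. \<forall>n\<ge>N. hnorm ell2 (\<lambda>x. F m x - F n x) < e"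
    then show "\<exists>f\<in>elems ell2. (\<lambda>n. hnorm ell2 (\<lambda>x. F n x - f x)) \<longlonglongrightarrow> 0"
      by (rule ell2_complete)
  next
    fix f :: "'i \<Rightarrow> complex" and y assume f: "f \<in> elems ell2"
    have "((\<lambda>i. f i * cnj (of_bool (i = y))) has_sum f y) UNIV"
      by (rule has_sum_finite_neutralI[of "{y}"]) auto
    then show "f y = ip ell2 f (\<lambda>x. if x \<in> points ell2 then of_bool (x = y) else 0)"
      unfolding ell2_ip by (simp add: infsumI)
  qed (use ell2_add ell2_scale delta in \<open>auto simp: ell2_iff\<close>)
qed

interpretation ell2: hilbert_function_space ell2 "\<lambda>x y. of_bool (x = y)"
  by (rule ell2_hilbert)

section \<open>The full Fock space\<close>

lemma has_sum_times:
  fixes f :: "'a \<Rightarrow> complex" and g :: "'b \<Rightarrow> complex"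
  assumes f: "(f has_sum a) A" and g: "(g has_sum b) B"
  shows "((\<lambda>(x, y). f x * g y) has_sum a * b) (A \<times> B)"
proof -
  have nf: "(\<lambda>x. norm (f x)) summable_on A"
    using f summable_on_iff_abs_summable_on_complex has_sum_imp_summable by blast
  have ng: "(\<lambda>y. norm (g y)) summable_on B"
    using g summable_on_iff_abs_summable_on_complex has_sum_imp_summable by blast
  have "(\<lambda>p. norm (f (fst p) * g (snd p))) summable_on (Sigma A (\<lambda>_. B))"
  proof (rule summable_on_SigmaI)
    show "((\<lambda>y. norm (f (fst (x, y)) * g (snd (x, y)))) has_sum norm (f x) * infsum (\<lambda>y. norm (g y)) B) B" for x
      unfolding norm_mult fst_conv snd_conv by (rule has_sum_cmult_right[OF has_sum_infsum[OF ng]])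
    show "(\<lambda>x. norm (f x) * infsum (\<lambda>y. norm (g y)) B) summable_on A"
      by (rule summable_on_cmult_left[OF nf])
  qed auto
  then have "(\<lambda>p. f (fst p) * g (snd p)) summable_on (Sigma A (\<lambda>_. B))"
    by (rule abs_summable_summable)
  then have "((\<lambda>p. f (fst p) * g (snd p)) has_sum a * b) (Sigma A (\<lambda>_. B))"
    by (rule has_sum_SigmaI[rotated 2, where g = "\<lambda>x. f x * b"])
      (auto intro: has_sum_cmult_right[OF g] has_sum_cmult_left[OF f])
  then show ?thesis by (simp add: case_prod_unfold)
qed

lemma words_length_has_sum:
  fixes g :: "'l \<Rightarrow> complex"
  assumes g: "(g has_sum G) UNIV"
  shows "((\<lambda>w. prod_list (map g w)) has_sum G ^ n) {w. length w = n}"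
proof (induction n)
  case 0
  have "{w::'l list. length w = 0} = {[]}" by auto
  then show ?case by (simp add: has_sum_finiteI)
next
  case (Suc n)
  have eq: "{w::'l list. length w = Suc n} = (\<lambda>(i, w). i # w) ` (UNIV \<times> {w. length w = n})"
    by (auto simp: length_Suc_conv image_iff)
  have "((\<lambda>(i, w). g i * prod_list (map g w)) has_sum G * G ^ n) (UNIV \<times> {w. length w = n})"
    by (rule has_sum_times[OF g Suc.IH])
  moreover have "((\<lambda>w. prod_list (map g w)) \<circ> (\<lambda>(i, w). i # w)) = (\<lambda>(i, w). g i * prod_list (map g w))"
    by auto
  ultimately show ?case unfolding eq by (subst has_sum_reindex) (auto simp: inj_on_def)
qed

text \<open>Words of length n contribute G^n, so grouping by length gives a geometric series; the
  absolute sum \<open>R\<close> < 1 justifies the regrouping.\<close>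

lemma words_has_sum:
  fixes g :: "'l \<Rightarrow> complex"
  assumes g: "(g has_sum G) UNIV" and R: "((\<lambda>i. norm (g i)) has_sum R) UNIV" and R1: "R < 1"
  shows "((\<lambda>w. prod_list (map g w)) has_sum 1 / (1 - G)) UNIV"
proof -
  let ?L = "\<lambda>n. {w::'l list. length w = n}"
  have R0: "R \<ge> 0" by (rule has_sum_nonneg[OF R]) auto
  have "norm G \<le> R" by (rule norm_infsum_le[OF g R]) auto
  then have G1: "norm G < 1" using R1 by simp
  have pn: "prod_list (map (\<lambda>i. complex_of_real (norm (g i))) w) = complex_of_real (norm (prod_list (map g w)))" for w
    by (induction w) (auto simp: norm_mult)
  have "((\<lambda>w. complex_of_real (norm (prod_list (map g w)))) has_sum complex_of_real R ^ n) (?L n)" for n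
    using words_length_has_sum[OF has_sum_of_real[OF R], where ?n = n] by (simp only: pn)
  from has_sum_Re[OF this] have norms: "((\<lambda>w. norm (prod_list (map g w))) has_sum R ^ n) (?L n)" for n
    by (simp flip: of_real_power)
  have geo: "((\<lambda>n. G ^ n) has_sum 1 / (1 - G)) UNIV"
    by (rule norm_summable_imp_has_sum) (use G1 in \<open>auto simp: norm_power geometric_sums summable_geometric\<close>)
  have "(\<lambda>p. norm (prod_list (map g (snd p)))) summable_on Sigma UNIV ?L"
  proof (rule summable_on_SigmaI)
    show "((\<lambda>w. norm (prod_list (map g (snd (n, w))))) has_sum R ^ n) (?L n)" for n
      using norms by simp
    show "(\<lambda>n. R ^ n) summable_on (UNIV :: nat set)"
      unfolding summable_on_UNIV_nonneg_real_iff[OF zero_le_power[OF R0]]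
      using R0 R1 by (simp add: summable_geometric)
  qed auto
  then have "(\<lambda>p. prod_list (map g (snd p))) summable_on Sigma UNIV ?L"
    by (rule abs_summable_summable)
  then have "((\<lambda>p. prod_list (map g (snd p))) has_sum 1 / (1 - G)) (Sigma UNIV ?L)"
    by (rule has_sum_SigmaI[rotated 2, where g = "\<lambda>n. G ^ n"])
      (auto intro: words_length_has_sum[OF g] geo)
  moreover have "bij_betw snd (Sigma UNIV ?L) UNIV"
    by (rule bij_betwI[where g = "\<lambda>w. (length w, w)"]) auto
  ultimately show ?thesis using has_sum_reindex_bij_betw[of snd "Sigma UNIV ?L" UNIV "\<lambda>w. prod_list (map g w)"] by simp
qed

section \<open>The kernel space as a quotient of the Fock space\<close>

locale cnp_space = hilbert_function_space H k for H :: "'a hfs" and k +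
  fixes u :: "'a \<Rightarrow> 'l \<Rightarrow> complex"
  assumes u_summable: "x \<in> points H \<Longrightarrow> (\<lambda>i. (cmod (u x i))\<^sup>2) summable_on UNIV"
    and u_less: "x \<in> points H \<Longrightarrow> (\<Sum>\<^sub>\<infinity>i. (cmod (u x i))\<^sup>2) < 1"
    and kernel_eq: "x \<in> points H \<Longrightarrow> y \<in> points H \<Longrightarrow> k x y = 1 / (1 - (\<Sum>\<^sub>\<infinity>i. u x i * cnj (u y i)))"
begin

definition mon :: "'a \<Rightarrow> 'l list \<Rightarrow> complex" where
  "mon x w = prod_list (map (u x) w)"

lemma mon_append: "mon x (v @ w) = mon x v * mon x w"
  by (simp add: mon_def)

lemma mon_has_sum:
  assumes x: "x \<in> points H" and y: "y \<in> points H"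
  shows "((\<lambda>w. mon x w * cnj (mon y w)) has_sum k x y) UNIV"
proof -
  have ell: "(u x) \<in> elems ell2" "(u y) \<in> elems ell2"
    using u_summable x y by (auto simp: ell2_iff)
  have less: "hnorm ell2 (u x) < 1" "hnorm ell2 (u y) < 1"
    using u_less x y unfolding ell2_hnorm_sq[symmetric]
    by (metis ell2_hnorm_nonneg one_power2 power2_less_imp_less zero_le_one)+
  have s: "((\<lambda>i. u x i * cnj (u y i)) has_sum ip ell2 (u x) (u y)) UNIV"
    by (rule ell2_ip_has_sum[OF ell])
  let ?a = "\<lambda>i. complex_of_real (cmod (u x i))" and ?b = "\<lambda>i. complex_of_real (cmod (u y i))"
  have ab: "?a \<in> elems ell2" "?b \<in> elems ell2" using ell by (auto simp: ell2_iff)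
  have "((\<lambda>i. ?a i * cnj (?b i)) has_sum ip ell2 ?a ?b) UNIV"
    by (rule ell2_ip_has_sum[OF ab])
  from has_sum_Re[OF this] have R: "((\<lambda>i. norm (u x i * cnj (u y i))) has_sum Re (ip ell2 ?a ?b)) UNIV"
    by (simp add: norm_mult flip: of_real_mult)
  have "Re (ip ell2 ?a ?b) \<le> hnorm ell2 ?a * hnorm ell2 ?b"
    using ell2.cauchy_schwarz[OF ab] complex_Re_le_cmod order_trans by blast
  also have "hnorm ell2 ?a = hnorm ell2 (u x)"
    by (simp add: hnorm_def ell2_ip_self)
  also have "hnorm ell2 ?b = hnorm ell2 (u y)"
    by (simp add: hnorm_def ell2_ip_self)
  also have "hnorm ell2 (u x) * hnorm ell2 (u y) < 1"
    using mult_strict_mono'[OF less] by simp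
  finally have "Re (ip ell2 ?a ?b) < 1" .
  from words_has_sum[OF s R this]
  have "((\<lambda>w. prod_list (map (\<lambda>i. u x i * cnj (u y i)) w)) has_sum k x y) UNIV"
    unfolding kernel_eq[OF x y] infsumI[OF s] .
  moreover have "prod_list (map (\<lambda>i. u x i * cnj (u y i)) w) = mon x w * cnj (mon y w)" for w
    unfolding mon_def by (induction w) auto
  ultimately show ?thesis by simp
qed

text \<open>The Fock space vector that represents evaluation at \<open>x\<close>; the Gram matrix of
  these vectors is the kernel.\<close>

definition pt :: "'a \<Rightarrow> 'l list \<Rightarrow> complex" where
  "pt x w = cnj (mon x w)"

lemma pt_in: "x \<in> points H \<Longrightarrow> pt x \<in> elems ell2"
proof -
  assume x: "x \<in> points H"
  have "(\<lambda>w. Re (mon x w * cnj (mon x w))) summable_on UNIV"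
    by (rule summable_on_Re[OF has_sum_imp_summable[OF mon_has_sum[OF x x]]])
  moreover have "Re (mon x w * cnj (mon x w)) = (cmod (pt x w))\<^sup>2" for w
    by (simp add: pt_def flip: complex_norm_square)
  ultimately show ?thesis by (simp add: ell2_iff)
qed

lemma ip_pt: "x \<in> points H \<Longrightarrow> y \<in> points H \<Longrightarrow> ip ell2 (pt y) (pt x) = k x y"
  using infsumI[OF mon_has_sum, of x y] unfolding ell2_ip pt_def by (simp add: mult.commute)

text \<open>The quotient map from the full Fock space, which lets the letters commute.\<close>

definition ab :: "('l list \<Rightarrow> complex) \<Rightarrow> 'a \<Rightarrow> complex" where
  "ab a x = (if x \<in> points H then \<Sum>\<^sub>\<infinity>w. a w * mon x w else 0)"

lemma ab_ip: "x \<in> points H \<Longrightarrow> ab a x = ip ell2 a (pt x)"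
  by (simp add: ab_def ell2_ip pt_def)

lemma ab_has_sum: "a \<in> elems ell2 \<Longrightarrow> x \<in> points H \<Longrightarrow> ((\<lambda>w. a w * mon x w) has_sum ab a x) UNIV"
  using ell2_ip_has_sum[OF _ pt_in, of a x] by (simp add: ab_ip) (simp add: pt_def)

definition ker :: "'a \<Rightarrow> 'a \<Rightarrow> complex" where
  "ker y = (\<lambda>x. if x \<in> points H then k x y else 0)"

lemma ker_in: "y \<in> points H \<Longrightarrow> ker y \<in> elems H"
  unfolding ker_def by (rule kernel_in)

lemma ip_ker: "f \<in> elems H \<Longrightarrow> y \<in> points H \<Longrightarrow> ip H f (ker y) = f y"
  unfolding ker_def using reproducing[of f y] by simp

text \<open>Point vectors and kernel functions have the same Gram matrix. This transports bounds for
  functionals between \<open>H\<close> and the Fock space, in both directions.\<close>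

lemma gram:
  assumes S: "finite S" "S \<subseteq> points H"
  shows "hnorm ell2 (\<lambda>w. \<Sum>y\<in>S. c y * pt y w) = hnorm H (\<lambda>x. \<Sum>y\<in>S. c y * ker y x)"
proof -
  let ?a = "\<lambda>w. \<Sum>y\<in>S. c y * pt y w" and ?f = "\<lambda>x. \<Sum>y\<in>S. c y * ker y x"
  have a: "?a \<in> elems ell2"
    by (rule ell2.sum_in, rule ell2_scale, rule pt_in) (use S in auto)
  have f: "?f \<in> elems H"
    by (rule sum_in, rule scale_in, rule ker_in) (use S in auto)
  have "ip ell2 ?a (pt z) = ip H ?f (ker z)" if z: "z \<in> points H" for z
  proof -
    have "ip ell2 ?a (pt z) = (\<Sum>y\<in>S. c y * k z y)"
      using S z by (subst ell2.ip_sum) (auto intro!: sum.cong simp: ell2_scale pt_in ell2.ip_scale ip_pt)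
    moreover have "ip H ?f (ker z) = (\<Sum>y\<in>S. c y * k z y)"
      using S z f by (subst ip_ker) (auto intro!: sum.cong simp: ker_def)
    ultimately show ?thesis by simp
  qed
  then have eq: "cnj (ip ell2 ?a (pt z)) = cnj (ip H ?f (ker z))" if "z \<in> points H" for z
    using that by simp
  have "ip ell2 ?a ?a = (\<Sum>z\<in>S. c z * ip ell2 (pt z) ?a)"
    using S a by (subst ell2.ip_sum) (auto intro!: sum.cong simp: ell2_scale pt_in ell2.ip_scale)
  also have "\<dots> = (\<Sum>z\<in>S. c z * ip H (ker z) ?f)"
    using S a f eq by (intro sum.cong refl) (auto simp: ell2.ip_cnj[OF a pt_in] ip_cnj[OF f ker_in] subset_iff)
  also have "\<dots> = ip H ?f ?f"
  proof -
    have "ip H ?f g = (\<Sum>z\<in>S. c z * ip H (ker z) g)" if "g \<in> elems H" for g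
      using S that by (subst ip_sum) (auto intro!: sum.cong simp: scale_in ker_in ip_scale)
    from this[OF f] show ?thesis ..
  qed
  finally show ?thesis by (simp add: hnorm_def)
qed

lemma ab_in:
  assumes a: "a \<in> elems ell2"
  shows "ab a \<in> elems H" "hnorm H (ab a) \<le> hnorm ell2 a"
proof -
  have "ab a \<in> elems H \<and> hnorm H (ab a) \<le> hnorm ell2 a"
  proof (rule kernel_criterion)
    fix S c assume S: "finite S" "S \<subseteq> points H"
    have v: "(\<lambda>w. \<Sum>y\<in>S. c y * pt y w) \<in> elems ell2"
      by (rule ell2.sum_in, rule ell2_scale, rule pt_in) (use S in auto)
    have "(\<Sum>y\<in>S. cnj (c y) * ab a y) = cnj (\<Sum>y\<in>S. c y * ip ell2 (pt y) a)"
      using S a by (auto intro!: sum.cong simp: ab_ip cnj_sum ell2.ip_cnj[OF a pt_in] subset_iff)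
    also have "(\<Sum>y\<in>S. c y * ip ell2 (pt y) a) = ip ell2 (\<lambda>w. \<Sum>y\<in>S. c y * pt y w) a"
      using S a by (subst ell2.ip_sum) (auto intro!: sum.cong simp: ell2_scale pt_in ell2.ip_scale)
    finally have "cmod (\<Sum>y\<in>S. cnj (c y) * ab a y) \<le> hnorm ell2 (\<lambda>w. \<Sum>y\<in>S. c y * pt y w) * hnorm ell2 a"
      using ell2.cauchy_schwarz[OF v a] by simp
    then show "cmod (\<Sum>y\<in>S. cnj (c y) * ab a y) \<le>
        hnorm ell2 a * hnorm H (\<lambda>x. \<Sum>y\<in>S. c y * (if x \<in> points H then k x y else 0))"
      using gram[OF S, of c] by (simp add: ker_def mult.commute)
  qed (auto simp: ab_def)
  then show "ab a \<in> elems H" "hnorm H (ab a) \<le> hnorm ell2 a" by auto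
qed

text \<open>Riesz representation on the point vectors. Together with \<open>ab_in\<close>, the norm
  of the lift equals that of \<open>f\<close>, so \<open>H\<close> carries the quotient
  norm.\<close>

lemma ab_lift:
  assumes f: "f \<in> elems H"
  shows "\<exists>a\<in>elems ell2. hnorm ell2 a \<le> hnorm H f \<and> ab a = f"
proof -
  have bound: "cmod (\<Sum>y\<in>S. cnj (c y) * f y) \<le> hnorm H f * hnorm ell2 (\<lambda>w. \<Sum>y\<in>S. c y * pt y w)"
    if S: "finite S" "S \<subseteq> points H" for S c
  proof -
    have v: "(\<lambda>x. \<Sum>y\<in>S. c y * ker y x) \<in> elems H"
      by (rule sum_in, rule scale_in, rule ker_in) (use S in auto)
    have "(\<Sum>y\<in>S. cnj (c y) * f y) = cnj (\<Sum>y\<in>S. c y * ip H (ker y) f)"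
      using S f by (auto intro!: sum.cong simp: cnj_sum ip_cnj[OF f ker_in] ip_ker subset_iff)
    also have "(\<Sum>y\<in>S. c y * ip H (ker y) f) = ip H (\<lambda>x. \<Sum>y\<in>S. c y * ker y x) f"
      using S f by (subst ip_sum) (auto intro!: sum.cong simp: scale_in ker_in ip_scale)
    finally show ?thesis using cauchy_schwarz[OF v f] gram[OF S, of c] by (simp add: mult.commute)
  qed
  have "\<exists>a\<in>elems ell2. hnorm ell2 a \<le> hnorm H f \<and> (\<forall>y\<in>points H. ip ell2 a (pt y) = f y) \<and>
    (\<forall>g\<in>elems ell2. (\<forall>y\<in>points H. ip ell2 (pt y) g = 0) \<longrightarrow> ip ell2 a g = 0)"
    by (rule ell2.riesz_family[of "points H" pt "hnorm H f" f, OF pt_in hnorm_nonneg[OF f] bound])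
  then obtain a where a: "a \<in> elems ell2" "hnorm ell2 a \<le> hnorm H f" "\<forall>y\<in>points H. ip ell2 a (pt y) = f y"
    by (elim bexE conjE) simp
  have "ab a = f"
  proof
    fix x show "ab a x = f x"
      using a(3) elems_support[OF f, of x] by (cases "x \<in> points H") (auto simp: ab_ip, simp add: ab_def)
  qed
  with a show ?thesis by blast
qed

end

section \<open>Cyclic right-invariant subspaces of the Fock space\<close>

definition app :: "'l list \<Rightarrow> 'l list \<times> 'n \<Rightarrow> 'l list \<times> 'n" where
  "app w p = (fst p @ w, snd p)"

text \<open>The isometry that appends \<open>w\<close> to words and leaves the multiplicity index
  alone; \<open>bshift w\<close> is its adjoint.\<close>

definition shift :: "'l list \<Rightarrow> ('l list \<times> 'n \<Rightarrow> complex) \<Rightarrow> 'l list \<times> 'n \<Rightarrow> complex" where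
  "shift w x p = (if p \<in> range (app w) then x (inv_into UNIV (app w) p) else 0)"

definition bshift :: "'l list \<Rightarrow> ('l list \<times> 'n \<Rightarrow> complex) \<Rightarrow> 'l list \<times> 'n \<Rightarrow> complex" where
  "bshift w x p = x (app w p)"

lemma inj_app: "inj (app w)"
  by (auto simp: app_def inj_on_def prod_eq_iff)

lemma app_range_iff: "(v, i) \<in> range (app w) \<longleftrightarrow> (\<exists>v'. v = v' @ w)"
  by (auto simp: app_def image_iff prod_eq_iff)

lemma shift_app [simp]: "shift w x (app w p) = x p"
  by (simp add: shift_def inv_f_f[OF inj_app])

lemma shift_append [simp]: "shift w x (v @ w, i) = x (v, i)"
  using shift_app[of w x "(v, i)"] by (simp add: app_def)

lemma shift_Nil [simp]: "shift [] x = x"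
  by (rule ext) (metis append_Nil2 shift_append surj_pair)

lemma shift_not_suffix: "\<nexists>v'. v = v' @ w \<Longrightarrow> shift w x (v, i) = 0"
  by (auto simp: shift_def app_range_iff)

lemma shift_in: "x \<in> elems ell2 \<Longrightarrow> shift w x \<in> elems ell2"
proof -
  assume "x \<in> elems ell2"
  then have "((\<lambda>p. (cmod (shift w x p))\<^sup>2) \<circ> app w) summable_on UNIV" by (simp add: ell2_iff o_def)
  then have "(\<lambda>p. (cmod (shift w x p))\<^sup>2) summable_on range (app w)"
    using summable_on_reindex[OF inj_app] by blast
  moreover have "(\<lambda>p. (cmod (shift w x p))\<^sup>2) summable_on UNIV \<longleftrightarrow>
      (\<lambda>p. (cmod (shift w x p))\<^sup>2) summable_on range (app w)"
    by (rule summable_on_cong_neutral) (auto simp: shift_def)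
  ultimately show ?thesis by (simp add: ell2_iff)
qed

lemma bshift_in: "x \<in> elems ell2 \<Longrightarrow> bshift w x \<in> elems ell2"
proof -
  assume "x \<in> elems ell2"
  then have "(\<lambda>p. (cmod (x p))\<^sup>2) summable_on range (app w)"
    unfolding ell2_iff by (rule summable_on_subset_banach) simp
  then have "((\<lambda>p. (cmod (x p))\<^sup>2) \<circ> app w) summable_on UNIV"
    using summable_on_reindex[OF inj_app] by blast
  then show ?thesis by (simp add: ell2_iff bshift_def o_def)
qed

lemma ip_shift: "ip ell2 (shift w x) y = ip ell2 x (bshift w y)"
proof -
  have "ip ell2 (shift w x) y = (\<Sum>\<^sub>\<infinity>p\<in>range (app w). shift w x p * cnj (y p))"
    unfolding ell2_ip by (rule infsum_cong_neutral) (auto simp: shift_def)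
  also have "\<dots> = (\<Sum>\<^sub>\<infinity>p. ((\<lambda>p. shift w x p * cnj (y p)) \<circ> app w) p)"
    by (rule infsum_reindex[OF inj_app])
  finally show ?thesis by (simp add: ell2_ip bshift_def)
qed

lemma ip_shift_right: "x \<in> elems ell2 \<Longrightarrow> y \<in> elems ell2 \<Longrightarrow> ip ell2 y (shift w x) = ip ell2 (bshift w y) x"
  unfolding ell2.ip_cnj[OF shift_in, of x y w] ip_shift ell2.ip_cnj[OF bshift_in, of y x w]
  using ell2.ip_cnj[OF bshift_in, of y x w] by simp

lemma shift_shift: "shift w2 (shift w1 x) = shift (w1 @ w2) x"
proof
  fix p :: "'a list \<times> 'b" obtain v i where p: "p = (v, i)" by (cases p)
  show "shift w2 (shift w1 x) p = shift (w1 @ w2) x p"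
  proof (cases "\<exists>v'. v = v' @ w2")
    case True
    then obtain v' where v: "v = v' @ w2" ..
    show ?thesis
    proof (cases "\<exists>v''. v' = v'' @ w1")
      case True
      then obtain v'' where v': "v' = v'' @ w1" ..
      show ?thesis unfolding p v v'
        using shift_append[of w2 "shift w1 x" "v'' @ w1" i] shift_append[of "w1 @ w2" x v'' i]
          shift_append[of w1 x v'' i] by simp
    next
      case False
      then show ?thesis unfolding p v by (simp add: shift_not_suffix)
    qed
  next
    case False
    then have "\<nexists>v'. v = v' @ w1 @ w2" by (metis append_assoc)
    with False show ?thesis unfolding p by (simp add: shift_not_suffix)
  qed
qed

lemma bshift_bshift: "bshift w1 (bshift w2 x) = bshift (w1 @ w2) x"
  by (auto simp: bshift_def app_def)

lemma bshift_shift [simp]: "bshift w (shift w x) = x"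
  by (auto simp: bshift_def)

lemma bshift_shift_longer: "bshift w (shift (q @ w) x) = shift q x"
  unfolding shift_shift[symmetric] by simp

lemma bshift_longer_shift: "bshift (q @ w) (shift w x) = bshift q x"
  unfolding bshift_bshift[symmetric] by simp

text \<open>Two suffixes of one word are always comparable, so incomparable words give shifts with
  orthogonal ranges.\<close>

lemma bshift_shift_incomparable:
  assumes "\<nexists>q. w = q @ w'" "\<nexists>q. w' = q @ w"
  shows "bshift w (shift w' x) = (\<lambda>p. 0)"
proof
  fix p :: "'a list \<times> 'b" obtain v i where p: "p = (v, i)" by (cases p)
  have "\<nexists>v'. v @ w = v' @ w'"
    using assms by (auto simp: append_eq_append_conv2)
  then show "bshift w (shift w' x) p = 0" unfolding p bshift_def app_def by (simp add: shift_not_suffix)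
qed

lemma shift_scale: "shift w (\<lambda>p. c * y p) = (\<lambda>p. c * shift w y p)"
  by (auto simp: shift_def)

text \<open>\<open>orbit x W\<close> is the closed span of the shifts of \<open>x\<close> by words in \<open>W\<close>, as a double
  orthogonal complement.\<close>

definition orbit :: "('l list \<times> 'n \<Rightarrow> complex) \<Rightarrow> 'l list set \<Rightarrow> ('l list \<times> 'n \<Rightarrow> complex) set" where
  "orbit x W = {z \<in> elems ell2. \<forall>g\<in>elems ell2. (\<forall>w\<in>W. ip ell2 (shift w x) g = 0) \<longrightarrow> ip ell2 z g = 0}"

lemma orbit_in: "z \<in> orbit x W \<Longrightarrow> z \<in> elems ell2"
  by (simp add: orbit_def)

lemma orbit_mono: "W \<subseteq> W' \<Longrightarrow> orbit x W \<subseteq> orbit x W'"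
  by (auto simp: orbit_def)

lemma orbit_shift: "x \<in> elems ell2 \<Longrightarrow> w \<in> W \<Longrightarrow> shift w x \<in> orbit x W"
  by (auto simp: orbit_def shift_in)

lemma orbit_diff: "z \<in> orbit x W \<Longrightarrow> z' \<in> orbit x W \<Longrightarrow> (\<lambda>p. z p - z' p) \<in> orbit x W"
  by (auto simp: orbit_def ell2_diff ell2.ip_diff)

lemma orbit_scale: "z \<in> orbit x W \<Longrightarrow> (\<lambda>p. c * z p) \<in> orbit x W"
  by (auto simp: orbit_def ell2_scale ell2.ip_scale)

definition delta :: "'i \<Rightarrow> 'i \<Rightarrow> complex" where
  "delta q p = of_bool (p = q)"

lemma delta_in: "delta q \<in> elems ell2"
  using ell2.kernel_in[of q] by (simp add: delta_def[abs_def])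

lemma ip_delta: "x \<in> elems ell2 \<Longrightarrow> ip ell2 x (delta q) = x q"
  using ell2.reproducing[of x q] by (simp add: delta_def[abs_def])

text \<open>The series of all \<open>a w * shift w \<theta>\<close>, evaluated at one position: only
  suffixes of the word contribute, so the sum is finite and can be written down before any
  convergence is known.\<close>

definition star :: "('l list \<times> 'n \<Rightarrow> complex) \<Rightarrow> ('l list \<Rightarrow> complex) \<Rightarrow> 'l list \<times> 'n \<Rightarrow> complex" where
  "star \<theta> a p = (\<Sum>n\<le>length (fst p). \<theta> (take n (fst p), snd p) * a (drop n (fst p)))"

lemma star_snoc:
  "star \<theta> a (v @ [l], i) = star \<theta> (\<lambda>w. a (w @ [l])) (v, i) + \<theta> (v @ [l], i) * a []"
  by (simp add: star_def)

lemma star_finite: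
  assumes S: "finite S" and supp: "\<And>w. w \<notin> S \<Longrightarrow> a w = 0"
  shows "star \<theta> a p = (\<Sum>w\<in>S. a w * shift w \<theta> p)"
proof -
  obtain v i where p: "p = (v, i)" by (cases p)
  let ?D = "(\<lambda>n. drop n v) ` {..length v}"
  have inj: "inj_on (\<lambda>n. drop n v) {..length v}"
    by (rule inj_on_inverseI[of _ "\<lambda>w. length v - length w"]) simp
  have sh: "shift (drop n v) \<theta> (v, i) = \<theta> (take n v, i)" for n
    using shift_append[of "drop n v" \<theta> "take n v" i] by simp
  have "star \<theta> a p = (\<Sum>w\<in>?D. a w * shift w \<theta> (v, i))"
    unfolding p star_def by (subst sum.reindex[OF inj]) (simp add: sh mult.commute)
  also have "\<dots> = (\<Sum>w\<in>S \<union> ?D. a w * shift w \<theta> (v, i))"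
  proof (rule sum.mono_neutral_left)
    show "\<forall>w\<in>S \<union> ?D - ?D. a w * shift w \<theta> (v, i) = 0"
    proof
      fix w assume w: "w \<in> S \<union> ?D - ?D"
      have "\<nexists>v'. v = v' @ w"
      proof
        assume "\<exists>v'. v = v' @ w"
        then obtain v' where "v = v' @ w" ..
        then have "w = drop (length v') v" "length v' \<le> length v" by auto
        then have "w \<in> ?D" by blast
        with w show False by blast
      qed
      then show "a w * shift w \<theta> (v, i) = 0" by (simp add: shift_not_suffix)
    qed
  qed (use S in auto)
  also have "\<dots> = (\<Sum>w\<in>S. a w * shift w \<theta> (v, i))"
    by (rule sum.mono_neutral_right) (use S supp in auto)
  finally show ?thesis by (simp add: p)
qed

section \<open>Wandering vectors and their orthonormal shifts\<close>

locale wandering_vector =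
  fixes \<theta> :: "'l list \<times> 'n \<Rightarrow> complex"
  assumes theta_in: "\<theta> \<in> elems ell2" and theta_unit: "ip ell2 \<theta> \<theta> = 1"
    and theta_wandering: "q \<noteq> [] \<Longrightarrow> ip ell2 (shift q \<theta>) \<theta> = 0"
begin

text \<open>For comparable words the common suffix cancels and the wandering condition remains;
  incomparable words have orthogonal ranges.\<close>

lemma shift_orthonormal: "ip ell2 (shift w \<theta>) (shift w' \<theta>) = of_bool (w = w')"
proof -
  have *: "ip ell2 (shift w \<theta>) (shift w' \<theta>) = ip ell2 \<theta> (bshift w (shift w' \<theta>))"
    by (rule ip_shift)
  show ?thesis
  proof (cases "w = w'")
    case True
    then show ?thesis using * theta_unit by simp
  next
    case neq: False
    consider q where "w = q @ w'" | q where "w' = q @ w" | "\<nexists>q. w = q @ w'" "\<nexists>q. w' = q @ w" by blast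
    then show ?thesis
    proof cases
      case (1 q)
      then have "q \<noteq> []" using neq by auto
      then show ?thesis
        using * theta_wandering[of q] ip_shift[of q \<theta> \<theta>] neq 1 by (simp add: bshift_longer_shift)
    next
      case (2 q)
      then have "q \<noteq> []" using neq by auto
      then show ?thesis
        using * theta_wandering[of q] ell2.ip_cnj[OF shift_in[OF theta_in] theta_in, of q] neq 2
        by (simp add: bshift_shift_longer)
    next
      case 3
      then show ?thesis
        unfolding * bshift_shift_incomparable[OF 3] using ell2.ip_scale_right[OF theta_in theta_in, of 0] neq by simp
    qed
  qed
qed

lemma comb_norm:
  assumes "finite S"
  shows "(hnorm ell2 (\<lambda>p. \<Sum>w\<in>S. a w * shift w \<theta> p))\<^sup>2 = (\<Sum>w\<in>S. (cmod (a w))\<^sup>2)"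
    and "(\<lambda>p. \<Sum>w\<in>S. a w * shift w \<theta> p) \<in> elems ell2"
    and "w' \<in> S \<Longrightarrow> ip ell2 (\<lambda>p. \<Sum>w\<in>S. a w * shift w \<theta> p) (shift w' \<theta>) = a w'"
proof -
  let ?z = "\<lambda>p. \<Sum>w\<in>S. a w * shift w \<theta> p"
  have el: "(\<lambda>p. a w * shift w \<theta> p) \<in> elems ell2" for w
    by (intro ell2_scale shift_in theta_in)
  show z: "?z \<in> elems ell2" by (rule ell2.sum_in[OF el])
  have c: "ip ell2 ?z (shift w' \<theta>) = a w'" if "w' \<in> S" for w'
  proof -
    have "ip ell2 ?z (shift w' \<theta>) = (\<Sum>w\<in>S. a w * of_bool (w = w'))"
      by (subst ell2.ip_sum[OF el shift_in[OF theta_in]])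
        (simp add: ell2.ip_scale shift_in theta_in shift_orthonormal)
    then show ?thesis using assms that by simp
  qed
  then show "w' \<in> S \<Longrightarrow> ip ell2 ?z (shift w' \<theta>) = a w'" .
  have "ip ell2 ?z ?z = (\<Sum>w\<in>S. a w * ip ell2 (shift w \<theta>) ?z)"
    by (subst ell2.ip_sum[OF el z]) (simp add: ell2.ip_scale shift_in theta_in z)
  also have "\<dots> = (\<Sum>w\<in>S. a w * cnj (a w))"
    using ell2.ip_cnj[OF z shift_in[OF theta_in]] c by (intro sum.cong refl) simp
  also have "\<dots> = of_real (\<Sum>w\<in>S. (cmod (a w))\<^sup>2)" by (simp add: complex_norm_square del: of_real_power)
  finally show "(hnorm ell2 ?z)\<^sup>2 = (\<Sum>w\<in>S. (cmod (a w))\<^sup>2)"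
    unfolding ell2.hnorm_sq[OF z] by simp
qed

text \<open>Finitely many positions involve only finitely many coefficients, and for a finite
  combination orthonormality gives the norm exactly.\<close>

lemma star_in:
  assumes a: "a \<in> elems ell2"
  shows "star \<theta> a \<in> elems ell2" "hnorm ell2 (star \<theta> a) \<le> hnorm ell2 a"
proof -
  have "(\<Sum>p\<in>T. (cmod (star \<theta> a p))\<^sup>2) \<le> (hnorm ell2 a)\<^sup>2" if T: "finite T" for T
  proof -
    define S where "S = (\<Union>p\<in>T. (\<lambda>n. drop n (fst p)) ` {..length (fst p)})"
    have S: "finite S" using T by (auto simp: S_def)
    define b where "b = (\<lambda>w. if w \<in> S then a w else 0)"
    have "star \<theta> a p = (\<Sum>w\<in>S. b w * shift w \<theta> p)" if "p \<in> T" for p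
    proof -
      have "star \<theta> a p = star \<theta> b p"
        unfolding star_def by (intro sum.cong refl) (use that in \<open>auto simp: b_def S_def\<close>)
      then show ?thesis using star_finite[OF S, of b \<theta> p] by (simp add: b_def)
    qed
    then have "(\<Sum>p\<in>T. (cmod (star \<theta> a p))\<^sup>2) = (\<Sum>p\<in>T. (cmod (\<Sum>w\<in>S. b w * shift w \<theta> p))\<^sup>2)"
      by simp
    also have "\<dots> \<le> (hnorm ell2 (\<lambda>p. \<Sum>w\<in>S. b w * shift w \<theta> p))\<^sup>2"
      by (rule ell2_finite_sum_le[OF comb_norm(2)[OF S] T])
    also have "\<dots> = (\<Sum>w\<in>S. (cmod (a w))\<^sup>2)"
      unfolding comb_norm(1)[OF S] by (simp add: b_def)
    also have "\<dots> \<le> (hnorm ell2 a)\<^sup>2" by (rule ell2_finite_sum_le[OF a S])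
    finally show ?thesis .
  qed
  from ell2_boundI[OF this ell2_hnorm_nonneg order_refl]
  show "star \<theta> a \<in> elems ell2" "hnorm ell2 (star \<theta> a) \<le> hnorm ell2 a" by auto
qed

text \<open>Bessel's inequality for the orthonormal shifts of \<theta>.\<close>

lemma coefficients_in:
  assumes z: "z \<in> elems ell2"
  defines "F \<equiv> \<lambda>w. ip ell2 z (shift w \<theta>)"
  shows "F \<in> elems ell2" "hnorm ell2 F \<le> hnorm ell2 z"
proof -
  have "(\<Sum>w\<in>S. (cmod (F w))\<^sup>2) \<le> (hnorm ell2 z)\<^sup>2" if S: "finite S" for S
  proof -
    let ?c = "\<lambda>p. \<Sum>w\<in>S. F w * shift w \<theta> p"
    have c: "?c \<in> elems ell2" by (rule comb_norm(2)[OF S])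
    have "ip ell2 ?c z = (\<Sum>w\<in>S. F w * ip ell2 (shift w \<theta>) z)"
      by (subst ell2.ip_sum) (simp_all add: ell2_scale ell2.ip_scale shift_in theta_in z)
    also have "\<dots> = (\<Sum>w\<in>S. F w * cnj (F w))"
      unfolding F_def using ell2.ip_cnj[OF z shift_in[OF theta_in]] by simp
    also have "\<dots> = of_real (\<Sum>w\<in>S. (cmod (F w))\<^sup>2)" by (simp add: complex_norm_square del: of_real_power)
    finally have "Re (ip ell2 z ?c) = (\<Sum>w\<in>S. (cmod (F w))\<^sup>2)"
      using ell2.ip_cnj[OF c z] by simp
    then have "(hnorm ell2 (\<lambda>p. z p - ?c p))\<^sup>2 = (hnorm ell2 z)\<^sup>2 - (\<Sum>w\<in>S. (cmod (F w))\<^sup>2)"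
      unfolding ell2.hnorm_diff_sq[OF z c] comb_norm(1)[OF S] by simp
    moreover have "0 \<le> (hnorm ell2 (\<lambda>p. z p - ?c p))\<^sup>2" by (rule zero_le_power2)
    ultimately show ?thesis by linarith
  qed
  from ell2_boundI[OF this ell2_hnorm_nonneg order_refl]
  show "F \<in> elems ell2" "hnorm ell2 F \<le> hnorm ell2 z" by auto
qed

end

lemma orbitD:
  "z \<in> orbit x W \<Longrightarrow> g \<in> elems ell2 \<Longrightarrow> (\<And>w. w \<in> W \<Longrightarrow> ip ell2 (shift w x) g = 0) \<Longrightarrow> ip ell2 z g = 0"
  unfolding orbit_def by blast

text \<open>Every \<open>z\<close> in the cyclic subspace of \<open>x\<close> equals \<open>star \<theta> F\<close>: subtracting the \<open>\<theta>\<close>-component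
  leaves a vector in the span of the nonempty shifts, whose backward shifts are again in
  the cyclic subspace, so the coefficients are recovered by induction on the word length.\<close>

lemma cyclic_factorization:
  fixes x :: "'l list \<times> 'n \<Rightarrow> complex"
  assumes x: "x \<in> elems ell2" and nz: "x \<noteq> (\<lambda>p. 0)"
  shows "\<exists>\<theta> F. wandering_vector \<theta> \<and> F \<in> elems ell2 \<and> hnorm ell2 F \<le> hnorm ell2 x \<and> x = star \<theta> F"
proof -
  define X where "X = {w::'l list. w \<noteq> []}"
  have sh: "shift w x \<in> elems ell2" for w by (rule shift_in[OF x])
  have bound: "cmod (\<Sum>w\<in>S. cnj (c w) * ip ell2 x (shift w x)) \<le>
      hnorm ell2 x * hnorm ell2 (\<lambda>p. \<Sum>w\<in>S. c w * shift w x p)" if "finite S" "S \<subseteq> X" for S c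
  proof -
    let ?v = "\<lambda>p. \<Sum>w\<in>S. c w * shift w x p"
    have v: "?v \<in> elems ell2" by (rule ell2.sum_in) (rule ell2_scale, rule sh)
    have "cnj (ip ell2 ?v x) = (\<Sum>w\<in>S. cnj (c w) * ip ell2 x (shift w x))"
      by (subst ell2.ip_sum) (simp_all add: ell2_scale sh x ell2.ip_scale cnj_sum ell2.ip_cnj[OF sh x])
    then have "(\<Sum>w\<in>S. cnj (c w) * ip ell2 x (shift w x)) = ip ell2 x ?v"
      using ell2.ip_cnj[OF v x] by simp
    then show ?thesis using ell2.cauchy_schwarz[OF x v] by simp
  qed
  \<comment> \<open>\<open>p\<close> is the orthogonal projection of \<open>x\<close> onto the
    closed span of its nonempty shifts; the remainder \<open>y\<close> will be the wandering
    direction.\<close>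
  have "\<exists>p\<in>elems ell2. hnorm ell2 p \<le> hnorm ell2 x \<and> (\<forall>w\<in>X. ip ell2 p (shift w x) = ip ell2 x (shift w x)) \<and>
    (\<forall>g\<in>elems ell2. (\<forall>w\<in>X. ip ell2 (shift w x) g = 0) \<longrightarrow> ip ell2 p g = 0)"
    by (rule ell2.riesz_family[of X "\<lambda>w. shift w x" "hnorm ell2 x" "\<lambda>w. ip ell2 x (shift w x)",
        OF sh ell2_hnorm_nonneg bound])
  then obtain p where p: "p \<in> elems ell2" "\<forall>w\<in>X. ip ell2 p (shift w x) = ip ell2 x (shift w x)"
    and p_orbit: "p \<in> orbit x X"
    unfolding orbit_def by blast
  have x_orbit: "x \<in> orbit x UNIV" using orbit_shift[OF x, of "[]" UNIV] by simp
  define y where "y = (\<lambda>q. x q - p q)"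
  have y: "y \<in> elems ell2" unfolding y_def by (rule ell2_diff[OF x p(1)])
  have y_orbit: "y \<in> orbit x UNIV"
    unfolding y_def using orbit_diff[OF x_orbit] orbit_mono[of X UNIV x] p_orbit by auto
  have y_perp: "ip ell2 (shift w x) y = 0" if "w \<noteq> []" for w
    using p(2) that ell2.ip_cnj[OF y sh, of w] ell2.ip_diff[OF x p(1) sh, of w] by (simp add: X_def y_def)
  have orbit_X_perp: "ip ell2 z y = 0" if "z \<in> orbit x X" for z
    by (rule orbitD[OF that y]) (simp add: y_perp X_def)
  have orbit_X_Nil: "z ([], i) = 0" if z: "z \<in> orbit x X" for z i
  proof -
    have "ip ell2 (shift w x) (delta ([], i)) = 0" if "w \<in> X" for w
      using that by (simp add: ip_delta[OF sh] X_def shift_not_suffix)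
    then have "ip ell2 z (delta ([], i)) = 0" by (rule orbitD[OF z delta_in])
    then show ?thesis by (simp add: ip_delta[OF orbit_in[OF z]])
  qed
  \<comment> \<open>Otherwise \<open>x\<close> lies in the closed span of its nonempty shifts. All
    of these vanish at a word of minimal length in the support of \<open>x\<close>, because there
    they take values of \<open>x\<close> at shorter words.\<close>
  have "y \<noteq> (\<lambda>q. 0)"
  proof
    assume "y = (\<lambda>q. 0)"
    then have "x = p" by (auto simp: y_def fun_eq_iff)
    then have xX: "x \<in> orbit x X" using p_orbit by simp
    obtain q where "x q \<noteq> 0" using nz by blast
    then have "\<exists>n v i. length v = n \<and> x (v, i) \<noteq> 0" by (cases q) auto
    then obtain n where n: "\<exists>v i. length v = n \<and> x (v, i) \<noteq> 0"
      and least: "\<And>m. m < n \<Longrightarrow> \<not> (\<exists>v i. length v = m \<and> x (v, i) \<noteq> 0)"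
      using exists_least_iff[of "\<lambda>n. \<exists>v i. length v = n \<and> x (v, i) \<noteq> 0"] by blast
    then obtain v i where v: "length v = n" "x (v, i) \<noteq> 0" by blast
    have "ip ell2 (shift w x) (delta (v, i)) = 0" if w: "w \<in> X" for w
    proof (cases "\<exists>v'. v = v' @ w")
      case True
      then obtain v' where v': "v = v' @ w" ..
      then have "length v' < n" using v(1) w by (auto simp: X_def)
      then have "x (v', i) = 0" using least by blast
      then show ?thesis by (simp add: ip_delta[OF sh] v')
    next
      case False
      then show ?thesis by (simp add: ip_delta[OF sh] shift_not_suffix)
    qed
    then have "ip ell2 x (delta (v, i)) = 0" by (rule orbitD[OF xX delta_in])
    then show False using v(2) by (simp add: ip_delta[OF x])
  qed
  then have N: "hnorm ell2 y > 0"
    using ell2.hnorm_eq_0[OF y] by (metis ell2_hnorm_nonneg order_le_less)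
  have shift_y: "shift q y \<in> orbit x X" if q: "q \<noteq> []" for q
    unfolding orbit_def
  proof (intro CollectI conjI shift_in y ballI impI)
    fix g assume g: "g \<in> elems ell2" and o: "\<forall>w\<in>X. ip ell2 (shift w x) g = 0"
    have "ip ell2 (shift w x) (bshift q g) = 0" for w
      using o q ip_shift[of q "shift w x" g] by (auto simp: shift_shift X_def)
    then have "ip ell2 y (bshift q g) = 0"
      by (rule orbitD[OF y_orbit bshift_in[OF g]])
    then show "ip ell2 (shift q y) g = 0" by (simp add: ip_shift)
  qed
  define \<theta> where "\<theta> = (\<lambda>q. of_real (inverse (hnorm ell2 y)) * y q)"
  have th: "\<theta> \<in> elems ell2" unfolding \<theta>_def by (rule ell2_scale[OF y])
  have y_eq: "y = (\<lambda>q. of_real (hnorm ell2 y) * \<theta> q)" using N by (auto simp: \<theta>_def)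
  have yy: "ip ell2 y y = of_real ((hnorm ell2 y)\<^sup>2)" by (rule ell2.ip_self[OF y])
  have th_wander: "wandering_vector \<theta>"
  proof
    show "\<theta> \<in> elems ell2" by (rule th)
    have "hnorm ell2 \<theta> = 1" unfolding \<theta>_def ell2.hnorm_scale[OF y] using N by (simp add: norm_inverse)
    then show "ip ell2 \<theta> \<theta> = 1" using ell2.ip_self[OF th] by simp
    show "ip ell2 (shift q \<theta>) \<theta> = 0" if "q \<noteq> []" for q
      using orbit_X_perp[OF shift_y[OF that]]
      unfolding \<theta>_def shift_scale
      by (simp add: ell2.ip_scale ell2.ip_scale_right ell2_scale shift_in y)
  qed
  interpret wandering_vector \<theta> by (rule th_wander)
  have th_orbit: "\<theta> \<in> orbit x UNIV" unfolding \<theta>_def by (rule orbit_scale[OF y_orbit])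
  have to_X: "z \<in> orbit x X" if z: "z \<in> orbit x UNIV" and zy: "ip ell2 z y = 0" for z
    unfolding orbit_def
  proof (intro CollectI conjI orbit_in[OF z] ballI impI)
    fix g assume g: "g \<in> elems ell2" and o: "\<forall>w\<in>X. ip ell2 (shift w x) g = 0"
    \<comment> \<open>Chosen so that g - t y is orthogonal to \<open>x\<close> itself and not only
      to its nonempty shifts.\<close>
    define t where "t = cnj (ip ell2 x g) / of_real ((hnorm ell2 y)\<^sup>2)"
    define g' where "g' = (\<lambda>q. g q - t * y q)"
    have g': "g' \<in> elems ell2" unfolding g'_def by (intro ell2_diff ell2_scale g y)
    have xy: "ip ell2 x y = of_real ((hnorm ell2 y)\<^sup>2)"
      using orbit_X_perp[OF p_orbit] yy ell2.ip_diff[OF x p(1) y] by (simp add: y_def)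
    have "ip ell2 x g' = 0"
      unfolding g'_def ell2.ip_diff_right[OF g ell2_scale[OF y] x] ell2.ip_scale_right[OF y x] xy t_def
      using N by simp
    moreover have "ip ell2 (shift w x) g' = 0" if "w \<noteq> []" for w
      unfolding g'_def ell2.ip_diff_right[OF g ell2_scale[OF y] sh] ell2.ip_scale_right[OF y sh]
      using o that y_perp[OF that] by (simp add: X_def)
    ultimately have "ip ell2 (shift w x) g' = 0" for w by (cases "w = []") auto
    then have "ip ell2 z g' = 0" by (rule orbitD[OF z g'])
    then show "ip ell2 z g = 0"
      unfolding g'_def ell2.ip_diff_right[OF g ell2_scale[OF y] orbit_in[OF z]]
        ell2.ip_scale_right[OF y orbit_in[OF z]] using zy by simp
  qed
  have remainder: "(\<lambda>q. z q - ip ell2 z \<theta> * \<theta> q) \<in> orbit x X" if z: "z \<in> orbit x UNIV" for z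
  proof (rule to_X)
    let ?z' = "\<lambda>q. z q - ip ell2 z \<theta> * \<theta> q"
    show z': "?z' \<in> orbit x UNIV" by (rule orbit_diff[OF z orbit_scale[OF th_orbit]])
    have "ip ell2 ?z' \<theta> = 0"
      unfolding ell2.ip_diff[OF orbit_in[OF z] ell2_scale[OF th] th] ell2.ip_scale[OF th th] theta_unit by simp
    then show "ip ell2 ?z' y = 0"
      by (subst y_eq) (simp add: ell2.ip_scale_right[OF th orbit_in[OF z']])
  qed
  have main: "z (v, i) = star \<theta> (\<lambda>w. ip ell2 z (shift w \<theta>)) (v, i)" if "z \<in> orbit x UNIV" for z v i
    using that
  proof (induction v arbitrary: z rule: rev_induct)
    case (Nil z)
    from orbit_X_Nil[OF remainder[OF Nil]] show ?case by (simp add: star_def)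
  next
    case (snoc l v z)
    note z = orbit_in[OF snoc.prems]
    define z' where "z' = (\<lambda>q. z q - ip ell2 z \<theta> * \<theta> q)"
    have z'X: "z' \<in> orbit x X" unfolding z'_def by (rule remainder[OF snoc.prems])
    note z'e = orbit_in[OF z'X]
    \<comment> \<open>Removing a last letter l from a nonempty shift of \<open>x\<close> gives
      either a shift of \<open>x\<close> or 0, so the induction hypothesis applies to the shorter
      word.\<close>
    have b: "bshift [l] z' \<in> orbit x UNIV" unfolding orbit_def
    proof (intro CollectI conjI bshift_in z'e ballI impI)
      fix g :: "'l list \<times> 'n \<Rightarrow> complex"
      assume g: "g \<in> elems ell2" and o: "\<forall>w\<in>UNIV. ip ell2 (shift w x) g = 0"
      have "ip ell2 (shift w x) (shift [l] g) = 0" if w: "w \<in> X" for w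
      proof -
        obtain w0 l' where w0: "w = w0 @ [l']" using w by (auto simp: X_def) (metis rev_exhaust)
        have "bshift [l] (shift w x) = (if l' = l then shift w0 x else (\<lambda>p. 0))"
        proof (cases "l' = l")
          case True
          then show ?thesis unfolding w0 by (simp add: bshift_shift_longer)
        next
          case False
          then show ?thesis unfolding w0 by (auto intro!: bshift_shift_incomparable)
        qed
        then have "ip ell2 (bshift [l] (shift w x)) g = 0"
          using o ell2.ip_zero_left[OF g] by auto
        then show ?thesis using ip_shift_right[OF g sh[of w], of "[l]"] by simp
      qed
      then have "ip ell2 z' (shift [l] g) = 0" by (rule orbitD[OF z'X shift_in[OF g]])
      then show "ip ell2 (bshift [l] z') g = 0" by (simp add: ip_shift_right[OF g z'e])
    qed
    \<comment> \<open>Subtracting the \<theta>-component leaves these coefficients unchanged, since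
      \<open>w @ [l]\<close> is nonempty and the shifts are orthonormal.\<close>
    have coeff: "ip ell2 (bshift [l] z') (shift w \<theta>) = ip ell2 z (shift (w @ [l]) \<theta>)" for w
    proof -
      have "ip ell2 (bshift [l] z') (shift w \<theta>) = ip ell2 z' (shift (w @ [l]) \<theta>)"
        using ip_shift_right[OF shift_in[OF th, of w] z'e, of "[l]"] by (simp add: shift_shift)
      also have "\<dots> = ip ell2 z (shift (w @ [l]) \<theta>)"
        unfolding z'_def ell2.ip_diff[OF z ell2_scale[OF th] shift_in[OF th]] ell2.ip_scale[OF th shift_in[OF th]]
        using shift_orthonormal[of "[]" "w @ [l]"] by simp
      finally show ?thesis .
    qed
    have "z' (v @ [l], i) = star \<theta> (\<lambda>w. ip ell2 z (shift (w @ [l]) \<theta>)) (v, i)"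
      using snoc.IH[OF b] unfolding coeff by (simp add: bshift_def app_def)
    then show ?case unfolding star_snoc by (simp add: z'_def algebra_simps)
  qed
  define F where "F = (\<lambda>w. ip ell2 x (shift w \<theta>))"
  have "x = star \<theta> F" unfolding F_def using main[OF x_orbit] by auto
  moreover have "F \<in> elems ell2" "hnorm ell2 F \<le> hnorm ell2 x"
    unfolding F_def by (rule coefficients_in[OF x])+
  ultimately show ?thesis using th_wander by blast
qed

section \<open>Factorization in the weak product\<close>

text \<open>The infimum defining the operator norm is itself an admissible constant. Vectors of norm
  0 are treated apart because they allow no division.\<close>

lemma bounded_operator_norm:
  assumes T: "bounded_operator V nV W nW T" and nV: "\<And>v. v \<in> V \<Longrightarrow> nV v \<ge> 0"
  shows "0 \<le> operator_norm V nV nW T" "v \<in> V \<Longrightarrow> nW (T v) \<le> operator_norm V nV nW T * nV v"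
proof -
  define A where "A = {C. 0 \<le> C \<and> (\<forall>v\<in>V. nW (T v) \<le> C * nV v)}"
  obtain C where C: "\<forall>v\<in>V. nW (T v) \<le> C * nV v" using T by (auto simp: bounded_operator_def)
  have "nW (T v) \<le> max C 0 * nV v" if "v \<in> V" for v
  proof -
    have "C * nV v \<le> max C 0 * nV v" by (rule mult_right_mono) (auto simp: nV that)
    then show ?thesis using C that by fastforce
  qed
  then have A: "A \<noteq> {}" unfolding A_def by (intro ex_in_conv[THEN iffD1] exI[of _ "max C 0"]) auto
  show nonneg: "0 \<le> operator_norm V nV nW T"
    unfolding operator_norm_def A_def[symmetric] by (rule cInf_greatest[OF A]) (auto simp: A_def)
  show "nW (T v) \<le> operator_norm V nV nW T * nV v" if v: "v \<in> V"
  proof (cases "nV v = 0")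
    case True
    then show ?thesis using C v by auto
  next
    case False
    then have pos: "nV v > 0" using nV[OF v] by simp
    have "nW (T v) / nV v \<le> operator_norm V nV nW T"
      unfolding operator_norm_def A_def[symmetric]
      by (rule cInf_greatest[OF A]) (use v pos in \<open>auto simp: A_def divide_le_eq\<close>)
    then show ?thesis using pos by (simp add: divide_le_eq)
  qed
qed

lemma operator_norm_le:
  "0 \<le> C \<Longrightarrow> (\<And>v. v \<in> V \<Longrightarrow> nW (T v) \<le> C * nV v) \<Longrightarrow> operator_norm V nV nW T \<le> C"
  unfolding operator_norm_def by (rule cInf_lower) (auto intro!: bdd_belowI[of _ 0])

context hilbert_function_space
begin

lemma point_bound:
  assumes f: "f \<in> elems H"
  shows "\<exists>C\<ge>0. \<forall>f\<in>elems H. cmod (f x) \<le> C * hnorm H f"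
proof (cases "x \<in> points H")
  case True
  let ?K = "\<lambda>z. if z \<in> points H then k z x else 0"
  have "cmod (f x) \<le> hnorm H ?K * hnorm H f" if "f \<in> elems H" for f
    using cauchy_schwarz[OF that kernel_in[OF True]] reproducing[OF that True] by (simp add: mult.commute)
  then show ?thesis using hnorm_nonneg[OF kernel_in[OF True]] by blast
next
  case False
  then show ?thesis using elems_support by (intro exI[of _ 0]) auto
qed

lemma tensor_l2_norm_nonneg: "F \<in> tensor_l2 H \<Longrightarrow> 0 \<le> tensor_l2_norm H F"
  unfolding tensor_l2_norm_def tensor_l2_def by (auto intro!: suminf_nonneg)

lemma column_boundI:
  assumes mult: "\<And>n g. g \<in> elems H \<Longrightarrow> (\<lambda>x. \<Phi> n x * g x) \<in> elems H" and C: "C \<ge> 0"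
    and bound: "\<And>g n. g \<in> elems H \<Longrightarrow> (\<Sum>i<n. (hnorm H (\<lambda>x. \<Phi> i x * g x))\<^sup>2) \<le> (C * hnorm H g)\<^sup>2"
  shows "column_bounded H \<Phi>" "column_norm H \<Phi> \<le> C"
proof -
  have "column_op \<Phi> g \<in> tensor_l2 H \<and> tensor_l2_norm H (column_op \<Phi> g) \<le> C * hnorm H g"
    if g: "g \<in> elems H" for g
  proof -
    have "(\<Sum>i\<le>n. (hnorm H (\<lambda>x. \<Phi> i x * g x))\<^sup>2) \<le> (C * hnorm H g)\<^sup>2" for n
      using bound[OF g, of "Suc n"] by (simp only: lessThan_Suc_atMost)
    then have s: "summable (\<lambda>i. (hnorm H (\<lambda>x. \<Phi> i x * g x))\<^sup>2)"
      by (intro bounded_imp_summable) auto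
    have "(\<Sum>i. (hnorm H (\<lambda>x. \<Phi> i x * g x))\<^sup>2) \<le> (C * hnorm H g)\<^sup>2"
      by (rule suminf_le_const[OF s bound[OF g]])
    then have "sqrt (\<Sum>i. (hnorm H (\<lambda>x. \<Phi> i x * g x))\<^sup>2) \<le> C * hnorm H g"
      using C hnorm_nonneg[OF g] by (intro real_le_lsqrt) auto
    then show ?thesis using s mult[OF g] by (simp add: tensor_l2_def tensor_l2_norm_def column_op_def)
  qed
  then show "column_bounded H \<Phi>" "column_norm H \<Phi> \<le> C"
    unfolding column_bounded_def column_norm_def bounded_operator_def
    using C by (auto intro!: operator_norm_le)
qed

end

lemma slices:
  fixes y :: "'w \<times> nat \<Rightarrow> complex"
  assumes y: "y \<in> elems ell2"
  shows "(\<lambda>v. y (v, i)) \<in> elems ell2" "(\<Sum>i<n. (hnorm ell2 (\<lambda>v. y (v, i)))\<^sup>2) \<le> (hnorm ell2 y)\<^sup>2"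
proof -
  show sl: "(\<lambda>v. y (v, i)) \<in> elems ell2" for i
  proof (rule ell2_boundI)
    fix S :: "'w set" assume "finite S"
    then have "(\<Sum>v\<in>S. (cmod (y (v, i)))\<^sup>2) = (\<Sum>p\<in>S \<times> {i}. (cmod (y p))\<^sup>2)"
      by (simp add: sum.cartesian_product')
    also have "\<dots> \<le> (hnorm ell2 y)\<^sup>2" by (rule ell2_finite_sum_le[OF y]) (use \<open>finite S\<close> in simp)
    finally show "(\<Sum>v\<in>S. (cmod (y (v, i)))\<^sup>2) \<le> (hnorm ell2 y)\<^sup>2" .
  qed (rule ell2_hnorm_nonneg order_refl)+
  have "((\<lambda>v. \<Sum>i<n. (cmod (y (v, i)))\<^sup>2) has_sum (\<Sum>i<n. (hnorm ell2 (\<lambda>v. y (v, i)))\<^sup>2)) UNIV"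
  proof (induction n)
    case (Suc n)
    from has_sum_add[OF this ell2_has_sum_norm[OF sl[of n]]] show ?case by simp
  qed simp
  then show "(\<Sum>i<n. (hnorm ell2 (\<lambda>v. y (v, i)))\<^sup>2) \<le> (hnorm ell2 y)\<^sup>2"
  proof (rule has_sum_le_finite_sums)
    fix S :: "'w set" assume "finite S"
    then have "(\<Sum>v\<in>S. \<Sum>i<n. (cmod (y (v, i)))\<^sup>2) = (\<Sum>p\<in>S \<times> {..<n}. (cmod (y p))\<^sup>2)"
      by (simp add: sum.cartesian_product')
    also have "\<dots> \<le> (hnorm ell2 y)\<^sup>2" by (rule ell2_finite_sum_le[OF y]) (use \<open>finite S\<close> in simp)
    finally show "(\<Sum>v\<in>S. \<Sum>i<n. (cmod (y (v, i)))\<^sup>2) \<le> (hnorm ell2 y)\<^sup>2" .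
  qed
qed

section \<open>Multiplier columns from wandering vectors\<close>

context cnp_space
begin

text \<open>Cutting words matches pairs of a word and a cut with pairs of words, and
  \<open>mon\<close> is multiplicative along the cut. Absolute convergence permits the regrouping,
  so \<open>star\<close> becomes pointwise multiplication once the letters commute.\<close>

lemma ab_star:
  fixes \<theta> :: "'l list \<times> nat \<Rightarrow> complex"
  assumes theta: "wandering_vector \<theta>" and a: "a \<in> elems ell2"
  shows "ab (\<lambda>v. star \<theta> a (v, i)) x = ab (\<lambda>v. \<theta> (v, i)) x * ab a x"
proof (cases "x \<in> points H")
  case x: True
  interpret wandering_vector \<theta> by (rule theta)
  let ?f = "\<lambda>p. (\<theta> (fst p, i) * mon x (fst p)) * (a (snd p) * mon x (snd p))"
  have "((\<lambda>(v, w). (\<theta> (v, i) * mon x v) * (a w * mon x w)) has_sum ab (\<lambda>v. \<theta> (v, i)) x * ab a x) (UNIV \<times> UNIV)"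
    by (rule has_sum_times[OF ab_has_sum[OF slices(1)[OF theta_in] x] ab_has_sum[OF a x]])
  then have f: "(?f has_sum ab (\<lambda>v. \<theta> (v, i)) x * ab a x) UNIV" by (simp add: case_prod_unfold)
  let ?S = "Sigma UNIV (\<lambda>v::'l list. {..length v})"
  have bij: "bij_betw (\<lambda>(v, n). (take n v, drop n v)) ?S UNIV"
    by (rule bij_betwI[where g = "\<lambda>(v, w). (v @ w, length v)"]) auto
  have "((\<lambda>q. ?f ((\<lambda>(v, n). (take n v, drop n v)) q)) has_sum ab (\<lambda>v. \<theta> (v, i)) x * ab a x) ?S"
    using has_sum_reindex_bij_betw[OF bij, of ?f] f by simp
  then have "((\<lambda>v. star \<theta> a (v, i) * mon x v) has_sum ab (\<lambda>v. \<theta> (v, i)) x * ab a x) UNIV"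
  proof (rule has_sum_SigmaD)
    fix v :: "'l list"
    have m: "mon x (take n v) * mon x (drop n v) = mon x v" for n
      using mon_append[of x "take n v" "drop n v"] by simp
    have e: "?f (take n v, drop n v) = \<theta> (take n v, i) * a (drop n v) * mon x v" for n
      unfolding m[of n, symmetric] by simp
    have "(\<Sum>n\<le>length v. ?f (take n v, drop n v)) = star \<theta> a (v, i) * mon x v"
      unfolding star_def sum_distrib_right fst_conv snd_conv
      by (intro sum.cong refl e[unfolded fst_conv snd_conv])
    then show "((\<lambda>n. ?f (case (v, n) of (v, n) \<Rightarrow> (take n v, drop n v))) has_sum star \<theta> a (v, i) * mon x v) {..length v}"
      by (simp add: has_sum_finiteI)
  qed
  then show ?thesis
    using ab_has_sum[OF slices(1)[OF star_in(1)[OF a]] x] has_sum_unique by blast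
qed (simp add: ab_def)

text \<open>Gluing all lifts into one vector is what produces a common factor \<open>F\<close>. The
  components of \<theta> form the column, which is contractive because \<open>g\<close> is lifted,
  multiplied by \<open>star \<theta>\<close> and mapped back, each without increase of norm.\<close>

lemma column_factorization:
  fixes f :: "nat \<Rightarrow> 'a \<Rightarrow> complex"
  assumes f: "\<And>i. f i \<in> elems H" and sm: "summable (\<lambda>i. (hnorm H (f i))\<^sup>2)"
  shows "\<exists>\<Phi> F. F \<in> elems H \<and> (hnorm H F)\<^sup>2 \<le> (\<Sum>i. (hnorm H (f i))\<^sup>2) \<and> (\<forall>i. \<Phi> i \<in> multipliers H) \<and>
    column_bounded H \<Phi> \<and> column_norm H \<Phi> \<le> 1 \<and> (\<forall>i x. f i x = \<Phi> i x * F x)"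
proof -
  have "\<forall>i. \<exists>a. a \<in> elems ell2 \<and> hnorm ell2 a \<le> hnorm H (f i) \<and> ab a = f i"
    using ab_lift[OF f] by blast
  from choice[OF this] obtain a where
    a: "\<And>i. a i \<in> elems ell2" "\<And>i. hnorm ell2 (a i) \<le> hnorm H (f i)" "\<And>i. ab (a i) = f i" by blast
  define X where "X = (\<lambda>p. a (snd p) (fst p))"
  define \<sigma> where "\<sigma> = (\<Sum>i. (hnorm H (f i))\<^sup>2)"
  have sigma: "\<sigma> \<ge> 0" unfolding \<sigma>_def by (rule suminf_nonneg[OF sm]) simp
  have "(\<Sum>p\<in>T. (cmod (X p))\<^sup>2) \<le> \<sigma>" if T: "finite T" for T
  proof -
    have "(\<Sum>p\<in>T. (cmod (X p))\<^sup>2) \<le> (\<Sum>p\<in>fst ` T \<times> snd ` T. (cmod (X p))\<^sup>2)"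
      by (rule sum_mono2) (use T in \<open>auto simp: image_iff, force+\<close>)
    also have "\<dots> = (\<Sum>i\<in>snd ` T. \<Sum>v\<in>fst ` T. (cmod (a i v))\<^sup>2)"
      unfolding sum.cartesian_product' X_def by (subst sum.swap) simp
    also have "\<dots> \<le> (\<Sum>i\<in>snd ` T. (hnorm H (f i))\<^sup>2)"
    proof (rule sum_mono)
      fix i
      have "(\<Sum>v\<in>fst ` T. (cmod (a i v))\<^sup>2) \<le> (hnorm ell2 (a i))\<^sup>2"
        by (rule ell2_finite_sum_le[OF a(1)]) (use T in simp)
      also have "\<dots> \<le> (hnorm H (f i))\<^sup>2" by (rule power_mono[OF a(2)]) simp
      finally show "(\<Sum>v\<in>fst ` T. (cmod (a i v))\<^sup>2) \<le> (hnorm H (f i))\<^sup>2" .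
    qed
    also have "\<dots> \<le> \<sigma>" unfolding \<sigma>_def by (rule sum_le_suminf[OF sm]) (use T in auto)
    finally show ?thesis .
  qed
  then have X: "X \<in> elems ell2" "hnorm ell2 X \<le> sqrt \<sigma>"
    using ell2_boundI[of X \<sigma> "sqrt \<sigma>"] sigma by auto
  show ?thesis
  \<comment> \<open>If every \<open>f i\<close> vanishes there is no wandering vector; the zero
    column serves instead.\<close>
  proof (cases "X = (\<lambda>p. 0)")
    case True
    then have "a i v = 0" for i v unfolding X_def by (metis fst_conv snd_conv)
    then have "a i = (\<lambda>v. 0)" for i by auto
    then have f0: "f i x = 0" for i x using fun_cong[OF a(3)[of i], of x] by (simp add: ab_def split: if_splits)
    have "column_bounded H (\<lambda>i x. 0)" "column_norm H (\<lambda>i x. 0) \<le> 1"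
      using column_boundI[of "\<lambda>i x. 0" 1] zero_in by auto
    then show ?thesis using zero_in sigma f0
      by (intro exI[of _ "\<lambda>i x. 0"] exI[of _ "\<lambda>x. 0"]) (auto simp: multipliers_def \<sigma>_def)
  next
    case False
    then obtain \<theta> F where theta: "wandering_vector \<theta>" and F: "F \<in> elems ell2" "hnorm ell2 F \<le> hnorm ell2 X"
      and XF: "X = star \<theta> F" using cyclic_factorization[OF X(1)] by blast
    interpret wandering_vector \<theta> by (rule theta)
    define \<Phi> where "\<Phi> = (\<lambda>i. ab (\<lambda>v. \<theta> (v, i)))"
    have "f i x = \<Phi> i x * ab F x" for i x
    proof -
      have "a i = (\<lambda>v. star \<theta> F (v, i))" using XF by (auto simp: X_def fun_eq_iff)
      then show ?thesis using ab_star[OF theta F(1), of i x] a(3)[of i] by (simp add: \<Phi>_def)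
    qed
    moreover have "(hnorm H (ab F))\<^sup>2 \<le> \<sigma>"
    proof -
      have "hnorm H (ab F) \<le> sqrt \<sigma>" using ab_in(2)[OF F(1)] F(2) X(2) by linarith
      then have "(hnorm H (ab F))\<^sup>2 \<le> (sqrt \<sigma>)\<^sup>2"
        by (rule power_mono) (rule hnorm_nonneg[OF ab_in(1)[OF F(1)]])
      then show ?thesis using sigma by simp
    qed
    moreover have col: "(\<lambda>x. \<Phi> i x * g x) \<in> elems H \<and> (\<Sum>i<n. (hnorm H (\<lambda>x. \<Phi> i x * g x))\<^sup>2) \<le> (1 * hnorm H g)\<^sup>2"
      if g: "g \<in> elems H" for g i n
    proof -
      obtain b where b: "b \<in> elems ell2" "hnorm ell2 b \<le> hnorm H g" "ab b = g"
        using ab_lift[OF g] by blast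
      have eq: "(\<lambda>x. \<Phi> i x * g x) = ab (\<lambda>v. star \<theta> b (v, i))" for i
        using ab_star[OF theta b(1), of i] b(3) by (auto simp: \<Phi>_def fun_eq_iff)
      note sl = slices[OF star_in(1)[OF b(1)]]
      have "(\<Sum>i<n. (hnorm H (\<lambda>x. \<Phi> i x * g x))\<^sup>2) \<le> (\<Sum>i<n. (hnorm ell2 (\<lambda>v. star \<theta> b (v, i)))\<^sup>2)"
        unfolding eq by (intro sum_mono power_mono ab_in(2) sl hnorm_nonneg ab_in(1))
      also have "\<dots> \<le> (hnorm ell2 (star \<theta> b))\<^sup>2" by (rule sl(2))
      also have "\<dots> \<le> (hnorm ell2 b)\<^sup>2" by (rule power_mono[OF star_in(2)[OF b(1)]]) simp
      also have "\<dots> \<le> (1 * hnorm H g)\<^sup>2" using power_mono[OF b(2), of 2] by simp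
      finally show ?thesis unfolding eq using ab_in(1)[OF sl(1)] by simp
    qed
    moreover have "\<Phi> i \<in> multipliers H" for i
      unfolding multipliers_def using col by (auto simp: \<Phi>_def ab_def)
    moreover have "column_bounded H \<Phi>" "column_norm H \<Phi> \<le> 1"
      using column_boundI[of \<Phi> 1] col by auto
    ultimately show ?thesis unfolding \<sigma>_def using ab_in(1)[OF F(1)] by blast
  qed
qed

lemma row_op_in:
  assumes r: "row_bounded H \<Phi>" and v: "v \<in> tensor_l2 H"
  shows "row_op \<Phi> v \<in> elems H" "hnorm H (row_op \<Phi> v) \<le> row_norm H \<Phi> * tensor_l2_norm H v" "0 \<le> row_norm H \<Phi>"
proof -
  have b: "bounded_operator (tensor_l2 H) (tensor_l2_norm H) (elems H) (hnorm H) (row_op \<Phi>)"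
    using r by (simp add: row_bounded_def)
  then show "row_op \<Phi> v \<in> elems H" using v by (simp add: bounded_operator_def)
  show "hnorm H (row_op \<Phi> v) \<le> row_norm H \<Phi> * tensor_l2_norm H v" "0 \<le> row_norm H \<Phi>"
    unfolding row_norm_def
    using bounded_operator_norm[OF b tensor_l2_norm_nonneg] v by auto
qed

text \<open>The column and its row norm are part of the conclusion, so that one lemma serves both
  the qualitative and the quantitative theorem.\<close>

lemma weak_product_factorization:
  assumes rep: "weak_product_repr H h f g" and cr: "column_row_property H"
  shows "\<exists>F\<in>elems H. \<exists>G\<in>elems H. \<exists>\<Phi>. h = (\<lambda>x. F x * G x) \<and> (\<forall>i. \<Phi> i \<in> multipliers H) \<and>
    column_bounded H \<Phi> \<and> column_norm H \<Phi> \<le> 1 \<and> row_bounded H \<Phi> \<and> 0 \<le> row_norm H \<Phi> \<and>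
    hnorm H F \<le> sqrt (\<Sum>i. hnorm H (f i) * hnorm H (g i)) \<and>
    hnorm H G \<le> row_norm H \<Phi> * sqrt (\<Sum>i. hnorm H (f i) * hnorm H (g i))"
proof -
  define m where "m = (\<lambda>i. hnorm H (f i) * hnorm H (g i))"
  have fg: "f i \<in> elems H" "g i \<in> elems H" for i using rep by (auto simp: weak_product_repr_def)
  have m: "summable m" using rep by (simp add: weak_product_repr_def m_def)
  have h: "(\<lambda>i. f i x * g i x) sums h x" for x using rep by (simp add: weak_product_repr_def)
  have nn: "hnorm H (f i) \<ge> 0" "hnorm H (g i) \<ge> 0" for i using hnorm_nonneg fg by auto
  have m0: "m i \<ge> 0" for i using nn by (simp add: m_def)
  \<comment> \<open>The scaling that makes both norms equal to the square root of
    \<open>m i\<close>. If \<open>m i = 0\<close>, one factor vanishes, and s = 0 with inverse 0 = 0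
    discards the term.\<close>
  define s where "s = (\<lambda>i. if m i = 0 then 0 else sqrt (hnorm H (g i) / hnorm H (f i)))"
  define f' where "f' = (\<lambda>i x. of_real (s i) * f i x)"
  define g' where "g' = (\<lambda>i x. of_real (inverse (s i)) * g i x)"
  have in': "f' i \<in> elems H" "g' i \<in> elems H" for i unfolding f'_def g'_def by (intro scale_in fg)+
  have norms: "(hnorm H (f' i))\<^sup>2 = m i \<and> (hnorm H (g' i))\<^sup>2 = m i \<and> (\<forall>x. f' i x * g' i x = f i x * g i x)" for i
  proof (cases "m i = 0")
    case True
    then have "f i = (\<lambda>x. 0) \<or> g i = (\<lambda>x. 0)" using hnorm_eq_0 fg by (auto simp: m_def)
    then show ?thesis using True unfolding f'_def g'_def by (auto simp: s_def)
  next
    case False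
    then have pos: "hnorm H (f i) > 0" "hnorm H (g i) > 0" using nn[of i] by (auto simp: m_def less_le)
    then have s: "s i > 0" "(s i)\<^sup>2 = hnorm H (g i) / hnorm H (f i)" using False by (auto simp: s_def)
    have "(hnorm H (f' i))\<^sup>2 = (s i)\<^sup>2 * (hnorm H (f i))\<^sup>2"
      unfolding f'_def hnorm_scale[OF fg(1)] by (simp add: power_mult_distrib)
    moreover have "(hnorm H (g' i))\<^sup>2 = inverse ((s i)\<^sup>2) * (hnorm H (g i))\<^sup>2"
      unfolding g'_def hnorm_scale[OF fg(2)] by (simp add: power_mult_distrib power_inverse norm_inverse)
    ultimately show ?thesis
      using pos s(1) unfolding s(2) f'_def g'_def m_def by (simp add: power2_eq_square)
  qed
  have sq: "(\<lambda>i. (hnorm H (f' i))\<^sup>2) = m" "(\<lambda>i. (hnorm H (g' i))\<^sup>2) = m" using norms by auto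
  obtain \<Phi> F where F: "F \<in> elems H" "(hnorm H F)\<^sup>2 \<le> suminf m"
    and Phi: "\<forall>i. \<Phi> i \<in> multipliers H" "column_bounded H \<Phi>" "column_norm H \<Phi> \<le> 1"
    and fac: "\<forall>i x. f' i x = \<Phi> i x * F x"
    using column_factorization[of f'] in'(1) m sq(1) by auto
  have row: "row_bounded H \<Phi>" using cr Phi by (auto simp: column_row_property_def)
  have g': "g' \<in> tensor_l2 H" using in'(2) m sq(2) by (simp add: tensor_l2_def)
  have tn: "tensor_l2_norm H g' = sqrt (suminf m)" by (simp add: tensor_l2_norm_def sq(2))
  define G where "G = row_op \<Phi> g'"
  note G = row_op_in[OF row g', folded G_def, unfolded tn]
  have "h x = F x * G x" for x
  proof (cases "x \<in> points H")
    case True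
    have "summable (\<lambda>n. \<Phi> n x * g' n x)" using row g' True by (auto simp: row_bounded_def)
    then have "(\<lambda>n. F x * (\<Phi> n x * g' n x)) sums (F x * G x)"
      unfolding G_def row_op_def by (intro sums_mult summable_sums)
    moreover have "F x * (\<Phi> n x * g' n x) = f n x * g n x" for n
      using norms[of n] fac by (metis mult.assoc mult.commute)
    ultimately show ?thesis using h[of x] sums_unique2 by simp
  next
    case False
    then have "f i x = 0" "F x = 0" for i using elems_support fg F(1) by auto
    then show ?thesis using h[of x] sums_unique2[of "\<lambda>i. 0" "h x" 0] by simp
  qed
  moreover have "hnorm H F \<le> sqrt (suminf m)"
    using F(2) by (rule real_le_rsqrt)
  ultimately show ?thesis
    using F(1) G Phi row unfolding m_def[symmetric]
    by (intro bexI[of _ F] bexI[of _ G] exI[of _ \<Phi>]) auto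
qed

end

text \<open>Weak compactness of balls, phrased through cluster points in the product topology.\<close>

lemma pointwise_cluster:
  fixes p :: "nat \<Rightarrow> 't \<Rightarrow> complex"
  assumes bound: "\<And>j t. cmod (p j t) \<le> B t"
  shows "\<exists>q \<F>. \<F> \<noteq> bot \<and> \<F> \<le> sequentially \<and> (\<forall>t. ((\<lambda>j. p j t) \<longlongrightarrow> q t) \<F>)"
proof -
  have "compactin (product_topology (\<lambda>t. euclidean) UNIV) (PiE UNIV (\<lambda>t. cball (0::complex) (B t)))"
    unfolding compactin_PiE by (auto simp: compactin_euclidean_iff)
  then have "compact (PiE UNIV (\<lambda>t::'t. cball (0::complex) (B t)))"
    unfolding euclidean_product_topology compactin_euclidean_iff .
  moreover have "filtermap p sequentially \<noteq> bot" by (simp add: filtermap_bot_iff)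
  moreover have "eventually (\<lambda>f. f \<in> PiE UNIV (\<lambda>t::'t. cball (0::complex) (B t))) (filtermap p sequentially)"
    using bound by (simp add: eventually_filtermap PiE_UNIV_domain)
  ultimately obtain q where q: "inf (nhds q) (filtermap p sequentially) \<noteq> bot"
    unfolding compact_filter by blast
  \<comment> \<open>A filter replaces a subsequence: over an uncountable index type a bounded
    sequence need not have a pointwise convergent subsequence. The intersection with
    \<open>sequentially\<close> lets ordinary limits be used along the filter.\<close>
  define \<F> where "\<F> = inf (filtercomap p (nhds q)) sequentially"
  have "\<F> \<noteq> bot"
  proof
    assume "\<F> = bot"
    then have "eventually (\<lambda>_. False) \<F>" by simp
    then obtain P Q where PQ: "eventually P (filtercomap p (nhds q))" "eventually Q sequentially" "\<And>j. P j \<Longrightarrow> Q j \<Longrightarrow> False"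
      unfolding \<F>_def eventually_inf by blast
    obtain R where R: "eventually R (nhds q)" "\<And>j. R (p j) \<Longrightarrow> P j"
      using PQ(1) unfolding eventually_filtercomap by blast
    have "eventually (\<lambda>f. \<not> R f) (filtermap p sequentially)"
      unfolding eventually_filtermap using PQ(2) by (rule eventually_mono) (use PQ(3) R(2) in blast)
    then have "eventually (\<lambda>_. False) (inf (nhds q) (filtermap p sequentially))"
      unfolding eventually_inf using R(1) by (intro exI[of _ R] exI[of _ "\<lambda>f. \<not> R f"]) auto
    then show False using q by (simp add: trivial_limit_def)
  qed
  moreover have lim: "filterlim p (nhds q) \<F>"
    unfolding \<F>_def filterlim_def by (rule order_trans[OF filtermap_mono[OF inf_le1] filtermap_filtercomap])
  have "((\<lambda>j. p j t) \<longlongrightarrow> q t) \<F>" for t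
  proof (rule topological_tendstoI)
    fix U assume U: "open U" "q t \<in> U"
    have "open ((\<lambda>f::'t \<Rightarrow> complex. f t) -` U)"
      by (rule open_vimage[OF U(1) continuous_on_product_coordinates])
    from topological_tendstoD[OF lim this] U(2) show "\<forall>\<^sub>F j in \<F>. p j t \<in> U" by simp
  qed
  ultimately show ?thesis unfolding \<F>_def by (intro exI[of _ q] exI[of _ "\<F>"]) (auto simp: \<F>_def)
qed

context hilbert_function_space
begin

text \<open>Lower semicontinuity of the norm: the functionals in \<open>kernel_criterion\<close> see
  only point values, so their bounds pass to pointwise limits.\<close>

lemma cluster_in:
  assumes F: "\<And>j::nat. F j \<in> elems H" "\<And>j. hnorm H (F j) \<le> C j" and C: "(C \<longlongrightarrow> c) \<F>" "c \<ge> 0"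
    and nb: "\<F> \<noteq> bot" and lim: "\<And>x. ((\<lambda>j. F j x) \<longlongrightarrow> f x) \<F>"
  shows "f \<in> elems H \<and> hnorm H f \<le> c"
proof (rule kernel_criterion[OF _ C(2)])
  show "f x = 0" if "x \<notin> points H" for x
    using lim[of x] elems_support[OF F(1) that] tendsto_unique[OF nb _ tendsto_const] by simp
  fix S d assume S: "finite S" "S \<subseteq> points H"
  let ?K = "\<lambda>y x. if x \<in> points H then k x y else 0"
  let ?v = "\<lambda>x. \<Sum>y\<in>S. d y * ?K y x"
  have v: "?v \<in> elems H" by (rule sum_in, rule scale_in, rule kernel_in) (use S in auto)
  show "cmod (\<Sum>y\<in>S. cnj (d y) * f y) \<le> c * hnorm H ?v"
  proof (rule tendsto_le[OF nb])
    show "((\<lambda>j. C j * hnorm H ?v) \<longlongrightarrow> c * hnorm H ?v) \<F>" by (rule tendsto_mult_right[OF C(1)])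
    show "((\<lambda>j. cmod (\<Sum>y\<in>S. cnj (d y) * F j y)) \<longlongrightarrow> cmod (\<Sum>y\<in>S. cnj (d y) * f y)) \<F>"
      by (intro tendsto_intros lim)
    have "cmod (\<Sum>y\<in>S. cnj (d y) * F j y) \<le> C j * hnorm H ?v" for j
    proof -
      have "ip H ?v (F j) = (\<Sum>y\<in>S. d y * ip H (?K y) (F j))"
        by (subst ip_sum) (use S F(1) in \<open>auto simp: scale_in kernel_in ip_scale intro!: sum.cong\<close>)
      also have "\<dots> = cnj (\<Sum>y\<in>S. cnj (d y) * F j y)"
        unfolding cnj_sum using S
        by (intro sum.cong refl) (simp add: ip_cnj[OF F(1) kernel_in] subset_iff flip: reproducing[OF F(1)])
      finally have "cmod (\<Sum>y\<in>S. cnj (d y) * F j y) \<le> hnorm H ?v * hnorm H (F j)"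
        using cauchy_schwarz[OF v F(1)[of j]] by (simp only: complex_mod_cnj)
      also have "\<dots> \<le> hnorm H ?v * C j" by (rule mult_left_mono[OF F(2) hnorm_nonneg[OF v]])
      finally show ?thesis by (simp add: mult.commute)
    qed
    then show "\<forall>\<^sub>F j in \<F>. cmod (\<Sum>y\<in>S. cnj (d y) * F j y) \<le> C j * hnorm H ?v" by simp
  qed
qed

end

section \<open>Factorization with control of the norms\<close>

context cnp_space
begin

theorem factorization:
  assumes cr: "column_row_property H" and h: "h \<in> weak_product H"
  shows "\<exists>f\<in>elems H. \<exists>g\<in>elems H. h = (\<lambda>x. f x * g x)"
proof -
  obtain f g where "weak_product_repr H h f g" using h by (auto simp: weak_product_def)
  from weak_product_factorization[OF this cr] show ?thesis by blast
qed

text \<open>Tested on the column with first entry 1 and all others 0: a negative \<open>c\<close>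
  forces its norm to be 0, hence the kernel function at \<open>x\<close> to vanish. On an empty set
  all norms are 0 and negative constants do occur, whence the point \<open>x\<close>.\<close>

lemma column_row_constant_nonneg:
  assumes c: "column_row_constant H c" and x: "x \<in> points H"
  shows "c \<ge> 0"
proof (rule ccontr)
  assume neg: "\<not> c \<ge> 0"
  define \<Phi> :: "nat \<Rightarrow> 'a \<Rightarrow> complex" where "\<Phi> = (\<lambda>n x. of_bool (n = 0 \<and> x \<in> points H))"
  have prod: "(\<lambda>x. \<Phi> n x * g x) = (if n = 0 then g else (\<lambda>x. 0))" if "g \<in> elems H" for g n
    using elems_support[OF that] by (auto simp: \<Phi>_def fun_eq_iff)
  have mult: "\<Phi> n \<in> multipliers H" for n
    using prod zero_in by (auto simp: multipliers_def \<Phi>_def)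
  have sums: "(\<Sum>i<n. (hnorm H (\<lambda>x. \<Phi> i x * g x))\<^sup>2) = (if n = 0 then 0 else (hnorm H g)\<^sup>2)"
    if "g \<in> elems H" for g n
  proof -
    have "(\<Sum>i<n. (hnorm H (\<lambda>x. \<Phi> i x * g x))\<^sup>2) = (\<Sum>i<n. if i = 0 then (hnorm H g)\<^sup>2 else 0)"
      by (intro sum.cong refl) (simp add: prod[OF that])
    then show ?thesis by (simp add: sum.delta)
  qed
  have col: "column_bounded H \<Phi>"
    by (rule column_boundI(1)[of _ 1]) (use sums prod zero_in in auto)
  then have b: "bounded_operator (elems H) (hnorm H) (tensor_l2 H) (tensor_l2_norm H) (column_op \<Phi>)"
    by (simp add: column_bounded_def)
  have r: "row_bounded H \<Phi>" "row_norm H \<Phi> \<le> c * column_norm H \<Phi>"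
    using c mult col by (auto simp: column_row_constant_def)
  have "(\<lambda>n x. 0) \<in> tensor_l2 H" using zero_in by (simp add: tensor_l2_def)
  from row_op_in(3)[OF r(1) this] have "0 \<le> c * column_norm H \<Phi>" using r(2) by simp
  moreover have "0 \<le> column_norm H \<Phi>"
    unfolding column_norm_def by (rule bounded_operator_norm(1)[OF b hnorm_nonneg])
  ultimately have cn: "column_norm H \<Phi> = 0" using neg by (simp add: zero_le_mult_iff)
  note kx = ker_in[OF x]
  have "tensor_l2_norm H (column_op \<Phi> (ker x)) \<le> 0"
    using bounded_operator_norm(2)[OF b hnorm_nonneg kx] cn by (simp add: column_norm_def)
  moreover have "tensor_l2_norm H (column_op \<Phi> (ker x)) = hnorm H (ker x)"
  proof -
    have "(\<lambda>n. (hnorm H (column_op \<Phi> (ker x) n))\<^sup>2) sums (\<Sum>n\<in>{0}. (hnorm H (column_op \<Phi> (ker x) n))\<^sup>2)"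
      by (rule sums_finite) (auto simp: column_op_def prod[OF kx])
    then show ?thesis
      using hnorm_nonneg[OF kx] by (simp add: tensor_l2_norm_def sums_unique[symmetric] column_op_def prod[OF kx])
  qed
  ultimately have "ker x = (\<lambda>x. 0)" using hnorm_eq_0[OF kx] hnorm_nonneg[OF kx] by simp
  then have "k x x = 0" using x by (metis ker_def)
  then have "(\<Sum>\<^sub>\<infinity>i. u x i * cnj (u x i)) = 1" using kernel_eq[OF x x] by auto
  then have "complex_of_real (\<Sum>\<^sub>\<infinity>i. (cmod (u x i))\<^sup>2) = 1"
    using ell2_ip_self[of "u x"] by (simp add: ell2_ip)
  then show False using u_less[OF x] by simp
qed

theorem factorization_norm:
  assumes c: "column_row_constant H c" and h: "h \<in> weak_product H"
  shows "\<exists>f\<in>elems H. \<exists>g\<in>elems H. h = (\<lambda>x. f x * g x) \<and> hnorm H f * hnorm H g \<le> c * weak_product_norm H h"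
proof -
  have cr: "column_row_property H" using c by (auto simp: column_row_property_def column_row_constant_def)
  define A where "A = {(\<Sum>i. hnorm H (f i) * hnorm H (g i)) | f g. weak_product_repr H h f g}"
  define N where "N = weak_product_norm H h"
  have N: "N = Inf A" by (simp add: N_def A_def weak_product_norm_def)
  have ne: "A \<noteq> {}" using h by (auto simp: A_def weak_product_def)
  have nonneg: "0 \<le> a" if "a \<in> A" for a
    using that by (auto simp: A_def weak_product_repr_def intro!: suminf_nonneg mult_nonneg_nonneg hnorm_nonneg)
  have N0: "0 \<le> N" unfolding N by (rule cInf_greatest[OF ne nonneg])
  show ?thesis
  \<comment> \<open>Without points the sign of \<open>c\<close> is unknown, but both sides of the
    estimate are 0.\<close>
  proof (cases "points H = {}")
    case True
    then have z: "f = (\<lambda>x. 0)" if "f \<in> elems H" for f using elems_support[OF that] by auto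
    have "a = 0" if a: "a \<in> A" for a
    proof -
      obtain f g where a: "weak_product_repr H h f g" "a = (\<Sum>i. hnorm H (f i) * hnorm H (g i))"
        using a by (auto simp: A_def)
      then have "hnorm H (f i) = 0" for i using z[of "f i"] by (simp add: weak_product_repr_def)
      then show ?thesis using a(2) by simp
    qed
    then have "A = {0}" using ne by auto
    then have "N = 0" by (simp add: N)
    moreover have "h = (\<lambda>x. 0 * 0)"
    proof -
      obtain f g where "f \<in> elems H" "h = (\<lambda>x. f x * g x)" using factorization[OF cr h] by blast
      then show ?thesis using z[of f] by simp
    qed
    ultimately show ?thesis using zero_in unfolding N_def[symmetric]
      by (intro bexI[of _ "\<lambda>x. 0"]) auto
  next
    case False
    then have c0: "c \<ge> 0" using column_row_constant_nonneg[OF c] by blast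
    \<comment> \<open>The infimum need not be attained, so representations of norm below N + 1/(j +
      1) are factored. Both norms are kept in terms of the square root of \<sigma> so that each
      factor has its own limit bound.\<close>
    have step: "\<exists>F G \<sigma>. F \<in> elems H \<and> G \<in> elems H \<and> h = (\<lambda>x. F x * G x) \<and> 0 \<le> \<sigma> \<and> N \<le> \<sigma> \<and>
        \<sigma> \<le> N + inverse (real (Suc j)) \<and> hnorm H F \<le> sqrt \<sigma> \<and> hnorm H G \<le> c * sqrt \<sigma>" for j
    proof -
      have "Inf A < N + inverse (real (Suc j))" unfolding N by simp
      from cInf_lessD[OF ne this] obtain a where a: "a \<in> A" "a < N + inverse (real (Suc j))" by blast
      then obtain f g where rep: "weak_product_repr H h f g" and a_eq: "a = (\<Sum>i. hnorm H (f i) * hnorm H (g i))"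
        by (auto simp: A_def)
      obtain F G \<Phi> where FG: "F \<in> elems H" "G \<in> elems H" "h = (\<lambda>x. F x * G x)"
        and Phi: "\<forall>i. \<Phi> i \<in> multipliers H" "column_bounded H \<Phi>" "column_norm H \<Phi> \<le> 1"
        and nF: "hnorm H F \<le> sqrt a" and nG: "hnorm H G \<le> row_norm H \<Phi> * sqrt a"
        using weak_product_factorization[OF rep cr] unfolding a_eq by blast
      have "row_norm H \<Phi> \<le> c * column_norm H \<Phi>" using c Phi by (auto simp: column_row_constant_def)
      also have "\<dots> \<le> c" using mult_left_mono[OF Phi(3) c0] by simp
      finally have "row_norm H \<Phi> * sqrt a \<le> c * sqrt a"
        by (rule mult_right_mono) (use nonneg[OF a(1)] in simp)
      then have "hnorm H G \<le> c * sqrt a" using nG by simp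
      moreover have "N \<le> a" unfolding N by (rule cInf_lower[OF a(1)]) (use nonneg in \<open>auto intro!: bdd_belowI[of _ 0]\<close>)
      ultimately show ?thesis using FG nF nonneg[OF a(1)] a(2) by (intro exI[of _ F] exI[of _ G] exI[of _ a]) simp
    qed
    from choice[OF allI[OF step]] obtain F where
      "\<forall>j. \<exists>G \<sigma>. F j \<in> elems H \<and> G \<in> elems H \<and> h = (\<lambda>x. F j x * G x) \<and> 0 \<le> \<sigma> \<and> N \<le> \<sigma> \<and>
        \<sigma> \<le> N + inverse (real (Suc j)) \<and> hnorm H (F j) \<le> sqrt \<sigma> \<and> hnorm H G \<le> c * sqrt \<sigma>" ..
    from choice[OF this] obtain G where
      "\<forall>j. \<exists>\<sigma>. F j \<in> elems H \<and> G j \<in> elems H \<and> h = (\<lambda>x. F j x * G j x) \<and> 0 \<le> \<sigma> \<and> N \<le> \<sigma> \<and>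
        \<sigma> \<le> N + inverse (real (Suc j)) \<and> hnorm H (F j) \<le> sqrt \<sigma> \<and> hnorm H (G j) \<le> c * sqrt \<sigma>" ..
    from choice[OF this] obtain \<sigma> where
      all: "\<forall>j. F j \<in> elems H \<and> G j \<in> elems H \<and> h = (\<lambda>x. F j x * G j x) \<and> 0 \<le> \<sigma> j \<and> N \<le> \<sigma> j \<and>
        \<sigma> j \<le> N + inverse (real (Suc j)) \<and> hnorm H (F j) \<le> sqrt (\<sigma> j) \<and> hnorm H (G j) \<le> c * sqrt (\<sigma> j)" ..
    then have FG: "\<And>j. F j \<in> elems H" "\<And>j. G j \<in> elems H" "\<And>j. h = (\<lambda>x. F j x * G j x)"
      and sg: "\<And>j. 0 \<le> \<sigma> j" "\<And>j. N \<le> \<sigma> j" "\<And>j. \<sigma> j \<le> N + inverse (real (Suc j))"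
      and nF: "\<And>j. hnorm H (F j) \<le> sqrt (\<sigma> j)" and nG: "\<And>j. hnorm H (G j) \<le> c * sqrt (\<sigma> j)" by blast+
    have sig_lim: "\<sigma> \<longlonglongrightarrow> N"
    proof (rule tendsto_sandwich[of "\<lambda>_. N" \<sigma> _ "\<lambda>j. N + inverse (real (Suc j))"])
      show "(\<lambda>j. N + inverse (real (Suc j))) \<longlonglongrightarrow> N"
        using tendsto_add[OF tendsto_const LIMSEQ_inverse_real_of_nat, of N] by simp
    qed (use sg in auto)
    define M where "M = sqrt (N + 1)"
    have M: "sqrt (\<sigma> j) \<le> M" for j
      unfolding M_def using sg(3)[of j] inverse_le_1_iff[of "real (Suc j)"] by (intro real_sqrt_le_mono) auto
    have "\<forall>x. \<exists>C\<ge>0. \<forall>f\<in>elems H. cmod (f x) \<le> C * hnorm H f" using point_bound[OF zero_in] by blast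
    from choice[OF this] obtain C where C: "\<And>x. C x \<ge> 0" "\<And>x f. f \<in> elems H \<Longrightarrow> cmod (f x) \<le> C x * hnorm H f"
      by blast
    \<comment> \<open>Both sequences are put into one family so that they converge along the same
      filter, and with them their product.\<close>
    define p where "p = (\<lambda>j t. if snd t then F j (fst t) else G j (fst t))"
    have "cmod (p j t) \<le> C (fst t) * (M + c * M)" for j t
    proof -
      have "0 \<le> sqrt (\<sigma> j)" using sg(1) by simp
      then have M0: "0 \<le> M" using M[of j] by linarith
      have "hnorm H (F j) \<le> M + c * M"
        using nF[of j] M[of j] mult_nonneg_nonneg[OF c0 M0] by linarith
      moreover have "hnorm H (G j) \<le> M + c * M"
        using nG[of j] mult_left_mono[OF M[of j] c0] M0 by linarith
      ultimately show ?thesis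
        unfolding p_def using C FG order_trans[OF C(2) mult_left_mono[OF _ C(1)]] by auto
    qed
    then obtain q \<F> where nb: "\<F> \<noteq> bot" and le: "\<F> \<le> sequentially" and lim: "\<forall>t. ((\<lambda>j. p j t) \<longlongrightarrow> q t) \<F>"
      using pointwise_cluster[of p "\<lambda>t. C (fst t) * (M + c * M)"] by blast
    define f where "f = (\<lambda>x. q (x, True))"
    define g where "g = (\<lambda>x. q (x, False))"
    have lf: "((\<lambda>j. F j x) \<longlongrightarrow> f x) \<F>" and lg: "((\<lambda>j. G j x) \<longlongrightarrow> g x) \<F>" for x
      using spec[OF lim, of "(x, True)"] spec[OF lim, of "(x, False)"] by (simp_all add: p_def f_def g_def)
    have sl: "((\<lambda>j. sqrt (\<sigma> j)) \<longlongrightarrow> sqrt N) \<F>"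
      by (rule tendsto_real_sqrt[OF tendsto_mono[OF le sig_lim]])
    have f: "f \<in> elems H \<and> hnorm H f \<le> sqrt N"
      by (rule cluster_in[OF FG(1) nF sl _ nb lf]) (simp add: N0)
    have g: "g \<in> elems H \<and> hnorm H g \<le> c * sqrt N"
      by (rule cluster_in[OF FG(2) nG tendsto_mult_left[OF sl] _ nb lg]) (simp add: N0 c0)
    have "h x = f x * g x" for x
    proof (rule tendsto_unique[OF nb])
      show "((\<lambda>j. F j x * G j x) \<longlongrightarrow> f x * g x) \<F>" by (rule tendsto_mult[OF lf lg])
      have "F j x * G j x = h x" for j using fun_cong[OF FG(3)[of j], of x] by simp
      then show "((\<lambda>j. F j x * G j x) \<longlongrightarrow> h x) \<F>" by simp
    qed
    moreover have "hnorm H f * hnorm H g \<le> sqrt N * (c * sqrt N)"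
      using f g by (intro mult_mono) (auto simp: N0 hnorm_nonneg)
    then have "hnorm H f * hnorm H g \<le> c * N" using N0 by (simp add: mult.left_commute)
    ultimately show ?thesis using f g unfolding N_def by (intro bexI[of _ f] bexI[of _ g]) auto
  qed
qed

end

section \<open>Columns and rows of power series\<close>

text \<open>Expansion of the squares over the fibres of \<open>key\<close>. Read from right to left,
  it shows that a form coupling indices with equal keys is nonnegative.\<close>

lemma sum_fibres_norm_sq:
  fixes t :: "'p \<Rightarrow> complex"
  assumes P: "finite P" and K: "finite K" and key: "key ` P \<subseteq> K"
  shows "of_real (\<Sum>y\<in>K. (cmod (\<Sum>p\<in>P. if key p = y then t p else 0))\<^sup>2) =
    (\<Sum>p\<in>P. \<Sum>q\<in>P. if key p = key q then t p * cnj (t q) else 0)"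
proof -
  have "of_real (\<Sum>y\<in>K. (cmod (\<Sum>p\<in>P. if key p = y then t p else 0))\<^sup>2) =
      (\<Sum>y\<in>K. \<Sum>p\<in>P. \<Sum>q\<in>P. (if key p = y then t p else 0) * cnj (if key q = y then t q else 0))"
    unfolding of_real_sum complex_norm_square cnj_sum sum_product ..
  also have "\<dots> = (\<Sum>p\<in>P. \<Sum>q\<in>P. \<Sum>y\<in>K. (if key p = y then t p else 0) * cnj (if key q = y then t q else 0))"
    by (subst sum.swap, intro sum.cong refl, subst sum.swap, rule refl)
  also have "\<dots> = (\<Sum>p\<in>P. \<Sum>q\<in>P. if key p = key q then t p * cnj (t q) else 0)"
  proof (intro sum.cong refl)
    fix p q assume "p \<in> P" "q \<in> P"
    have "(\<Sum>y\<in>K. (if key p = y then t p else 0) * cnj (if key q = y then t q else 0)) =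
        (\<Sum>y\<in>{key p}. (if key p = y then t p else 0) * cnj (if key q = y then t q else 0))"
      using key \<open>p \<in> P\<close> K by (intro sum.mono_neutral_right) auto
    then show "(\<Sum>y\<in>K. (if key p = y then t p else 0) * cnj (if key q = y then t q else 0)) =
        (if key p = key q then t p * cnj (t q) else 0)" by auto
  qed
  finally show ?thesis .
qed

lemma cmod_sum_sq_le:
  assumes "finite S"
  shows "(cmod (\<Sum>i\<in>S. f i))\<^sup>2 \<le> real (card S) * (\<Sum>i\<in>S. (cmod (f i))\<^sup>2)"
proof -
  have "(cmod (\<Sum>i\<in>S. f i))\<^sup>2 \<le> (\<Sum>i\<in>S. cmod (f i))\<^sup>2"
    by (intro power_mono norm_sum) auto
  also have "\<dots> = (\<Sum>i\<in>S. 1 * cmod (f i))\<^sup>2" by simp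
  also have "\<dots> \<le> (\<Sum>i\<in>S. 1\<^sup>2) * (\<Sum>i\<in>S. (cmod (f i))\<^sup>2)"
    by (rule Cauchy_Schwarz_ineq_sum)
  finally show ?thesis by simp
qed

section \<open>Weighted norms and convolution on a graded monoid\<close>

locale graded_monoid =
  fixes deg :: "'i::cancel_comm_monoid_add \<Rightarrow> nat"
  assumes deg_add: "deg (A + B) = deg A + deg B"
    and finite_deg_le: "finite {A. deg A \<le> n}"
begin

definition conv :: "('i \<Rightarrow> complex) \<Rightarrow> ('i \<Rightarrow> complex) \<Rightarrow> 'i \<Rightarrow> complex" where
  "conv p a A = (\<Sum>(B, C)\<in>{(B, C). B + C = A}. p B * a C)"

definition nrm :: "('i \<Rightarrow> real) \<Rightarrow> nat \<Rightarrow> ('i \<Rightarrow> complex) \<Rightarrow> real" where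
  "nrm w J a = (\<Sum>A\<in>{A. deg A \<le> J}. w A * (cmod (a A))\<^sup>2)"

lemma finite_pairs: "finite {(B, C). B + C = (A :: 'i)}"
  by (rule finite_subset[OF _ finite_cartesian_product[OF finite_deg_le[of "deg A"] finite_deg_le[of "deg A"]]])
    (auto simp: deg_add)

lemma conv_cong:
  assumes "\<And>B C. B + C = A \<Longrightarrow> p B * a C = q B * b C"
  shows "conv p a A = conv q b A"
  unfolding conv_def by (rule sum.cong) (use assms in auto)

lemma conv_cong_scaled:
  assumes "\<And>B C. B + C = A \<Longrightarrow> q B * b C = z * (p B * a C)"
  shows "conv q b A = z * conv p a A"
  unfolding conv_def sum_distrib_left by (rule sum.cong) (use assms in auto)

lemma nrm_mono: "(\<And>A. deg A \<le> J \<Longrightarrow> w A * (cmod (a A))\<^sup>2 \<le> w' A * (cmod (b A))\<^sup>2) \<Longrightarrow> nrm w J a \<le> nrm w' J b"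
  unfolding nrm_def by (intro sum_mono) auto

lemma nrm_cong: "(\<And>A. deg A \<le> J \<Longrightarrow> w A * (cmod (a A))\<^sup>2 = w' A * (cmod (b A))\<^sup>2) \<Longrightarrow> nrm w J a = nrm w' J b"
  unfolding nrm_def by (intro sum.cong) auto

lemma nrm_sum_le:
  assumes "finite S" "\<And>A. w A \<ge> 0"
  shows "nrm w J (\<lambda>A. \<Sum>i\<in>S. f i A) \<le> real (card S) * (\<Sum>i\<in>S. nrm w J (f i))"
proof -
  have "nrm w J (\<lambda>A. \<Sum>i\<in>S. f i A) \<le> (\<Sum>A\<in>{A. deg A \<le> J}. w A * (real (card S) * (\<Sum>i\<in>S. (cmod (f i A))\<^sup>2)))"
    unfolding nrm_def by (intro sum_mono mult_left_mono cmod_sum_sq_le assms)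
  also have "\<dots> = real (card S) * (\<Sum>A\<in>{A. deg A \<le> J}. \<Sum>i\<in>S. w A * (cmod (f i A))\<^sup>2)"
    unfolding sum_distrib_left by (intro sum.cong refl) (simp add: sum_distrib_left mult.left_commute)
  also have "(\<Sum>A\<in>{A. deg A \<le> J}. \<Sum>i\<in>S. w A * (cmod (f i A))\<^sup>2) = (\<Sum>i\<in>S. nrm w J (f i))"
    unfolding nrm_def by (rule sum.swap)
  finally show ?thesis .
qed

lemma nrm_scale: "nrm w J (\<lambda>A. z * a A) = (cmod z)\<^sup>2 * nrm w J a"
  unfolding nrm_def sum_distrib_left
  by (intro sum.cong refl) (simp add: norm_mult power_mult_distrib)

subsection \<open>Weights for which rows are dominated by columns\<close>

text \<open>The supports are finite so that the truncation at M + N cuts nothing off from any of the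
  products.\<close>

definition row_weight :: "('i \<Rightarrow> real) \<Rightarrow> bool" where
  "row_weight \<gamma> \<longleftrightarrow> (\<forall>M N n0 \<psi> h.
     (\<forall>n A. deg A > M \<longrightarrow> \<psi> n A = 0) \<longrightarrow> (\<forall>n A. deg A > N \<longrightarrow> h n A = 0) \<longrightarrow>
     nrm \<gamma> (M + N) (\<lambda>A. \<Sum>n<n0::nat. conv (\<psi> n) (h n) A) \<le>
       (\<Sum>n<n0. \<Sum>m<n0. nrm \<gamma> (M + N) (conv (\<psi> n) (h m))))"

text \<open>The square root of \<open>ch\<close> is multiplicative, so multiplying both factors by
  it multiplies every convolution by it.\<close>

lemma row_weight_scale:
  assumes g: "row_weight \<gamma>" and chi: "\<And>A B. ch (A + B) = ch A * ch B" "\<And>A. ch A \<ge> 0"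
  shows "row_weight (\<lambda>A. \<gamma> A * ch A)"
  unfolding row_weight_def
proof (intro allI impI)
  fix M N n0 and \<psi> h :: "nat \<Rightarrow> 'i \<Rightarrow> complex"
  assume psi: "\<forall>n A. deg A > M \<longrightarrow> \<psi> n A = 0" and h: "\<forall>n A. deg A > N \<longrightarrow> h n A = 0"
  define s where "s = (\<lambda>A. complex_of_real (sqrt (ch A)))"
  have s_add: "s (B + C) = s B * s C" for B C
    unfolding s_def chi(1) real_sqrt_mult by simp
  have s_sq: "(cmod (s A))\<^sup>2 = ch A" for A
    unfolding s_def using chi(2)[of A] by simp
  define \<psi>' where "\<psi>' = (\<lambda>n A. s A * \<psi> n A)"
  define h' where "h' = (\<lambda>n A. s A * h n A)"
  have conv: "conv (\<psi>' n) (h' m) A = s A * conv (\<psi> n) (h m) A" for n m A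
    by (rule conv_cong_scaled) (auto simp: \<psi>'_def h'_def s_add)
  have "nrm \<gamma> (M + N) (\<lambda>A. \<Sum>n<n0. conv (\<psi>' n) (h' n) A) \<le>
      (\<Sum>n<n0. \<Sum>m<n0. nrm \<gamma> (M + N) (conv (\<psi>' n) (h' m)))"
    using g psi h unfolding row_weight_def \<psi>'_def h'_def by simp
  moreover have "nrm \<gamma> (M + N) (conv (\<psi>' n) (h' m)) = nrm (\<lambda>A. \<gamma> A * ch A) (M + N) (conv (\<psi> n) (h m))" for n m
    by (rule nrm_cong) (simp add: conv norm_mult power_mult_distrib s_sq)
  moreover have "nrm \<gamma> (M + N) (\<lambda>A. \<Sum>n<n0. conv (\<psi>' n) (h' n) A) =
      nrm (\<lambda>A. \<gamma> A * ch A) (M + N) (\<lambda>A. \<Sum>n<n0. conv (\<psi> n) (h n) A)"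
    by (rule nrm_cong) (simp add: conv norm_mult power_mult_distrib s_sq flip: sum_distrib_left)
  ultimately show "nrm (\<lambda>A. \<gamma> A * ch A) (M + N) (\<lambda>A. \<Sum>n<n0. conv (\<psi> n) (h n) A) \<le>
       (\<Sum>n<n0. \<Sum>m<n0. nrm (\<lambda>A. \<gamma> A * ch A) (M + N) (conv (\<psi> n) (h m)))"
    by simp
qed

text \<open>Both sides of the defining inequality are linear in the weight.\<close>

lemma row_weight_integral:
  fixes \<gamma> :: "real \<Rightarrow> 'i \<Rightarrow> real"
  assumes g: "\<And>t. t \<in> T \<Longrightarrow> row_weight (\<gamma> t)"
    and int: "\<And>A. ((\<lambda>t. \<gamma> t A) has_integral g A) T"
  shows "row_weight g"
  unfolding row_weight_def
proof (intro allI impI)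
  fix M N n0 and \<psi> h :: "nat \<Rightarrow> 'i \<Rightarrow> complex"
  assume psi: "\<forall>n A. deg A > M \<longrightarrow> \<psi> n A = 0" and h: "\<forall>n A. deg A > N \<longrightarrow> h n A = 0"
  have nrm_int: "((\<lambda>t. nrm (\<gamma> t) J a) has_integral nrm g J a) T" for J a
    unfolding nrm_def by (intro has_integral_sum finite_deg_le has_integral_mult_left int)
  show "nrm g (M + N) (\<lambda>A. \<Sum>n<n0. conv (\<psi> n) (h n) A) \<le>
       (\<Sum>n<n0. \<Sum>m<n0. nrm g (M + N) (conv (\<psi> n) (h m)))"
  proof (rule has_integral_le[OF nrm_int])
    show "((\<lambda>t. \<Sum>n<n0. \<Sum>m<n0. nrm (\<gamma> t) (M + N) (conv (\<psi> n) (h m))) has_integral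
        (\<Sum>n<n0. \<Sum>m<n0. nrm g (M + N) (conv (\<psi> n) (h m)))) T"
      by (intro has_integral_sum finite_lessThan nrm_int)
  qed (use g psi h in \<open>auto simp: row_weight_def\<close>)
qed

text \<open>Passing from the convolution \<open>\<psi> * h\<close> to the correlation of \<open>\<psi>\<close> and \<open>h\<close> does not change
  the norm, and for correlations the claim is Lagrange's identity.\<close>

lemma row_weight_const: "row_weight (\<lambda>A. 1)"
  unfolding row_weight_def
proof (intro allI impI)
  fix M N n0 and \<psi> h :: "nat \<Rightarrow> 'i \<Rightarrow> complex"
  assume psi: "\<forall>n A. deg A > M \<longrightarrow> \<psi> n A = 0" and h: "\<forall>n A. deg A > N \<longrightarrow> h n A = 0"
  define X where "X = {A. deg A \<le> M}"
  define Y where "Y = {A. deg A \<le> N}"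
  define P where "P = X \<times> Y"
  define D where "D = {A. deg A \<le> M + N}"
  have fin: "finite X" "finite Y" "finite P" "finite D"
    unfolding X_def Y_def P_def D_def by (simp_all add: finite_deg_le)
  define t where "t = (\<lambda>n m (p::'i \<times> 'i). \<psi> n (fst p) * h m (snd p))"
  define s where "s = (\<lambda>n m (p::'i \<times> 'i). cnj (\<psi> n (fst p)) * h m (snd p))"
  \<comment> \<open>\<open>I\<close> couples pairs (B, C) with equal sums, \<open>I'\<close> those
    with equal differences C - B; a monoid has no subtraction, so differences are compared
    crosswise.\<close>
  define I where "I = (\<lambda>u v :: 'i \<times> 'i \<Rightarrow> complex. \<Sum>p\<in>P. \<Sum>q\<in>P.
    if fst p + snd p = fst q + snd q then u p * cnj (v q) else 0)"
  define I' where "I' = (\<lambda>u v :: 'i \<times> 'i \<Rightarrow> complex. \<Sum>p\<in>P. \<Sum>q\<in>P.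
    if snd p + fst q = snd q + fst p then u p * cnj (v q) else 0)"
  have supp: "deg A \<le> M" if "\<psi> n A \<noteq> 0" for n A
    using psi that by (meson not_le)
  have supp': "deg A \<le> N" if "h n A \<noteq> 0" for n A
    using h that by (meson not_le)
  have conv_t: "conv (\<psi> n) (h m) A = (\<Sum>p\<in>P. if fst p + snd p = A then t n m p else 0)" for n m A
  proof -
    have "conv (\<psi> n) (h m) A = (\<Sum>p\<in>{p\<in>P. fst p + snd p = A}. t n m p)"
      unfolding conv_def
    proof (rule sum.mono_neutral_cong_right[OF finite_pairs])
      show "\<forall>p\<in>{(B, C). B + C = A} - {p \<in> P. fst p + snd p = A}. (case p of (B, C) \<Rightarrow> \<psi> n B * h m C) = 0"
        by (auto simp: P_def X_def Y_def supp supp')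
    qed (auto simp: t_def)
    also have "\<dots> = (\<Sum>p\<in>P. if fst p + snd p = A then t n m p else 0)"
      by (rule sum.inter_filter[OF fin(3)])
    finally show ?thesis .
  qed
  have sub: "(\<lambda>p. fst p + snd p) ` P \<subseteq> D"
    by (auto simp: P_def X_def Y_def D_def deg_add)
  have nrm_t: "of_real (nrm (\<lambda>A. 1) (M + N) (\<lambda>A. \<Sum>p\<in>P. if fst p + snd p = A then u p else 0)) = I u u" for u
    unfolding nrm_def I_def D_def[symmetric]
    using sum_fibres_norm_sq[OF fin(3,4) sub, of u] by simp
  \<comment> \<open>Exchanging the first components of the two pairs turns equal differences into
    equal sums; the conjugate on \<psi> in \<open>s\<close> makes the summands agree.\<close>
  have I_swap: "I' (s n m) (s n' m') = I (t n' m) (t n m')" for n m n' m'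
  proof -
    let ?f = "\<lambda>B C B' C'. if B' + C = B + C' then cnj (\<psi> n B) * h m C * \<psi> n' B' * cnj (h m' C') else 0"
    have "I' (s n m) (s n' m') = (\<Sum>B\<in>X. \<Sum>C\<in>Y. \<Sum>B'\<in>X. \<Sum>C'\<in>Y. ?f B C B' C')"
      unfolding I'_def P_def sum.cartesian_product' s_def
      by (intro sum.cong refl) (auto simp: add.commute)
    also have "\<dots> = (\<Sum>B\<in>X. \<Sum>B'\<in>X. \<Sum>C\<in>Y. \<Sum>C'\<in>Y. ?f B C B' C')"
      by (rule sum.cong[OF refl sum.swap])
    also have "\<dots> = (\<Sum>B'\<in>X. \<Sum>B\<in>X. \<Sum>C\<in>Y. \<Sum>C'\<in>Y. ?f B C B' C')"
      by (rule sum.swap)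
    also have "\<dots> = (\<Sum>B'\<in>X. \<Sum>C\<in>Y. \<Sum>B\<in>X. \<Sum>C'\<in>Y. ?f B C B' C')"
      by (rule sum.cong[OF refl sum.swap])
    also have "\<dots> = I (t n' m) (t n m')"
      unfolding I_def P_def sum.cartesian_product' t_def
      by (intro sum.cong refl) auto
    finally show ?thesis .
  qed
  have I'_pos: "0 \<le> Re (I' u u)" for u
  proof -
    \<comment> \<open>The class of a pair under equality of differences; cancellation makes this an
      equivalence relation.\<close>
    define key where "key = (\<lambda>p. {q\<in>P. snd p + fst q = snd q + fst p})"
    have key_iff: "key p = key q \<longleftrightarrow> snd p + fst q = snd q + fst p" if pq: "p \<in> P" "q \<in> P" for p q
    proof
      assume "key p = key q"
      then have "q \<in> key p" using pq by (auto simp: key_def)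
      then show "snd p + fst q = snd q + fst p" by (simp add: key_def)
    next
      assume e: "snd p + fst q = snd q + fst p"
      have "snd p + fst r = snd r + fst p \<longleftrightarrow> snd q + fst r = snd r + fst q" for r
      proof -
        have "snd p + fst r = snd r + fst p \<longleftrightarrow> snd p + fst r + fst q = snd r + fst p + fst q" by simp
        also have "snd p + fst r + fst q = snd q + fst r + fst p" using e by (metis add.assoc add.commute)
        also have "snd r + fst p + fst q = snd r + fst q + fst p" by (metis add.assoc add.commute)
        finally show ?thesis by simp
      qed
      then show "key p = key q" by (auto simp: key_def)
    qed
    have "I' u u = (\<Sum>p\<in>P. \<Sum>q\<in>P. if key p = key q then u p * cnj (u q) else 0)"
      unfolding I'_def by (intro sum.cong refl) (use key_iff in auto)
    also have "\<dots> = of_real (\<Sum>y\<in>key ` P. (cmod (\<Sum>p\<in>P. if key p = y then u p else 0))\<^sup>2)"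
      using sum_fibres_norm_sq[OF fin(3) finite_imageI[OF fin(3)] order_refl, of key u] by simp
    finally show ?thesis by (simp add: sum_nonneg)
  qed
  have I'_diff: "I' (\<lambda>p. u p - v p) (\<lambda>p. u p - v p) = I' u u - I' u v - I' v u + I' v v" for u v
    unfolding I'_def sum_subtractf[symmetric] sum.distrib[symmetric]
    by (intro sum.cong refl) (simp add: algebra_simps)
  \<comment> \<open>Lagrange's identity: the squared norms of the parts antisymmetric in n and m add
    up to twice the difference of the two sides.\<close>
  have "0 \<le> (\<Sum>n<n0. \<Sum>m<n0. Re (I' (\<lambda>p. s n m p - s m n p) (\<lambda>p. s n m p - s m n p)))"
    by (intro sum_nonneg I'_pos)
  also have "\<dots> = (\<Sum>n<n0. \<Sum>m<n0. Re (I (t n m) (t n m))) - (\<Sum>n<n0. \<Sum>m<n0. Re (I (t m m) (t n n)))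
      - (\<Sum>n<n0. \<Sum>m<n0. Re (I (t n n) (t m m))) + (\<Sum>n<n0. \<Sum>m<n0. Re (I (t m n) (t m n)))"
    unfolding I'_diff I_swap by (simp add: sum.distrib sum_subtractf)
  also have "(\<Sum>n<n0. \<Sum>m<n0. Re (I (t m n) (t m n))) = (\<Sum>n<n0. \<Sum>m<n0. Re (I (t n m) (t n m)))"
    by (rule sum.swap)
  also have "(\<Sum>n<n0. \<Sum>m<n0. Re (I (t m m) (t n n))) = (\<Sum>n<n0. \<Sum>m<n0. Re (I (t n n) (t m m)))"
    by (rule sum.swap)
  finally have main: "(\<Sum>n<n0. \<Sum>m<n0. Re (I (t n n) (t m m))) \<le> (\<Sum>n<n0. \<Sum>m<n0. Re (I (t n m) (t n m)))"
    by simp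
  have "(\<Sum>n<n0. \<Sum>m<n0. I (t n n) (t m m)) = I (\<lambda>p. \<Sum>n<n0. t n n p) (\<lambda>p. \<Sum>n<n0. t n n p)"
  proof -
    let ?f = "\<lambda>p q n m. if fst p + snd p = fst q + snd q then t n n p * cnj (t m m q) else 0"
    have "I (\<lambda>p. \<Sum>n<n0. t n n p) (\<lambda>p. \<Sum>n<n0. t n n p) = (\<Sum>p\<in>P. \<Sum>q\<in>P. \<Sum>n<n0. \<Sum>m<n0. ?f p q n m)"
      unfolding I_def by (intro sum.cong refl) (simp add: cnj_sum sum_product)
    also have "\<dots> = (\<Sum>p\<in>P. \<Sum>n<n0. \<Sum>q\<in>P. \<Sum>m<n0. ?f p q n m)"
      by (rule sum.cong[OF refl sum.swap])
    also have "\<dots> = (\<Sum>n<n0. \<Sum>p\<in>P. \<Sum>q\<in>P. \<Sum>m<n0. ?f p q n m)"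
      by (rule sum.swap)
    also have "\<dots> = (\<Sum>n<n0. \<Sum>p\<in>P. \<Sum>m<n0. \<Sum>q\<in>P. ?f p q n m)"
      by (rule sum.cong[OF refl sum.cong[OF refl sum.swap]])
    also have "\<dots> = (\<Sum>n<n0. \<Sum>m<n0. \<Sum>p\<in>P. \<Sum>q\<in>P. ?f p q n m)"
      by (rule sum.cong[OF refl sum.swap])
    also have "\<dots> = (\<Sum>n<n0. \<Sum>m<n0. I (t n n) (t m m))"
      unfolding I_def ..
    finally show ?thesis by simp
  qed
  moreover have "(\<Sum>n<n0. conv (\<psi> n) (h n) A) = (\<Sum>p\<in>P. if fst p + snd p = A then \<Sum>n<n0. t n n p else 0)" for A
    unfolding conv_t by (subst sum.swap) (auto intro!: sum.cong)
  ultimately have "of_real (nrm (\<lambda>A. 1) (M + N) (\<lambda>A. \<Sum>n<n0. conv (\<psi> n) (h n) A)) =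
      (\<Sum>n<n0. \<Sum>m<n0. I (t n n) (t m m))"
    using nrm_t[of "\<lambda>p. \<Sum>n<n0. t n n p"] by simp
  then have "nrm (\<lambda>A. 1) (M + N) (\<lambda>A. \<Sum>n<n0. conv (\<psi> n) (h n) A) = (\<Sum>n<n0. \<Sum>m<n0. Re (I (t n n) (t m m)))"
    by (drule_tac arg_cong[of _ _ Re]) simp
  moreover have "nrm (\<lambda>A. 1) (M + N) (conv (\<psi> n) (h m)) = Re (I (t n m) (t n m))" for n m
    using arg_cong[OF nrm_t[of "t n m"], of Re] unfolding conv_t[symmetric] by simp
  ultimately show "nrm (\<lambda>A. 1) (M + N) (\<lambda>A. \<Sum>n<n0. conv (\<psi> n) (h n) A) \<le>
       (\<Sum>n<n0. \<Sum>m<n0. nrm (\<lambda>A. 1) (M + N) (conv (\<psi> n) (h m)))"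
    using main by simp
qed

subsection \<open>Rows of power series\<close>

text \<open>\<open>K\<close> plays the role of a squared column norm. Both sides may be truncated at
  the same \<open>J\<close>, since coefficients of degree at most \<open>J\<close> depend only on
  inputs of degree at most \<open>J\<close>.\<close>

definition col_bound :: "('i \<Rightarrow> real) \<Rightarrow> ('i \<Rightarrow> real) \<Rightarrow> nat \<Rightarrow> (nat \<Rightarrow> 'i \<Rightarrow> complex) \<Rightarrow> real \<Rightarrow> bool" where
  "col_bound w w' n0 p K \<longleftrightarrow> (\<forall>J a. (\<Sum>n<n0. nrm w' J (conv (p n) a)) \<le> K * nrm w J a)"

lemma col_boundD: "col_bound w w' n0 p K \<Longrightarrow> (\<Sum>n<n0. nrm w' J (conv (p n) a)) \<le> K * nrm w J a"
  unfolding col_bound_def by blast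

lemma nrm_cmult_weight: "nrm (\<lambda>A. c * w A) J a = c * nrm w J a"
  unfolding nrm_def sum_distrib_left by (simp add: mult.assoc)

lemma nrm_Suc: "nrm w (Suc J) a = nrm w J a + (\<Sum>A\<in>{A. deg A = Suc J}. w A * (cmod (a A))\<^sup>2)"
proof -
  have "{A. deg A \<le> Suc J} = {A. deg A \<le> J} \<union> {A. deg A = Suc J}" by auto
  moreover have "finite {A. deg A = Suc J}" by (rule finite_subset[OF _ finite_deg_le[of "Suc J"]]) auto
  ultimately show ?thesis unfolding nrm_def by (subst sum.union_disjoint[symmetric]) (auto simp: finite_deg_le)
qed

text \<open>Truncations \<open>{deg \<le> J}\<close> see only the truncated input, and a decreasing weight is a positive
  combination of truncations.\<close>

lemma nrm_decreasing_weight: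
  "nrm (\<lambda>A. w A * \<tau> (deg A)) J a =
    \<tau> J * nrm w J a + (\<Sum>i<J. (\<tau> i - \<tau> (Suc i)) * nrm w i a)"
proof (induction J)
  case 0
  show ?case unfolding nrm_def sum_distrib_left by (auto intro!: sum.cong)
next
  case (Suc J)
  have "(\<Sum>A\<in>{A. deg A = Suc J}. w A * \<tau> (deg A) * (cmod (a A))\<^sup>2) =
      \<tau> (Suc J) * (\<Sum>A\<in>{A. deg A = Suc J}. w A * (cmod (a A))\<^sup>2)"
    unfolding sum_distrib_left by (intro sum.cong) auto
  then show ?case unfolding nrm_Suc Suc.IH by (simp add: algebra_simps)
qed

text \<open>The bound holds at every truncation with the same \<open>K\<close>, hence for every
  positive combination of truncations.\<close>

lemma col_bound_decreasing:
  assumes c: "col_bound w w n0 p K" and tau: "\<And>i. \<tau> (Suc i) \<le> \<tau> i" "\<And>i. \<tau> i \<ge> 0"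
  shows "col_bound (\<lambda>A. w A * \<tau> (deg A)) (\<lambda>A. w A * \<tau> (deg A)) n0 p K"
  unfolding col_bound_def
proof (intro allI)
  fix J and a :: "'i \<Rightarrow> complex"
  have "(\<Sum>n<n0. nrm (\<lambda>A. w A * \<tau> (deg A)) J (conv (p n) a)) =
      \<tau> J * (\<Sum>n<n0. nrm w J (conv (p n) a)) +
      (\<Sum>i<J. (\<tau> i - \<tau> (Suc i)) * (\<Sum>n<n0. nrm w i (conv (p n) a)))"
    unfolding nrm_decreasing_weight sum.distrib sum_distrib_left by (subst (2) sum.swap) simp
  also have "\<dots> \<le> \<tau> J * (K * nrm w J a) + (\<Sum>i<J. (\<tau> i - \<tau> (Suc i)) * (K * nrm w i a))"
    by (intro add_mono sum_mono mult_left_mono col_boundD[OF c]) (use tau in auto)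
  also have "\<dots> = K * nrm (\<lambda>A. w A * \<tau> (deg A)) J a"
    unfolding nrm_decreasing_weight sum_distrib_left distrib_left by (simp add: mult.left_commute)
  finally show "(\<Sum>n<n0. nrm (\<lambda>A. w A * \<tau> (deg A)) J (conv (p n) a)) \<le>
      K * nrm (\<lambda>A. w A * \<tau> (deg A)) J a" .
qed

section \<open>Euler operators and divided weights\<close>

definition drv :: "nat \<Rightarrow> ('i \<Rightarrow> complex) \<Rightarrow> 'i \<Rightarrow> complex" where
  "drv i p A = of_nat (deg A) ^ i * p A"

text \<open>The shift by 1 makes the Euler operator invertible on constants too. In a product only
  one factor receives the shift; the other carries \<open>drv\<close>.\<close>

definition drv1 :: "nat \<Rightarrow> ('i \<Rightarrow> complex) \<Rightarrow> 'i \<Rightarrow> complex" where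
  "drv1 i a A = of_nat (deg A + 1) ^ i * a A"

text \<open>The binomial theorem for deg A + 1 = deg B + (deg C + 1).\<close>

lemma leibniz:
  "drv1 N (conv p a) A = (\<Sum>i\<le>N. of_nat (N choose i) * conv (drv i p) (drv1 (N - i) a) A)"
proof -
  have "of_nat (deg A + 1) ^ N * (p B * a C) =
      (\<Sum>i\<le>N. of_nat (N choose i) * (drv i p B * drv1 (N - i) a C))" if "B + C = A" for B C
  proof -
    have "of_nat (deg A + 1) = (of_nat (deg B) + of_nat (deg C + 1) :: complex)"
      using that deg_add by auto
    then have "(of_nat (deg A + 1) :: complex) ^ N =
        (\<Sum>i\<le>N. of_nat (N choose i) * of_nat (deg B) ^ i * of_nat (deg C + 1) ^ (N - i))"
      by (simp only: binomial_ring)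
    then show ?thesis unfolding drv_def drv1_def
      by (simp only: sum_distrib_right) (intro sum.cong refl, simp only: mult_ac)
  qed
  then have "drv1 N (conv p a) A =
      (\<Sum>(B, C)\<in>{(B, C). B + C = A}. \<Sum>i\<le>N. of_nat (N choose i) * (drv i p B * drv1 (N - i) a C))"
    unfolding drv1_def conv_def sum_distrib_left by (intro sum.cong refl) auto
  also have "\<dots> = (\<Sum>i\<le>N. of_nat (N choose i) * conv (drv i p) (drv1 (N - i) a) A)"
    unfolding conv_def case_prod_beta sum_distrib_left by (rule sum.swap)
  finally show ?thesis .
qed

text \<open>The weight that turns \<open>drv1 j\<close> into an isometry; the exponent is doubled
  because weights multiply squared moduli.\<close>

definition wt :: "('i \<Rightarrow> real) \<Rightarrow> nat \<Rightarrow> 'i \<Rightarrow> real" where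
  "wt w j A = w A * (1 / real (deg A + 1) ^ (2 * j))"

lemma nrm_drv1: "nrm (wt w (i + j)) J (drv1 i a) = nrm (wt w j) J a"
proof (rule nrm_cong)
  fix A
  have "real (deg A + 1) ^ (2 * (i + j)) = (real (deg A + 1) ^ i)\<^sup>2 * real (deg A + 1) ^ (2 * j)"
    by (simp add: distrib_left power_add mult.commute flip: power_mult)
  then show "wt w (i + j) A * (cmod (drv1 i a A))\<^sup>2 = wt w j A * (cmod (a A))\<^sup>2"
    unfolding wt_def drv1_def norm_mult norm_power norm_of_nat power_mult_distrib
    by (simp add: field_simps)
qed

text \<open>Induction through (D p) a = (D + 1)(p a) - p ((D + 1) a), where D multiplies by the
  degree. Each step costs a factor 4: 2 from squaring a difference, and 2 because both terms obey
  the same bound.\<close>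

lemma col_bound_drv:
  assumes c: "col_bound w w n0 p K" and w: "\<And>A. w A \<ge> 0"
  shows "col_bound (wt w j) (wt w (i + j)) n0 (\<lambda>n. drv i (p n)) (4 ^ i * K)"
proof (induction i arbitrary: j)
  case 0
  have "col_bound (\<lambda>A. w A * (1 / real (deg A + 1) ^ (2 * j))) (\<lambda>A. w A * (1 / real (deg A + 1) ^ (2 * j))) n0 p K"
    by (rule col_bound_decreasing[OF c, of "\<lambda>i. 1 / real (i + 1) ^ (2 * j)"])
      (auto intro!: divide_left_mono power_mono)
  then show ?case unfolding wt_def[abs_def] drv_def by simp
next
  case (Suc i)
  have wt_nonneg: "wt w j A \<ge> 0" for j A unfolding wt_def using w by simp
  show ?case unfolding col_bound_def
  proof (intro allI)
    fix J a
    let ?u = "\<lambda>n. drv1 1 (conv (drv i (p n)) a)" and ?v = "\<lambda>n. conv (drv i (p n)) (drv1 1 a)"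
    have eq: "conv (drv (Suc i) (p n)) a A = ?u n A - ?v n A" for n A
    proof -
      have "conv (drv (Suc i) (p n)) a A =
          (\<Sum>(B, C)\<in>{(B, C). B + C = A}. of_nat (deg A + 1) * (drv i (p n) B * a C) - drv i (p n) B * drv1 1 a C)"
        unfolding conv_def by (intro sum.cong refl) (auto simp: drv_def drv1_def deg_add algebra_simps)
      then show ?thesis
        unfolding conv_def drv1_def case_prod_beta sum_subtractf by (simp add: sum_distrib_left)
    qed
    have "nrm (wt w (Suc i + j)) J (conv (drv (Suc i) (p n)) a) \<le>
        2 * nrm (wt w (i + j)) J (conv (drv i (p n)) a) + 2 * nrm (wt w (i + Suc j)) J (?v n)" for n
    proof -
      have "nrm (wt w (Suc i + j)) J (conv (drv (Suc i) (p n)) a) \<le>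
          2 * nrm (wt w (1 + (i + j))) J (?u n) + 2 * nrm (wt w (1 + (i + j))) J (?v n)"
        unfolding nrm_def sum_distrib_left sum.distrib[symmetric]
      proof (intro sum_mono)
        fix A
        have "(cmod (?u n A - ?v n A))\<^sup>2 \<le> (cmod (?u n A) + cmod (?v n A))\<^sup>2"
          by (intro power_mono norm_triangle_ineq4) auto
        also have "\<dots> \<le> 2 * (cmod (?u n A))\<^sup>2 + 2 * (cmod (?v n A))\<^sup>2"
          using sum_squares_bound[of "cmod (?u n A)" "cmod (?v n A)"] by (simp add: power2_sum)
        finally have "wt w (1 + (i + j)) A * (cmod (?u n A - ?v n A))\<^sup>2 \<le>
            wt w (1 + (i + j)) A * (2 * (cmod (?u n A))\<^sup>2 + 2 * (cmod (?v n A))\<^sup>2)"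
          by (intro mult_left_mono wt_nonneg)
        then show "wt w (Suc i + j) A * (cmod (conv (drv (Suc i) (p n)) a A))\<^sup>2 \<le>
            2 * (wt w (1 + (i + j)) A * (cmod (?u n A))\<^sup>2) + 2 * (wt w (1 + (i + j)) A * (cmod (?v n A))\<^sup>2)"
          unfolding eq by (simp add: algebra_simps)
      qed
      then show ?thesis unfolding nrm_drv1 by simp
    qed
    then have "(\<Sum>n<n0. nrm (wt w (Suc i + j)) J (conv (drv (Suc i) (p n)) a)) \<le>
        2 * (\<Sum>n<n0. nrm (wt w (i + j)) J (conv (drv i (p n)) a)) + 2 * (\<Sum>n<n0. nrm (wt w (i + Suc j)) J (?v n))"
      unfolding sum_distrib_left sum.distrib[symmetric] by (intro sum_mono)
    also have "\<dots> \<le> 2 * (4 ^ i * K * nrm (wt w j) J a) + 2 * (4 ^ i * K * nrm (wt w (Suc j)) J (drv1 1 a))"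
      using col_boundD[OF Suc.IH[of j], of J a] col_boundD[OF Suc.IH[of "Suc j"], of J "drv1 1 a"] by linarith
    also have "nrm (wt w (Suc j)) J (drv1 1 a) = nrm (wt w j) J a"
      using nrm_drv1[of w 1 j] by simp
    finally show "(\<Sum>n<n0. nrm (wt w (Suc i + j)) J (conv (drv (Suc i) (p n)) a)) \<le> 4 ^ Suc i * K * nrm (wt w j) J a"
      by (simp add: mult_ac)
  qed
qed

text \<open>N + 1 comes from Cauchy-Schwarz over the Leibniz terms, the squared binomials are their
  coefficients, \<rho> compares \<gamma> with the divided weight, and 4^i is the cost in
  \<open>col_bound_drv\<close>.\<close>

definition row_const :: "nat \<Rightarrow> real \<Rightarrow> real" where
  "row_const N \<rho> = real (N + 1) * (\<Sum>i\<le>N. (real (N choose i))\<^sup>2 * (\<rho> * 4 ^ i))"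

text \<open>After the isometry \<open>drv1 N\<close> each Leibniz term can be measured by \<gamma>.
  For fixed m, the sum over all pairs given by \<open>row_weight\<close> is a differentiated column
  applied to a single function.\<close>

lemma row_bound_polynomial:
  assumes c: "col_bound w w n0 p K" and w: "\<And>A. w A \<ge> 0"
    and g: "row_weight \<gamma>" "\<And>A. wt w N A \<le> \<gamma> A" "\<And>A. \<gamma> A \<le> \<rho> * wt w N A"
    and p: "\<And>n A. deg A > M \<Longrightarrow> p n A = 0" and a: "\<And>n A. deg A > L \<Longrightarrow> a n A = 0"
  shows "nrm w (M + L) (\<lambda>A. \<Sum>n<n0. conv (p n) (a n) A) \<le>
    row_const N \<rho> * K * (\<Sum>n<n0. nrm w (M + L) (a n))"
proof -
  let ?J = "M + L"
  let ?F = "\<lambda>i A. \<Sum>n<n0. conv (drv i (p n)) (drv1 (N - i) (a n)) A"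
  have wt_nonneg: "wt w j A \<ge> 0" for j A unfolding wt_def using w by simp
  have wt0: "wt w 0 = w" by (simp add: wt_def fun_eq_iff)
  have g0: "\<gamma> A \<ge> 0" for A using g(2)[of A] wt_nonneg order_trans by blast
  have part: "nrm (wt w N) ?J (?F i) \<le> \<rho> * 4 ^ i * K * (\<Sum>n<n0. nrm w ?J (a n))" if i: "i \<le> N" for i
  proof -
    have "nrm (wt w N) ?J (?F i) \<le> nrm \<gamma> ?J (?F i)"
      by (intro nrm_mono mult_right_mono g) auto
    also have "\<dots> \<le> (\<Sum>n<n0. \<Sum>m<n0. nrm \<gamma> ?J (conv (drv i (p n)) (drv1 (N - i) (a m))))"
      using g(1) p a unfolding row_weight_def drv_def drv1_def by simp
    also have "\<dots> \<le> (\<Sum>n<n0. \<Sum>m<n0. nrm (\<lambda>A. \<rho> * wt w N A) ?J (conv (drv i (p n)) (drv1 (N - i) (a m))))"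
      by (intro sum_mono nrm_mono mult_right_mono g) auto
    also have "\<dots> = \<rho> * (\<Sum>m<n0. \<Sum>n<n0. nrm (wt w N) ?J (conv (drv i (p n)) (drv1 (N - i) (a m))))"
      unfolding nrm_cmult_weight sum_distrib_left by (rule sum.swap)
    also have "\<dots> \<le> \<rho> * (\<Sum>m<n0. 4 ^ i * K * nrm w ?J (a m))"
    \<comment> \<open>A positive value of \<gamma> forces \<rho> >= 0; without one, the weight
      \<open>w\<close> vanishes and so do both sides.\<close>
    proof (cases "\<exists>A. \<gamma> A > 0")
      case True
      then obtain A where "\<gamma> A > 0" ..
      then have "\<rho> \<ge> 0" using g(3)[of A] wt_nonneg[of N A] by (metis linorder_not_le mult_nonpos_nonneg order.strict_trans2 less_imp_le)
      moreover have "(\<Sum>n<n0. nrm (wt w N) ?J (conv (drv i (p n)) (drv1 (N - i) (a m)))) \<le> 4 ^ i * K * nrm w ?J (a m)" for m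
      proof -
        have "(\<Sum>n<n0. nrm (wt w (i + (N - i))) ?J (conv (drv i (p n)) (drv1 (N - i) (a m)))) \<le>
            4 ^ i * K * nrm (wt w (N - i)) ?J (drv1 (N - i) (a m))"
          by (rule col_boundD[OF col_bound_drv[OF c w]])
        then show ?thesis using nrm_drv1[of w "N - i" 0] i by (simp add: wt0)
      qed
      ultimately show ?thesis by (intro mult_left_mono sum_mono)
    next
      case False
      then have "wt w N A = 0" for A using g(2)[of A] wt_nonneg[of N A] by (metis linorder_not_le order_antisym order_trans)
      then have "w A = 0" for A by (simp add: wt_def)
      then show ?thesis by (simp add: nrm_def wt_def)
    qed
    finally show ?thesis by (simp add: sum_distrib_left mult.assoc)
  qed
  have "nrm w ?J (\<lambda>A. \<Sum>n<n0. conv (p n) (a n) A) = nrm (wt w N) ?J (drv1 N (\<lambda>A. \<Sum>n<n0. conv (p n) (a n) A))"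
    using nrm_drv1[of w N 0] by (simp add: wt0)
  also have "\<dots> = nrm (wt w N) ?J (\<lambda>A. \<Sum>i\<le>N. of_nat (N choose i) * ?F i A)"
  proof (rule nrm_cong)
    fix A
    have "drv1 N (\<lambda>A. \<Sum>n<n0. conv (p n) (a n) A) A = (\<Sum>n<n0. drv1 N (conv (p n) (a n)) A)"
      by (simp add: drv1_def sum_distrib_left)
    also have "\<dots> = (\<Sum>i\<le>N. of_nat (N choose i) * ?F i A)"
      unfolding leibniz sum_distrib_left by (rule sum.swap)
    finally show "wt w N A * (cmod (drv1 N (\<lambda>A. \<Sum>n<n0. conv (p n) (a n) A) A))\<^sup>2 =
        wt w N A * (cmod (\<Sum>i\<le>N. of_nat (N choose i) * ?F i A))\<^sup>2" by simp
  qed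
  also have "\<dots> \<le> real (N + 1) * (\<Sum>i\<le>N. nrm (wt w N) ?J (\<lambda>A. of_nat (N choose i) * ?F i A))"
    using nrm_sum_le[of "{..N}" "wt w N" ?J "\<lambda>i A. of_nat (N choose i) * ?F i A"] wt_nonneg by simp
  also have "\<dots> = real (N + 1) * (\<Sum>i\<le>N. (real (N choose i))\<^sup>2 * nrm (wt w N) ?J (?F i))"
    unfolding nrm_scale by simp
  also have "\<dots> \<le> real (N + 1) * (\<Sum>i\<le>N. (real (N choose i))\<^sup>2 * (\<rho> * 4 ^ i * K * (\<Sum>n<n0. nrm w ?J (a n))))"
    by (intro mult_left_mono sum_mono part) auto
  also have "\<dots> = row_const N \<rho> * K * (\<Sum>n<n0. nrm w ?J (a n))"
    unfolding row_const_def by (simp add: sum_distrib_right mult.assoc)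
  finally show ?thesis .
qed

text \<open>Fejer means: \<open>(M - \<bar>r - s\<bar>)\<^sup>+\<close> counts the windows of length \<open>M\<close> containing both \<open>r\<close> and \<open>s\<close>.\<close>

definition fejer :: "nat \<Rightarrow> ('i \<Rightarrow> complex) \<Rightarrow> 'i \<Rightarrow> complex" where
  "fejer M p A = of_nat (M - deg A) / of_nat M * p A"

text \<open>The coefficient at A is an average, over levels j in the window of deg A, of products
  with the input cut to degrees whose window contains j. Every degree lies in M windows, which
  cancels the remaining 1/M and keeps \<open>K\<close>; a sharp truncation of the multipliers need
  not keep it.\<close>

lemma col_bound_fejer:
  assumes c: "col_bound w w n0 p K" and w: "\<And>A. w A \<ge> 0" and M: "M > 0"
  shows "col_bound w w n0 (\<lambda>n. fejer M (p n)) K"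
  unfolding col_bound_def
proof (intro allI)
  fix J and a :: "'i \<Rightarrow> complex"
  define win where "win = (\<lambda>r. {r<..r + M})"
  define cut where "cut = (\<lambda>j A. if j \<in> win (deg A) then a A else 0)"
  \<comment> \<open>Contains the window of every degree up to \<open>J\<close>.\<close>
  define E where "E = {..J + M}"
  have card_win: "card (win r) = M" for r by (simp add: win_def)
  have conv: "conv (fejer M (p n)) a A = (1 / of_nat M) * (\<Sum>j\<in>win (deg A). conv (p n) (cut j) A)" for n A
  proof -
    have "(\<Sum>j\<in>win (deg A). p n B * cut j C) = of_nat (M - deg B) * (p n B * a C)" if "B + C = A" for B C
    proof -
      have "win (deg A) \<inter> win (deg C) = {deg A<..deg C + M}"
        using that by (auto simp: win_def deg_add)
      moreover have "card {deg A<..deg C + M} = M - deg B" using that by (auto simp: deg_add)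
      ultimately have "card (win (deg A) \<inter> win (deg C)) = M - deg B" by simp
      moreover have "(\<Sum>j\<in>win (deg A). p n B * cut j C) = (\<Sum>j\<in>win (deg A) \<inter> win (deg C). p n B * a C)"
        by (rule sum.mono_neutral_cong_right) (auto simp: cut_def win_def)
      ultimately show ?thesis by simp
    qed
    then have "(\<Sum>(B, C)\<in>{(B, C). B + C = A}. \<Sum>j\<in>win (deg A). p n B * cut j C) =
        (\<Sum>(B, C)\<in>{(B, C). B + C = A}. of_nat M * (fejer M (p n) B * a C))"
      using M by (intro sum.cong refl) (auto simp: fejer_def)
    moreover have "(\<Sum>(B, C)\<in>{(B, C). B + C = A}. \<Sum>j\<in>win (deg A). p n B * cut j C) =
        (\<Sum>j\<in>win (deg A). conv (p n) (cut j) A)"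
      unfolding conv_def case_prod_beta by (rule sum.swap)
    moreover have "(\<Sum>(B, C)\<in>{(B, C). B + C = A}. of_nat M * (fejer M (p n) B * a C)) =
        of_nat M * conv (fejer M (p n)) a A"
      unfolding conv_def case_prod_beta by (simp add: sum_distrib_left)
    ultimately show ?thesis using M by (simp add: field_simps)
  qed
  have "nrm w J (conv (fejer M (p n)) a) \<le> (1 / real M) * (\<Sum>j\<in>E. nrm w J (conv (p n) (cut j)))" for n
  proof -
    have "w A * (cmod (conv (fejer M (p n)) a A))\<^sup>2 \<le>
        (1 / real M) * (\<Sum>j\<in>E. w A * (cmod (conv (p n) (cut j) A))\<^sup>2)" if "deg A \<le> J" for A
    proof -
      have "(cmod (conv (fejer M (p n)) a A))\<^sup>2 =
          (1 / real M)\<^sup>2 * (cmod (\<Sum>j\<in>win (deg A). conv (p n) (cut j) A))\<^sup>2"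
        unfolding conv by (simp add: norm_mult norm_divide power_mult_distrib power_divide)
      also have "\<dots> \<le> (1 / real M)\<^sup>2 * (real M * (\<Sum>j\<in>win (deg A). (cmod (conv (p n) (cut j) A))\<^sup>2))"
        using cmod_sum_sq_le[of "win (deg A)" "\<lambda>j. conv (p n) (cut j) A"] card_win[of "deg A"]
        by (intro mult_left_mono) (auto simp: win_def)
      also have "\<dots> = (1 / real M) * (\<Sum>j\<in>win (deg A). (cmod (conv (p n) (cut j) A))\<^sup>2)"
        using M by (simp add: power2_eq_square)
      also have "\<dots> \<le> (1 / real M) * (\<Sum>j\<in>E. (cmod (conv (p n) (cut j) A))\<^sup>2)"
        using that by (intro mult_left_mono sum_mono2) (auto simp: E_def win_def)
      finally have "w A * (cmod (conv (fejer M (p n)) a A))\<^sup>2 \<le>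
          w A * ((1 / real M) * (\<Sum>j\<in>E. (cmod (conv (p n) (cut j) A))\<^sup>2))"
        by (intro mult_left_mono w)
      then show ?thesis by (simp add: sum_distrib_left)
    qed
    then have "nrm w J (conv (fejer M (p n)) a) \<le>
        (\<Sum>A\<in>{A. deg A \<le> J}. (1 / real M) * (\<Sum>j\<in>E. w A * (cmod (conv (p n) (cut j) A))\<^sup>2))"
      unfolding nrm_def by (intro sum_mono) auto
    also have "\<dots> = (1 / real M) * (\<Sum>j\<in>E. nrm w J (conv (p n) (cut j)))"
      unfolding nrm_def sum_distrib_left by (rule sum.swap)
    finally show ?thesis .
  qed
  then have "(\<Sum>n<n0. nrm w J (conv (fejer M (p n)) a)) \<le>
      (\<Sum>n<n0. (1 / real M) * (\<Sum>j\<in>E. nrm w J (conv (p n) (cut j))))"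
    by (intro sum_mono)
  also have "\<dots> = (1 / real M) * (\<Sum>j\<in>E. \<Sum>n<n0. nrm w J (conv (p n) (cut j)))"
    unfolding sum_distrib_left by (rule sum.swap)
  also have "\<dots> \<le> (1 / real M) * (\<Sum>j\<in>E. K * nrm w J (cut j))"
    by (intro mult_left_mono sum_mono col_boundD[OF c]) auto
  also have "(\<Sum>j\<in>E. K * nrm w J (cut j)) = K * (real M * nrm w J a)"
  proof -
    have "(\<Sum>j\<in>E. nrm w J (cut j)) = (\<Sum>A\<in>{A. deg A \<le> J}. \<Sum>j\<in>E. w A * (cmod (cut j A))\<^sup>2)"
      unfolding nrm_def by (rule sum.swap)
    also have "\<dots> = (\<Sum>A\<in>{A. deg A \<le> J}. real M * (w A * (cmod (a A))\<^sup>2))"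
    proof (intro sum.cong refl)
      fix A assume A: "A \<in> {A. deg A \<le> J}"
      have "(\<Sum>j\<in>E. w A * (cmod (cut j A))\<^sup>2) = (\<Sum>j\<in>win (deg A). w A * (cmod (a A))\<^sup>2)"
        using A by (intro sum.mono_neutral_cong_right) (auto simp: E_def win_def cut_def)
      then show "(\<Sum>j\<in>E. w A * (cmod (cut j A))\<^sup>2) = real M * (w A * (cmod (a A))\<^sup>2)"
        by (simp add: card_win)
    qed
    also have "\<dots> = real M * nrm w J a" unfolding nrm_def sum_distrib_left ..
    finally show ?thesis by (simp flip: sum_distrib_left)
  qed
  finally show "(\<Sum>n<n0. nrm w J (conv (fejer M (p n)) a)) \<le> K * nrm w J a"
    using M by simp
qed

text \<open>Only finitely many coefficients enter \<open>nrm w J\<close>, so Fejer means of growing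
  order converge there, with a constant independent of the order.\<close>

lemma row_bound:
  assumes c: "col_bound w w n0 p K" and w: "\<And>A. w A \<ge> 0"
    and g: "row_weight \<gamma>" "\<And>A. wt w N A \<le> \<gamma> A" "\<And>A. \<gamma> A \<le> \<rho> * wt w N A"
  shows "nrm w J (\<lambda>A. \<Sum>n<n0. conv (p n) (a n) A) \<le> row_const N \<rho> * K * (\<Sum>n<n0. nrm w J (a n))"
proof -
  define b where "b = (\<lambda>n A. if deg A \<le> J then a n A else 0)"
  have conv_b: "conv q (b n) A = conv q (a n) A" if "deg A \<le> J" for q n A
    by (rule conv_cong) (use that deg_add in \<open>auto simp: b_def\<close>)
  have bound: "nrm w J (\<lambda>A. \<Sum>n<n0. conv (fejer M (p n)) (a n) A) \<le>
      row_const N \<rho> * K * (\<Sum>n<n0. nrm w J (a n))" if M: "M > 0" for M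
  proof -
    have "nrm w J (\<lambda>A. \<Sum>n<n0. conv (fejer M (p n)) (a n) A) =
        nrm w J (\<lambda>A. \<Sum>n<n0. conv (fejer M (p n)) (b n) A)"
      by (rule nrm_cong) (simp add: conv_b)
    also have "\<dots> \<le> nrm w (M + J) (\<lambda>A. \<Sum>n<n0. conv (fejer M (p n)) (b n) A)"
      unfolding nrm_def by (rule sum_mono2[OF finite_deg_le]) (use w in auto)
    also have "\<dots> \<le> row_const N \<rho> * K * (\<Sum>n<n0. nrm w (M + J) (b n))"
      by (rule row_bound_polynomial[OF col_bound_fejer[OF c w M] w g]) (auto simp: fejer_def b_def)
    also have "(\<Sum>n<n0. nrm w (M + J) (b n)) = (\<Sum>n<n0. nrm w J (a n))"
      unfolding nrm_def
      by (intro sum.cong refl sum.mono_neutral_cong_right finite_deg_le) (auto simp: b_def)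
    finally show ?thesis .
  qed
  have fej: "(\<lambda>M. fejer (Suc M) q A) \<longlonglongrightarrow> q A" for q A
  proof -
    have "(\<lambda>M. 1 - complex_of_real (real (deg A)) * complex_of_real (inverse (real (Suc M)))) \<longlonglongrightarrow> 1 - complex_of_real (real (deg A)) * complex_of_real 0"
      by (intro tendsto_intros LIMSEQ_inverse_real_of_nat)
    then have "(\<lambda>M. (1 - complex_of_real (real (deg A)) * complex_of_real (inverse (real (Suc M)))) * q A) \<longlonglongrightarrow> 1 * q A"
      by (intro tendsto_mult tendsto_const) simp
    moreover have "\<forall>\<^sub>F M in sequentially. (1 - complex_of_real (real (deg A)) * complex_of_real (inverse (real (Suc M)))) * q A = fejer (Suc M) q A"
      using eventually_ge_at_top[of "deg A"]
    proof eventually_elim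
      case (elim M)
      then have "of_nat (Suc M - deg A) = (of_nat (Suc M) - of_nat (deg A) :: complex)"
        by (intro of_nat_diff) simp
      moreover have nz: "(of_nat (Suc M) :: complex) \<noteq> 0" by (simp del: of_nat_Suc)
      then have "1 - complex_of_real (real (deg A)) * complex_of_real (inverse (real (Suc M))) =
          (of_nat (Suc M) - of_nat (deg A)) / of_nat (Suc M)"
        by (simp add: field_simps del: of_nat_Suc)
      ultimately show ?case unfolding fejer_def by (simp only:)
    qed
    ultimately show ?thesis using Lim_transform_eventually by force
  qed
  have "(\<lambda>M. nrm w J (\<lambda>A. \<Sum>n<n0. conv (fejer (Suc M) (p n)) (a n) A)) \<longlonglongrightarrow>
      nrm w J (\<lambda>A. \<Sum>n<n0. conv (p n) (a n) A)"
    unfolding nrm_def conv_def case_prod_beta by (intro tendsto_intros fej)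
  then show ?thesis
    by (rule LIMSEQ_le_const2) (use bound in auto)
qed

end

section \<open>Function spaces with orthogonal monomials\<close>

locale power_series_space = graded_monoid deg + hilbert_function_space H k
  for deg :: "'i::cancel_comm_monoid_add \<Rightarrow> nat" and H :: "'a hfs" and k +
  fixes e :: "'i \<Rightarrow> 'a \<Rightarrow> complex" and w :: "'i \<Rightarrow> real"
  assumes w_nonneg: "w A \<ge> 0"
    and e_zero: "x \<in> points H \<Longrightarrow> e 0 x = 1"
    and e_add: "x \<in> points H \<Longrightarrow> e (A + B) x = e A x * e B x"
    and series: "f \<in> elems H \<Longrightarrow> \<exists>a. (\<forall>x\<in>points H. ((\<lambda>A. a A * e A x) has_sum f x) UNIV) \<and>
      ((\<lambda>A. w A * (cmod (a A))\<^sup>2) has_sum (hnorm H f)\<^sup>2) UNIV"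
    and sum_of_series: "(\<lambda>A. w A * (cmod (a A))\<^sup>2) summable_on UNIV \<Longrightarrow>
      \<exists>f\<in>elems H. \<forall>x\<in>points H. ((\<lambda>A. a A * e A x) has_sum f x) UNIV"
    and series_zero: "(\<And>x. x \<in> points H \<Longrightarrow> ((\<lambda>A. a A * e A x) has_sum 0) UNIV) \<Longrightarrow> a A = 0"
begin

definition ser :: "('a \<Rightarrow> complex) \<Rightarrow> ('i \<Rightarrow> complex) \<Rightarrow> bool" where
  "ser f a \<longleftrightarrow> (\<forall>x\<in>points H. ((\<lambda>A. a A * e A x) has_sum f x) UNIV)"

lemma ser_unique:
  assumes "ser f a" "ser f b"
  shows "a = b"
proof
  fix A
  have "((\<lambda>A. (a A - b A) * e A x) has_sum 0) UNIV" if "x \<in> points H" for x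
  proof -
    have "((\<lambda>A. a A * e A x + - (b A * e A x)) has_sum f x + - f x) UNIV"
      by (intro has_sum_add has_sum_uminusI) (use assms that in \<open>auto simp: ser_def\<close>)
    then show ?thesis by (simp add: left_diff_distrib)
  qed
  from series_zero[of "\<lambda>A. a A - b A" A, OF this] show "a A = b A" by simp
qed

lemma ser_conv:
  assumes f: "ser f a" and g: "ser g b"
  shows "ser (\<lambda>x. f x * g x) (conv a b)"
  unfolding ser_def
proof
  fix x assume x: "x \<in> points H"
  let ?f = "\<lambda>p. (a (fst p) * e (fst p) x) * (b (snd p) * e (snd p) x)"
  have "((\<lambda>(B, C). (a B * e B x) * (b C * e C x)) has_sum f x * g x) (UNIV \<times> UNIV)"
    by (rule has_sum_times) (use f g x in \<open>auto simp: ser_def\<close>)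
  then have s: "(?f has_sum f x * g x) UNIV" by (simp add: case_prod_unfold)
  let ?S = "Sigma UNIV (\<lambda>A::'i. {(B, C). B + C = A})"
  have bij: "bij_betw snd ?S UNIV"
    by (rule bij_betwI[where g = "\<lambda>p. (fst p + snd p, p)"]) auto
  have "((\<lambda>q. ?f (snd q)) has_sum f x * g x) ?S"
    using has_sum_reindex_bij_betw[OF bij, of ?f] s by simp
  then show "((\<lambda>A. conv a b A * e A x) has_sum f x * g x) UNIV"
  proof (rule has_sum_SigmaD)
    fix A :: 'i
    have "(\<Sum>p\<in>{(B, C). B + C = A}. ?f p) = conv a b A * e A x"
      unfolding conv_def sum_distrib_right by (rule sum.cong) (use e_add[OF x] in auto)
    then show "((\<lambda>p. ?f (snd (A, p))) has_sum conv a b A * e A x) {(B, C). B + C = A}"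
      using finite_pairs[of A] by (simp add: has_sum_finiteI)
  qed
qed

lemma ser_sum:
  assumes "finite S" "\<And>i. i \<in> S \<Longrightarrow> ser (f i) (a i)"
  shows "ser (\<lambda>x. \<Sum>i\<in>S. f i x) (\<lambda>A. \<Sum>i\<in>S. a i A)"
  unfolding ser_def
proof
  fix x assume x: "x \<in> points H"
  show "((\<lambda>A. (\<Sum>i\<in>S. a i A) * e A x) has_sum (\<Sum>i\<in>S. f i x)) UNIV"
    using assms
  proof (induction S rule: finite_induct)
    case (insert i S)
    have "((\<lambda>A. a i A * e A x) has_sum f i x) UNIV" using insert.prems x by (auto simp: ser_def)
    moreover have "((\<lambda>A. (\<Sum>i\<in>S. a i A) * e A x) has_sum (\<Sum>i\<in>S. f i x)) UNIV" using insert by auto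
    ultimately show ?case
      using insert.hyps has_sum_add by (fastforce simp: distrib_right)
  qed simp
qed

lemma ser_nrm_le:
  assumes f: "f \<in> elems H" and a: "ser f a"
  shows "nrm w J a \<le> (hnorm H f)\<^sup>2"
proof -
  obtain b where b: "ser f b" "((\<lambda>A. w A * (cmod (b A))\<^sup>2) has_sum (hnorm H f)\<^sup>2) UNIV"
    using series[OF f] by (auto simp: ser_def)
  have "a = b" using ser_unique a b(1) by blast
  then show ?thesis unfolding nrm_def
    using finite_sum_le_has_sum[OF b(2) finite_deg_le[of J]] w_nonneg by simp
qed

lemma ser_boundI:
  assumes f: "f \<in> elems H" and a: "ser f a" and B: "\<And>J. nrm w J a \<le> B"
  shows "(hnorm H f)\<^sup>2 \<le> B"
proof -
  obtain b where b: "ser f b" "((\<lambda>A. w A * (cmod (b A))\<^sup>2) has_sum (hnorm H f)\<^sup>2) UNIV"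
    using series[OF f] by (auto simp: ser_def)
  have ab: "a = b" using ser_unique a b(1) by blast
  show ?thesis
  proof (rule has_sum_le_finite_sums[OF b(2)])
    fix S :: "'i set" assume S: "finite S"
    define J where "J = Max (insert 0 (deg ` S))"
    have "deg A \<le> J" if "A \<in> S" for A unfolding J_def using S that by (intro Max_ge) auto
    then have "(\<Sum>A\<in>S. w A * (cmod (b A))\<^sup>2) \<le> nrm w J b"
      unfolding nrm_def by (intro sum_mono2 finite_deg_le) (auto simp: w_nonneg)
    then show "(\<Sum>A\<in>S. w A * (cmod (b A))\<^sup>2) \<le> B" using B[of J] ab by simp
  qed
qed

lemma polynomial_in:
  assumes a: "\<And>A. deg A > J \<Longrightarrow> a A = 0"
  shows "\<exists>f\<in>elems H. ser f a \<and> (hnorm H f)\<^sup>2 = nrm w J a"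
proof -
  have s: "((\<lambda>A. w A * (cmod (a A))\<^sup>2) has_sum nrm w J a) UNIV"
    unfolding nrm_def by (rule has_sum_finite_neutralI[OF finite_deg_le]) (auto intro!: a)
  then obtain f where f: "f \<in> elems H" "ser f a"
    using sum_of_series[OF has_sum_imp_summable[OF s]] by (auto simp: ser_def)
  obtain b where b: "ser f b" "((\<lambda>A. w A * (cmod (b A))\<^sup>2) has_sum (hnorm H f)\<^sup>2) UNIV"
    using series[OF f(1)] by (auto simp: ser_def)
  have "a = b" using ser_unique f(2) b(1) by blast
  then show ?thesis using f s b(2) has_sum_unique by blast
qed

text \<open>The constant function 1 belongs to the space, hence so does every multiplier.\<close>

lemma multiplier_series:
  assumes phi: "\<phi> \<in> multipliers H"
  shows "\<exists>p. ser \<phi> p"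
proof -
  obtain f where f: "f \<in> elems H" "ser f (\<lambda>A. of_bool (A = 0))"
    using polynomial_in[of "deg 0" "\<lambda>A. of_bool (A = 0)"] by fastforce
  have "f x = 1" if "x \<in> points H" for x
  proof -
    have "((\<lambda>A. of_bool (A = 0) * e A x) has_sum 1) UNIV"
      by (rule has_sum_finite_neutralI[of "{0}"]) (use e_zero[OF that] in auto)
    then show ?thesis using f(2) that has_sum_unique by (fastforce simp: ser_def)
  qed
  then have "(\<lambda>x. \<phi> x * f x) = \<phi>" using phi by (auto simp: multipliers_def fun_eq_iff)
  moreover have "(\<lambda>x. \<phi> x * f x) \<in> elems H" using phi f(1) by (auto simp: multipliers_def)
  ultimately have "\<phi> \<in> elems H" by simp
  then show ?thesis using series by (auto simp: ser_def)
qed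

text \<open>Transfers \<open>row_bound\<close> from coefficients to operators; the square root
  appears because coefficient estimates concern squared norms. Blocks of summands are estimated, not
  just initial segments, to see that the partial sums of the row are Cauchy in
  \<open>H\<close>.\<close>

lemma column_row_constant_power_series:
  assumes g: "row_weight \<gamma>" "\<And>A. wt w N A \<le> \<gamma> A" "\<And>A. \<gamma> A \<le> \<rho> * wt w N A" and rho: "\<rho> \<ge> 0"
  shows "column_row_constant H (sqrt (row_const N \<rho>))"
  unfolding column_row_constant_def
proof (intro allI impI)
  fix \<Phi> assume mult: "\<forall>n::nat. \<Phi> n \<in> multipliers H" and col: "column_bounded H \<Phi>"
  define B where "B = column_norm H \<Phi>"
  have b: "bounded_operator (elems H) (hnorm H) (tensor_l2 H) (tensor_l2_norm H) (column_op \<Phi>)"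
    using col by (simp add: column_bounded_def)
  have B0: "B \<ge> 0" unfolding B_def column_norm_def by (rule bounded_operator_norm(1)[OF b hnorm_nonneg])
  have mult_in: "(\<lambda>x. \<Phi> n x * f x) \<in> elems H" if "f \<in> elems H" for n f
    using mult that by (auto simp: multipliers_def)
  have column: "(\<Sum>n<n0. (hnorm H (\<lambda>x. \<Phi> n x * f x))\<^sup>2) \<le> B\<^sup>2 * (hnorm H f)\<^sup>2" if f: "f \<in> elems H" for f n0
  proof -
    have t: "column_op \<Phi> f \<in> tensor_l2 H" using b f by (simp add: bounded_operator_def)
    have "tensor_l2_norm H (column_op \<Phi> f) \<le> B * hnorm H f"
      unfolding B_def column_norm_def by (rule bounded_operator_norm(2)[OF b hnorm_nonneg f])
    then have "(tensor_l2_norm H (column_op \<Phi> f))\<^sup>2 \<le> (B * hnorm H f)\<^sup>2"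
      by (rule power_mono) (rule tensor_l2_norm_nonneg[OF t])
    moreover have s: "summable (\<lambda>n. (hnorm H (\<lambda>x. \<Phi> n x * f x))\<^sup>2)"
      using t by (simp add: tensor_l2_def column_op_def)
    moreover have "(tensor_l2_norm H (column_op \<Phi> f))\<^sup>2 = (\<Sum>n. (hnorm H (\<lambda>x. \<Phi> n x * f x))\<^sup>2)"
      unfolding tensor_l2_norm_def column_op_def using suminf_nonneg[OF s] by simp
    moreover have "(\<Sum>n<n0. (hnorm H (\<lambda>x. \<Phi> n x * f x))\<^sup>2) \<le> (\<Sum>n. (hnorm H (\<lambda>x. \<Phi> n x * f x))\<^sup>2)"
      by (rule sum_le_suminf[OF s]) auto
    ultimately show ?thesis by (simp add: power_mult_distrib)
  qed
  have "\<forall>n. \<exists>p. ser (\<Phi> n) p" using multiplier_series mult by blast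
  from choice[OF this] obtain p where p: "\<And>n. ser (\<Phi> n) (p n)" by blast
  \<comment> \<open>Truncating the input to a polynomial makes it an element of \<open>H\<close> and
    leaves the output up to degree \<open>J\<close> unchanged.\<close>
  have cb: "col_bound w w n0 p (B\<^sup>2)" for n0
    unfolding col_bound_def
  proof (intro allI)
    fix J and a :: "'i \<Rightarrow> complex"
    define a' where "a' = (\<lambda>A. if deg A \<le> J then a A else 0)"
    obtain f where f: "f \<in> elems H" "ser f a'" "(hnorm H f)\<^sup>2 = nrm w J a'"
      using polynomial_in[of J a'] by (auto simp: a'_def)
    have "nrm w J (conv (p n) a) = nrm w J (conv (p n) a')" for n
    proof (rule nrm_cong)
      fix A assume A: "deg A \<le> J"
      have "conv (p n) a A = conv (p n) a' A"
        by (rule conv_cong) (use A deg_add in \<open>auto simp: a'_def\<close>)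
      then show "w A * (cmod (conv (p n) a A))\<^sup>2 = w A * (cmod (conv (p n) a' A))\<^sup>2" by simp
    qed
    then have "(\<Sum>n<n0. nrm w J (conv (p n) a)) \<le> (\<Sum>n<n0. (hnorm H (\<lambda>x. \<Phi> n x * f x))\<^sup>2)"
      by (auto intro!: sum_mono ser_nrm_le mult_in f(1) ser_conv p f(2))
    also have "\<dots> \<le> B\<^sup>2 * nrm w J a'" using column[OF f(1), of n0] f(3) by simp
    also have "nrm w J a' = nrm w J a" by (rule nrm_cong) (simp add: a'_def)
    finally show "(\<Sum>n<n0. nrm w J (conv (p n) a)) \<le> B\<^sup>2 * nrm w J a" .
  qed
  define C where "C = row_const N \<rho>"
  have C0: "C \<ge> 0" unfolding C_def row_const_def using rho by (intro mult_nonneg_nonneg sum_nonneg) auto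
  have finite_row: "(hnorm H (\<lambda>x. \<Sum>n\<in>{m..<n0}. \<Phi> n x * F n x))\<^sup>2 \<le> C * B\<^sup>2 * (\<Sum>n\<in>{m..<n0}. (hnorm H (F n))\<^sup>2)"
    if F: "\<And>n. F n \<in> elems H" for F m n0
  proof -
    have "\<forall>n. \<exists>a. ser (F n) a" using series[OF F] by (auto simp: ser_def)
    from choice[OF this] obtain a where a: "\<And>n. ser (F n) (a n)" by blast
    define a' where "a' = (\<lambda>n. if n \<in> {m..<n0} then a n else (\<lambda>A. 0))"
    have s: "ser (\<lambda>x. \<Sum>n\<in>{m..<n0}. \<Phi> n x * F n x) (\<lambda>A. \<Sum>n\<in>{m..<n0}. conv (p n) (a n) A)"
      by (intro ser_sum ser_conv p a) simp
    have f: "(\<lambda>x. \<Sum>n\<in>{m..<n0}. \<Phi> n x * F n x) \<in> elems H" by (intro sum_in mult_in F)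
    have conv0: "conv q (\<lambda>A. 0) A = 0" for q A unfolding conv_def by (simp add: case_prod_beta)
    show ?thesis
    proof (rule ser_boundI[OF f s])
      fix J
      have "(\<Sum>n\<in>{m..<n0}. conv (p n) (a n) A) = (\<Sum>n<n0. conv (p n) (a' n) A)" for A
        by (rule sum.mono_neutral_cong_left) (auto simp: a'_def conv0)
      then have "nrm w J (\<lambda>A. \<Sum>n\<in>{m..<n0}. conv (p n) (a n) A) \<le> C * B\<^sup>2 * (\<Sum>n<n0. nrm w J (a' n))"
        unfolding C_def using row_bound[OF cb[of n0] w_nonneg g, of J a'] by simp
      also have "(\<Sum>n<n0. nrm w J (a' n)) = (\<Sum>n\<in>{m..<n0}. nrm w J (a n))"
        by (rule sum.mono_neutral_cong_right) (auto simp: a'_def nrm_def)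
      also have "\<dots> \<le> (\<Sum>n\<in>{m..<n0}. (hnorm H (F n))\<^sup>2)"
        by (intro sum_mono ser_nrm_le F a)
      finally show "nrm w J (\<lambda>A. \<Sum>n\<in>{m..<n0}. conv (p n) (a n) A) \<le> C * B\<^sup>2 * (\<Sum>n\<in>{m..<n0}. (hnorm H (F n))\<^sup>2)"
        using C0 by (simp add: mult_left_mono)
    qed
  qed
  have main: "(\<forall>x. (\<lambda>n. \<Phi> n x * F n x) sums row_op \<Phi> F x) \<and> row_op \<Phi> F \<in> elems H \<and>
      hnorm H (row_op \<Phi> F) \<le> sqrt C * B * tensor_l2_norm H F" if F: "F \<in> tensor_l2 H" for F
  proof -
    have Fin: "F n \<in> elems H" for n using F by (simp add: tensor_l2_def)
    have sm: "summable (\<lambda>n. (hnorm H (F n))\<^sup>2)" using F by (simp add: tensor_l2_def)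
    define h where "h = (\<lambda>n0 x. \<Sum>n<n0. \<Phi> n x * F n x)"
    have h_in: "h n \<in> elems H" for n unfolding h_def by (intro sum_in mult_in Fin)
    have h_diff: "(\<lambda>x. h n x - h m x) = (\<lambda>x. \<Sum>n\<in>{m..<n}. \<Phi> n x * F n x)" if "m \<le> n" for m n
      unfolding h_def using that by (auto simp: fun_eq_iff sum_diff_nat_ivl lessThan_atLeast0)
    have "\<exists>M. \<forall>m\<ge>M. \<forall>n\<ge>M. hnorm H (\<lambda>x. h m x - h n x) < eps" if eps: "eps > 0" for eps
    proof -
      \<comment> \<open>The summand 1 avoids a division by 0 when the column norm is 0.\<close>
      have pos: "eps\<^sup>2 / (C * B\<^sup>2 + 1) > 0" using eps C0 by (intro divide_pos_pos add_nonneg_pos) auto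
      from summable_Cauchy[THEN iffD1, OF sm, rule_format, OF pos]
      obtain M where M: "\<And>m n. m \<ge> M \<Longrightarrow> norm (\<Sum>n\<in>{m..<n}. (hnorm H (F n))\<^sup>2) < eps\<^sup>2 / (C * B\<^sup>2 + 1)" by blast
      have lt: "hnorm H (\<lambda>x. h n x - h m x) < eps" if mn: "M \<le> m" "m \<le> n" for m n
      proof (rule power2_less_imp_less)
        let ?s = "\<Sum>n\<in>{m..<n}. (hnorm H (F n))\<^sup>2"
        have s0: "?s \<ge> 0" by (intro sum_nonneg) auto
        have "(hnorm H (\<lambda>x. h n x - h m x))\<^sup>2 \<le> C * B\<^sup>2 * ?s"
          unfolding h_diff[OF mn(2)] by (rule finite_row[OF Fin])
        also have "\<dots> \<le> (C * B\<^sup>2 + 1) * ?s" using s0 by (intro mult_right_mono) auto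
        also have "\<dots> < (C * B\<^sup>2 + 1) * (eps\<^sup>2 / (C * B\<^sup>2 + 1))"
          using M[OF mn(1), of n] s0 C0 by (intro mult_strict_left_mono add_nonneg_pos) auto
        also have "\<dots> = eps\<^sup>2" using C0 by (simp add: add_nonneg_eq_0_iff)
        finally show "(hnorm H (\<lambda>x. h n x - h m x))\<^sup>2 < eps\<^sup>2" .
      qed (use eps in simp)
      have "hnorm H (\<lambda>x. h m x - h n x) < eps" if "m \<ge> M" "n \<ge> M" for m n
        using lt[of n m] lt[of m n] hnorm_minus_commute[OF h_in[of m] h_in[of n]] that by (cases "m \<le> n") auto
      then show ?thesis by blast
    qed
    then obtain f where f: "f \<in> elems H" and lim: "(\<lambda>n. hnorm H (\<lambda>x. h n x - f x)) \<longlonglongrightarrow> 0"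
      using complete[of h] h_in by blast
    have sums: "(\<lambda>n. \<Phi> n x * F n x) sums f x" for x
      using point_limit[OF h_in f lim, of x] by (simp add: sums_def h_def)
    then have f_eq: "row_op \<Phi> F = f" unfolding row_op_def by (auto simp: sums_iff)
    have "hnorm H (h n) \<le> sqrt C * B * tensor_l2_norm H F" for n
    proof (rule power2_le_imp_le)
      have "(hnorm H (h n))\<^sup>2 \<le> C * B\<^sup>2 * (\<Sum>i\<in>{0..<n}. (hnorm H (F i))\<^sup>2)"
        unfolding h_def lessThan_atLeast0 by (rule finite_row[OF Fin])
      also have "\<dots> \<le> C * B\<^sup>2 * (\<Sum>i. (hnorm H (F i))\<^sup>2)"
        using C0 by (intro mult_left_mono sum_le_suminf sm) auto
      also have "\<dots> = (sqrt C * B * tensor_l2_norm H F)\<^sup>2"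
        unfolding tensor_l2_norm_def using C0 suminf_nonneg[OF sm] by (simp add: power_mult_distrib)
      finally show "(hnorm H (h n))\<^sup>2 \<le> (sqrt C * B * tensor_l2_norm H F)\<^sup>2" .
      show "0 \<le> sqrt C * B * tensor_l2_norm H F" using C0 B0 tensor_l2_norm_nonneg[OF F] by simp
    qed
    then have "hnorm H f \<le> sqrt C * B * tensor_l2_norm H F"
      by (intro LIMSEQ_le_const2[OF hnorm_limit[OF h_in f lim]]) blast
    then show ?thesis using sums f f_eq by simp
  qed
  have "row_bounded H \<Phi>"
    unfolding row_bounded_def bounded_operator_def using main by (auto simp: sums_iff)
  moreover have "row_norm H \<Phi> \<le> sqrt C * B"
    unfolding row_norm_def by (rule operator_norm_le) (use main C0 B0 in auto)
  ultimately show "row_bounded H \<Phi> \<and> row_norm H \<Phi> \<le> sqrt (row_const N \<rho>) * column_norm H \<Phi>"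
    by (simp add: C_def B_def)
qed

end

section \<open>The Dirichlet space\<close>

lemma power_series_unique:
  fixes a :: "nat \<Rightarrow> complex"
  assumes s: "\<And>t. cmod t < 1 \<Longrightarrow> (\<lambda>n. a n * t ^ n) sums 0"
  shows "a m = 0"
proof (rule ccontr)
  assume am: "a m \<noteq> 0"
  have s': "\<And>t. cmod (t - 0) < 1 \<Longrightarrow> (\<lambda>n. a n * (t - 0) ^ n) sums (\<lambda>_. 0) t" using s by simp
  show False
  proof (cases "m = 0")
    case True
    have "(\<lambda>n. a n * 0 ^ n) sums (\<Sum>n\<in>{0}. a n * 0 ^ n)" by (rule sums_finite) auto
    then have "a 0 = 0" using s[of 0] sums_unique2 by fastforce
    then show False using am True by simp
  next
    case False
    then have m: "m > 0" by simp
    show False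
    proof (rule powser_0_nonzero[OF zero_less_one s' refl am m])
      fix r :: real
      assume "0 < r" and r: "\<And>z::complex. z \<in> cball 0 r - {0} \<Longrightarrow> (0::complex) \<noteq> 0"
      then show False using r[of "of_real r"] by simp
    qed
  qed
qed

lemma power_series_abs_summable:
  fixes a :: "nat \<Rightarrow> complex"
  assumes s: "\<And>t. cmod t < 1 \<Longrightarrow> (\<lambda>n. a n * t ^ n) sums f t" and z: "cmod z < 1"
  shows "((\<lambda>n. a n * z ^ n) has_sum f z) UNIV"
proof -
  define t :: complex where "t = of_real ((cmod z + 1) / 2)"
  have t: "cmod t < 1" "cmod z < cmod t" using z unfolding t_def norm_of_real by auto
  have "summable (\<lambda>n. norm (a n * z ^ n))"
    by (rule powser_insidea[OF sums_summable[OF s[OF t(1)]] t(2)])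
  then show ?thesis by (rule norm_summable_imp_has_sum[OF _ s[OF z]])
qed

section \<open>The Dirichlet space as a weighted sequence space\<close>

definition dir_vec :: "(nat \<Rightarrow> complex) \<Rightarrow> nat \<Rightarrow> complex" where
  "dir_vec a n = of_real (sqrt (real (n + 1))) * a n"

definition dir_coeffs :: "(complex \<Rightarrow> complex) \<Rightarrow> (nat \<Rightarrow> complex) \<Rightarrow> bool" where
  "dir_coeffs f a \<longleftrightarrow> (\<forall>z. cmod z < 1 \<longrightarrow> (\<lambda>n. a n * z ^ n) sums f z) \<and>
     (\<forall>z. \<not> cmod z < 1 \<longrightarrow> f z = 0) \<and> dir_vec a \<in> elems ell2"

lemma dir_vec_norm: "(cmod (dir_vec a n))\<^sup>2 = real (n + 1) * (cmod (a n))\<^sup>2"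
  by (simp add: dir_vec_def norm_mult power_mult_distrib)

lemma dir_vec_in: "dir_vec a \<in> elems ell2 \<longleftrightarrow> summable (\<lambda>n. real (n + 1) * (cmod (a n))\<^sup>2)"
proof -
  have "(\<lambda>n. real (n + 1) * (cmod (a n))\<^sup>2) summable_on UNIV \<longleftrightarrow> summable (\<lambda>n. real (n + 1) * (cmod (a n))\<^sup>2)"
    by (rule summable_on_UNIV_nonneg_real_iff) simp
  then show ?thesis unfolding ell2_iff dir_vec_norm .
qed

lemma dir_coeffs_holomorphic: "dir_coeffs f a \<Longrightarrow> f holomorphic_on ball 0 1"
  by (rule power_series_holomorphic[of 0 1 a]) (simp add: dir_coeffs_def)

lemma dir_coeffs_taylor: "dir_coeffs f a \<Longrightarrow> taylor_coeff f = a"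
proof -
  assume a: "dir_coeffs f a"
  show ?thesis
  proof
    fix m
    have "(\<lambda>n. (taylor_coeff f n - a n) * t ^ n) sums 0" if t: "cmod t < 1" for t
    proof -
      have "(\<lambda>n. (deriv ^^ n) f 0 / fact n * (t - 0) ^ n) sums f t"
        by (rule holomorphic_power_series[OF dir_coeffs_holomorphic[OF a]]) (use t in simp)
      then have "(\<lambda>n. taylor_coeff f n * t ^ n - a n * t ^ n) sums (f t - f t)"
        using a t by (intro sums_diff) (simp_all add: taylor_coeff_def dir_coeffs_def)
      then show ?thesis by (simp add: left_diff_distrib)
    qed
    from power_series_unique[of "\<lambda>n. taylor_coeff f n - a n", OF this, of m]
    show "taylor_coeff f m = a m" by simp
  qed
qed

lemma dir_points [simp]: "points dirichlet_space = ball 0 1"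
  by (simp add: dirichlet_space_def)

lemma dir_elems_iff: "f \<in> elems dirichlet_space \<longleftrightarrow> dir_coeffs f (taylor_coeff f)"
proof
  assume f: "f \<in> elems dirichlet_space"
  then have hol: "f holomorphic_on ball 0 1" by (simp add: dirichlet_space_def)
  have "(\<lambda>n. taylor_coeff f n * z ^ n) sums f z" if "cmod z < 1" for z
    using holomorphic_power_series[OF hol, of z] that by (simp add: taylor_coeff_def)
  then show "dir_coeffs f (taylor_coeff f)"
    using f by (simp add: dir_coeffs_def dir_vec_in) (simp add: dirichlet_space_def)
next
  assume a: "dir_coeffs f (taylor_coeff f)"
  then show "f \<in> elems dirichlet_space"
    using dir_coeffs_holomorphic[OF a]
    by (simp add: dir_coeffs_def dir_vec_in) (simp add: dirichlet_space_def)
qed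

lemma dir_coeffs_elem: "dir_coeffs f a \<Longrightarrow> f \<in> elems dirichlet_space"
  using dir_coeffs_taylor dir_elems_iff by simp

lemma dir_coeffs_exists:
  assumes a: "dir_vec a \<in> elems ell2"
  shows "\<exists>f. dir_coeffs f a"
proof -
  have bound: "cmod (a n) \<le> hnorm ell2 (dir_vec a)" for n
  proof -
    have "1 * cmod (a n) \<le> sqrt (real (n + 1)) * cmod (a n)" by (intro mult_right_mono) auto
    also have "\<dots> = cmod (dir_vec a n)" by (simp add: dir_vec_def norm_mult)
    also have "\<dots> \<le> hnorm ell2 (dir_vec a)" by (rule ell2_point_le[OF a])
    finally show ?thesis by simp
  qed
  have "summable (\<lambda>n. a n * z ^ n)" if z: "cmod z < 1" for z
  proof (rule summable_comparison_test')
    show "summable (\<lambda>n. hnorm ell2 (dir_vec a) * cmod z ^ n)"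
      using z by (intro summable_mult summable_geometric) simp
    show "norm (a n * z ^ n) \<le> hnorm ell2 (dir_vec a) * cmod z ^ n" for n
      unfolding norm_mult norm_power by (intro mult_right_mono bound) simp
  qed
  then have "dir_coeffs (\<lambda>z. if cmod z < 1 then \<Sum>n. a n * z ^ n else 0) a"
    using a by (simp add: dir_coeffs_def summable_sums)
  then show ?thesis by blast
qed

lemma sqrt_mult_cnj:
  "x \<ge> 0 \<Longrightarrow> of_real (sqrt x) * z * cnj (of_real (sqrt x) * w) = of_real x * (z * cnj w)"
proof -
  assume "x \<ge> 0"
  then have "complex_of_real (sqrt x) * of_real (sqrt x) = of_real x" by (simp flip: of_real_mult)
  then have "complex_of_real (sqrt x) * of_real (sqrt x) * (z * cnj w) = of_real x * (z * cnj w)" by simp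
  then show ?thesis by (simp add: mult_ac)
qed

lemma dir_ip:
  assumes f: "dir_coeffs f a" and g: "dir_coeffs g b"
  shows "ip dirichlet_space f g = ip ell2 (dir_vec a) (dir_vec b)"
proof -
  have "((\<lambda>n. dir_vec a n * cnj (dir_vec b n)) has_sum ip ell2 (dir_vec a) (dir_vec b)) UNIV"
    by (rule ell2_ip_has_sum) (use f g in \<open>auto simp: dir_coeffs_def\<close>)
  from has_sum_imp_sums[OF this]
  have "(\<Sum>n. dir_vec a n * cnj (dir_vec b n)) = ip ell2 (dir_vec a) (dir_vec b)" by (simp add: sums_iff)
  moreover have "dir_vec a n * cnj (dir_vec b n) = of_nat (n + 1) * a n * cnj (b n)" for n
    unfolding dir_vec_def by (subst sqrt_mult_cnj) (simp_all del: of_nat_Suc of_nat_add)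
  ultimately show ?thesis
    using dir_coeffs_taylor[OF f] dir_coeffs_taylor[OF g] by (simp add: dirichlet_space_def)
qed

lemma dir_hnorm: "dir_coeffs f a \<Longrightarrow> hnorm dirichlet_space f = hnorm ell2 (dir_vec a)"
  by (simp add: hnorm_def dir_ip)

lemma dir_vec_add: "dir_vec (\<lambda>n. a n + b n) = (\<lambda>n. dir_vec a n + dir_vec b n)"
  and dir_vec_diff: "dir_vec (\<lambda>n. a n - b n) = (\<lambda>n. dir_vec a n - dir_vec b n)"
  and dir_vec_scale: "dir_vec (\<lambda>n. c * a n) = (\<lambda>n. c * dir_vec a n)"
  by (auto simp: dir_vec_def algebra_simps)

lemma dir_coeffs_add: "dir_coeffs f a \<Longrightarrow> dir_coeffs g b \<Longrightarrow> dir_coeffs (\<lambda>z. f z + g z) (\<lambda>n. a n + b n)"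
  by (auto simp: dir_coeffs_def dir_vec_add distrib_right intro: sums_add ell2_add)

lemma dir_coeffs_scale: "dir_coeffs f a \<Longrightarrow> dir_coeffs (\<lambda>z. c * f z) (\<lambda>n. c * a n)"
  by (auto simp: dir_coeffs_def dir_vec_scale mult.assoc intro: sums_mult ell2_scale)

lemma dir_coeffs_diff: "dir_coeffs f a \<Longrightarrow> dir_coeffs g b \<Longrightarrow> dir_coeffs (\<lambda>z. f z - g z) (\<lambda>n. a n - b n)"
  using dir_coeffs_add[OF _ dir_coeffs_scale[of g b "-1"], of f a] by simp

lemma dir_coeffs_zero: "dir_coeffs (\<lambda>z. 0) (\<lambda>n. 0)"
  using ell2.zero_in by (simp add: dir_coeffs_def dir_vec_def[abs_def])

text \<open>On the disk this is -log(1 - t) / t at t = \<open>z * cnj w\<close>, with value 1 at t =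
  0.\<close>

definition dir_kernel :: "complex \<Rightarrow> complex \<Rightarrow> complex" where
  "dir_kernel z w = (\<Sum>n. (z * cnj w) ^ n / of_nat (n + 1))"

lemma dir_kernel_coeffs:
  assumes w: "cmod w < 1"
  shows "dir_coeffs (\<lambda>z. if z \<in> ball 0 1 then dir_kernel z w else 0) (\<lambda>n. cnj w ^ n / of_nat (n + 1))"
proof -
  let ?a = "\<lambda>n. cnj w ^ n / of_nat (n + 1)"
  have "summable (\<lambda>n. real (n + 1) * (cmod (?a n))\<^sup>2)"
  proof (rule summable_comparison_test')
    show "summable (\<lambda>n. ((cmod w)\<^sup>2) ^ n)"
      using w by (intro summable_geometric) (simp add: power_less_one_iff abs_square_less_1)
    fix n
    have "real (n + 1) * (cmod (?a n))\<^sup>2 = ((cmod w)\<^sup>2) ^ n / real (n + 1)"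
      by (simp add: norm_divide norm_power power_divide power2_eq_square power_mult_distrib del: of_nat_Suc)
    also have "\<dots> \<le> ((cmod w)\<^sup>2) ^ n / 1"
      by (rule divide_left_mono) auto
    finally show "norm (real (n + 1) * (cmod (?a n))\<^sup>2) \<le> ((cmod w)\<^sup>2) ^ n" by simp
  qed
  then have v: "dir_vec ?a \<in> elems ell2" by (simp only: dir_vec_in)
  from dir_coeffs_exists[OF v] obtain f where f: "dir_coeffs f ?a" ..
  have "f = (\<lambda>z. if z \<in> ball 0 1 then dir_kernel z w else 0)"
  proof
    fix z
    show "f z = (if z \<in> ball 0 1 then dir_kernel z w else 0)"
      using f unfolding dir_coeffs_def dir_kernel_def
      by (auto simp: sums_iff power_mult_distrib mult.commute)
  qed
  with f show ?thesis by simp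
qed

lemma dir_hilbert: "hilbert_function_space dirichlet_space dir_kernel"
proof
  fix f g h :: "complex \<Rightarrow> complex" and c :: complex
  assume f: "f \<in> elems dirichlet_space" and g: "g \<in> elems dirichlet_space"
  note f' = f[unfolded dir_elems_iff] and g' = g[unfolded dir_elems_iff]
  have v: "dir_vec (taylor_coeff f) \<in> elems ell2" "dir_vec (taylor_coeff g) \<in> elems ell2"
    using f' g' by (auto simp: dir_coeffs_def)
  show "(\<lambda>x. f x + g x) \<in> elems dirichlet_space" by (rule dir_coeffs_elem[OF dir_coeffs_add[OF f' g']])
  show "ip dirichlet_space g f = cnj (ip dirichlet_space f g)"
    unfolding dir_ip[OF f' g'] dir_ip[OF g' f'] by (rule ell2.ip_cnj[OF v])
  show "ip dirichlet_space (\<lambda>x. c * f x) g = c * ip dirichlet_space f g"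
    unfolding dir_ip[OF f' g'] dir_ip[OF dir_coeffs_scale[OF f'] g'] dir_vec_scale by (rule ell2.ip_scale[OF v])
  assume h: "h \<in> elems dirichlet_space"
  note h' = h[unfolded dir_elems_iff]
  have vh: "dir_vec (taylor_coeff h) \<in> elems ell2" using h' by (auto simp: dir_coeffs_def)
  show "ip dirichlet_space (\<lambda>x. f x + g x) h = ip dirichlet_space f h + ip dirichlet_space g h"
    unfolding dir_ip[OF f' h'] dir_ip[OF g' h'] dir_ip[OF dir_coeffs_add[OF f' g'] h'] dir_vec_add
    by (rule ell2.ip_add[OF v vh])
next
  show "(\<lambda>x. 0) \<in> elems dirichlet_space" by (rule dir_coeffs_elem[OF dir_coeffs_zero])
next
  fix f :: "complex \<Rightarrow> complex" and c :: complex
  assume f: "f \<in> elems dirichlet_space"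
  note f' = f[unfolded dir_elems_iff]
  show "(\<lambda>x. c * f x) \<in> elems dirichlet_space" by (rule dir_coeffs_elem[OF dir_coeffs_scale[OF f']])
  show "x \<notin> points dirichlet_space \<Longrightarrow> f x = 0" for x using f' by (simp add: dir_coeffs_def)
  show "Re (ip dirichlet_space f f) > 0" if nz: "f \<noteq> (\<lambda>x. 0)"
    unfolding dir_ip[OF f' f']
  proof (rule ell2.ip_pos)
    show "dir_vec (taylor_coeff f) \<in> elems ell2" using f' by (simp add: dir_coeffs_def)
    show "dir_vec (taylor_coeff f) \<noteq> (\<lambda>n. 0)"
    proof
      assume zero: "dir_vec (taylor_coeff f) = (\<lambda>n. 0)"
      have "taylor_coeff f n = 0" for n
        using dir_vec_norm[of "taylor_coeff f" n] fun_cong[OF zero, of n] by simp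
      then have "taylor_coeff f = (\<lambda>n. 0)" by auto
      then have "f z = 0" for z using f' unfolding dir_coeffs_def by (cases "cmod z < 1") (auto simp: sums_iff)
      then show False using nz by auto
    qed
  qed
  show "f y = ip dirichlet_space f (\<lambda>x. if x \<in> points dirichlet_space then dir_kernel x y else 0)"
    if y: "y \<in> points dirichlet_space" for y
  proof -
    have y: "cmod y < 1" using y by simp
    let ?b = "\<lambda>n. cnj y ^ n / of_nat (n + 1)"
    have kb: "dir_coeffs (\<lambda>z. if z \<in> ball 0 1 then dir_kernel z y else 0) ?b" by (rule dir_kernel_coeffs[OF y])
    have "((\<lambda>n. dir_vec (taylor_coeff f) n * cnj (dir_vec ?b n)) has_sum
        ip ell2 (dir_vec (taylor_coeff f)) (dir_vec ?b)) UNIV"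
      by (rule ell2_ip_has_sum) (use f' kb in \<open>auto simp: dir_coeffs_def\<close>)
    moreover have "dir_vec (taylor_coeff f) n * cnj (dir_vec ?b n) = taylor_coeff f n * y ^ n" for n
      unfolding dir_vec_def by (subst sqrt_mult_cnj) (simp_all del: of_nat_Suc of_nat_add)
    ultimately have "(\<lambda>n. taylor_coeff f n * y ^ n) sums ip ell2 (dir_vec (taylor_coeff f)) (dir_vec ?b)"
      using has_sum_imp_sums by fastforce
    moreover have "(\<lambda>n. taylor_coeff f n * y ^ n) sums f y" using f' y by (simp add: dir_coeffs_def)
    ultimately have "f y = ip ell2 (dir_vec (taylor_coeff f)) (dir_vec ?b)" by (rule sums_unique2[symmetric])
    then show ?thesis using dir_ip[OF f' kb] by simp
  qed
next
  fix F :: "nat \<Rightarrow> complex \<Rightarrow> complex"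
  assume F: "\<And>n. F n \<in> elems dirichlet_space"
    and cauchy: "\<And>e. e > 0 \<Longrightarrow> \<exists>N. \<forall>m\<ge>N. \<forall>n\<ge>N. hnorm dirichlet_space (\<lambda>x. F m x - F n x) < e"
  let ?v = "\<lambda>n. dir_vec (taylor_coeff (F n))"
  have F': "dir_coeffs (F n) (taylor_coeff (F n))" for n using F by (simp add: dir_elems_iff)
  have v: "?v n \<in> elems ell2" for n using F'[of n] by (simp add: dir_coeffs_def)
  have "\<exists>b\<in>elems ell2. (\<lambda>n. hnorm ell2 (\<lambda>i. ?v n i - b i)) \<longlonglongrightarrow> 0"
  proof (rule ell2_complete[OF v])
    fix e :: real assume "e > 0"
    from cauchy[OF this] show "\<exists>N. \<forall>m\<ge>N. \<forall>n\<ge>N. hnorm ell2 (\<lambda>x. ?v m x - ?v n x) < e"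
      by (simp add: dir_hnorm[OF dir_coeffs_diff[OF F' F']] dir_vec_diff)
  qed
  then obtain b where b: "b \<in> elems ell2" "(\<lambda>n. hnorm ell2 (\<lambda>i. ?v n i - b i)) \<longlonglongrightarrow> 0" by blast
  define a where "a = (\<lambda>n. b n / of_real (sqrt (real (n + 1))))"
  have av: "dir_vec a = b"
  proof
    fix n
    have "sqrt (real (n + 1)) \<noteq> 0" by simp
    then have "complex_of_real (sqrt (real (n + 1))) \<noteq> 0" by (simp only: of_real_eq_0_iff not_False_eq_True)
    then show "dir_vec a n = b n" unfolding dir_vec_def a_def by (simp only: times_divide_eq_right nonzero_mult_div_cancel_left not_False_eq_True)
  qed
  obtain f where f: "dir_coeffs f a" using dir_coeffs_exists[of a] b(1) av by auto
  have "hnorm dirichlet_space (\<lambda>x. F n x - f x) = hnorm ell2 (\<lambda>i. ?v n i - b i)" for n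
    by (simp add: dir_hnorm[OF dir_coeffs_diff[OF F' f]] dir_vec_diff av)
  then show "\<exists>f\<in>elems dirichlet_space. (\<lambda>n. hnorm dirichlet_space (\<lambda>x. F n x - f x)) \<longlonglongrightarrow> 0"
    using b(2) dir_coeffs_elem[OF f] by (intro bexI[of _ f]) auto
next
  fix y assume "y \<in> points dirichlet_space"
  then show "(\<lambda>x. if x \<in> points dirichlet_space then dir_kernel x y else 0) \<in> elems dirichlet_space"
    using dir_coeffs_elem[OF dir_kernel_coeffs[of y]] by simp
qed

text \<open>By Kaluza's argument, log-convexity of \<open>1 / (n + 1)\<close> makes the numbers \<open>kal n\<close> nonnegative,
  and these are the squared coefficients of the embedding into the unit ball of \<open>\<ell>\<^sup>2\<close>.\<close>

definition kal :: "nat \<Rightarrow> real" where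
  "kal = fps_nth (1 - inverse (Abs_fps (\<lambda>n. 1 / real (n + 1))))"

lemma kal_conv: "(\<Sum>j\<le>n. kal j * (1 / real (n - j + 1))) = (if n = 0 then 0 else 1 / real (n + 1))"
proof -
  let ?A = "Abs_fps (\<lambda>n. 1 / real (n + 1))"
  have "inverse ?A * ?A = 1" by (rule inverse_mult_eq_1) simp
  then have "(1 - inverse ?A) * ?A = ?A - 1" by (simp add: left_diff_distrib)
  then have "fps_nth ((1 - inverse ?A) * ?A) n = fps_nth (?A - 1) n" by simp
  then show ?thesis unfolding fps_mult_nth kal_def by (simp add: atMost_atLeast0)
qed

lemma kal_0: "kal 0 = 0"
  using kal_conv[of 0] by simp

lemma kal_Suc: "kal (Suc n) = 1 / real (n + 2) - (\<Sum>j\<le>n. kal j * (1 / real (n - j + 2)))"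
proof -
  have "(\<Sum>j\<le>Suc n. kal j * (1 / real (Suc n - j + 1))) = 1 / real (n + 2)"
    using kal_conv[of "Suc n"] by simp
  moreover have "(\<Sum>j\<le>n. kal j * (1 / real (Suc n - j + 1))) = (\<Sum>j\<le>n. kal j * (1 / real (n - j + 2)))"
    by (intro sum.cong refl) (simp add: Suc_diff_le)
  ultimately show ?thesis by simp
qed

text \<open>Log-convexity enters as (r + 1)/(r + 2) <= (m + 1)/(m + 2) for r <= m: scaling the
  identity \<open>kal_conv\<close> at m by (m + 1)/(m + 2) dominates the sum in
  \<open>kal_Suc\<close> term by term. The identity has value 1/(m + 1) only for m > 0, so index 1
  is separate.\<close>

lemma kal_nonneg: "kal n \<ge> 0"
proof (induction n rule: less_induct)
  case (less n)
  consider "n = 0" | "n = 1" | m where "n = Suc m" "m > 0" by (cases n rule: nat.exhaust) (use gr0I in auto)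
  then show ?case
  proof cases
    case (3 m)
    have "(\<Sum>j\<le>m. kal j * (1 / real (m - j + 2))) \<le> (\<Sum>j\<le>m. (real (m + 1) / real (m + 2)) * (kal j * (1 / real (m - j + 1))))"
    proof (rule sum_mono)
      fix j assume j: "j \<in> {..m}"
      define r where "r = real (m - j)"
      have r: "0 \<le> r" "r \<le> real m" by (auto simp: r_def)
      have "1 / (r + 2) \<le> (real m + 1) / (real m + 2) * (1 / (r + 1))"
      proof -
        have "(r + 1) * (real m + 2) \<le> (real m + 1) * (r + 2)" using r by (simp add: algebra_simps)
        then have "1 * ((real m + 2) * (r + 1)) \<le> (real m + 1) * (r + 2)" by (simp only: mult.commute mult_1)
        then have "1 / (r + 2) \<le> (real m + 1) / ((real m + 2) * (r + 1))"
          by (subst frac_le_eq) (use r in \<open>auto intro!: divide_nonpos_pos mult_pos_pos\<close>)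
        then show ?thesis by simp
      qed
      moreover have "0 \<le> kal j" using less 3 j by simp
      ultimately have "kal j * (1 / (r + 2)) \<le> kal j * ((real m + 1) / (real m + 2) * (1 / (r + 1)))"
        by (intro mult_left_mono)
      then show "kal j * (1 / real (m - j + 2)) \<le> (real (m + 1) / real (m + 2)) * (kal j * (1 / real (m - j + 1)))"
        by (simp add: r_def add.commute mult_ac)
    qed
    also have "\<dots> = (real (m + 1) / real (m + 2)) * (1 / real (m + 1))"
      unfolding sum_distrib_left[symmetric] kal_conv using 3 by simp
    also have "\<dots> = 1 / real (m + 2)" by (simp del: of_nat_Suc)
    finally show ?thesis unfolding 3 kal_Suc by simp
  qed (use kal_0 kal_Suc[of 0] in auto)
qed

lemma kal_le: "kal n \<le> 1"
proof -
  have "kal n * (1 / real (n - n + 1)) \<le> (\<Sum>j\<le>n. kal j * (1 / real (n - j + 1)))"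
    by (rule member_le_sum) (auto simp: kal_nonneg)
  then show ?thesis unfolding kal_conv by (auto split: if_splits intro: order_trans)
qed

lemma kal_summable: "cmod t < 1 \<Longrightarrow> summable (\<lambda>n. norm (of_real (kal n) * t ^ n))"
  by (rule summable_comparison_test'[of "\<lambda>n. cmod t ^ n"])
    (auto simp: norm_mult norm_power kal_nonneg kal_le mult_left_le_one_le summable_geometric)

lemma kal_kernel:
  assumes t: "cmod t < 1"
  shows "(\<Sum>n. t ^ n / of_nat (n + 1)) * (1 - (\<Sum>n. of_real (kal n) * t ^ n)) = 1"
proof -
  let ?a = "\<lambda>n. t ^ n / of_nat (n + 1)" and ?b = "\<lambda>n. of_real (kal n) * t ^ n"
  have na: "summable (\<lambda>n. norm (?a n))"
  proof (rule summable_comparison_test'[of "\<lambda>n. cmod t ^ n"])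
    show "norm (norm (?a n)) \<le> cmod t ^ n" for n
      by (simp add: norm_divide norm_power divide_le_eq mult_left_le mult_le_cancel_left1 del: of_nat_Suc)
  qed (use t in \<open>simp add: summable_geometric\<close>)
  note nb = kal_summable[OF t]
  have "(\<lambda>n. \<Sum>j\<le>n. ?b j * ?a (n - j)) sums ((\<Sum>n. ?b n) * (\<Sum>n. ?a n))"
    by (rule Cauchy_product_sums[OF nb na])
  moreover have "(\<Sum>j\<le>n. ?b j * ?a (n - j)) = ?a n - (if n = 0 then 1 else 0)" for n
  proof -
    have "(\<Sum>j\<le>n. ?b j * ?a (n - j)) = (\<Sum>j\<le>n. of_real (kal j * (1 / real (n - j + 1))) * t ^ n)"
    proof (intro sum.cong refl)
      fix j assume "j \<in> {..n}"
      then have "t ^ n = t ^ j * t ^ (n - j)" by (simp flip: power_add)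
      then show "?b j * ?a (n - j) = of_real (kal j * (1 / real (n - j + 1))) * t ^ n" by simp
    qed
    also have "\<dots> = of_real (if n = 0 then 0 else 1 / real (n + 1)) * t ^ n"
      unfolding sum_distrib_right[symmetric] of_real_sum[symmetric] kal_conv ..
    finally show ?thesis by simp
  qed
  moreover have "(\<lambda>n. ?a n - (if n = 0 then 1 else 0)) sums ((\<Sum>n. ?a n) - 1)"
  proof (intro sums_diff summable_sums summable_norm_cancel[OF na])
    show "(\<lambda>n. if n = 0 then 1 else 0) sums (1::complex)" using sums_single[of 0 "\<lambda>_. 1::complex"] by simp
  qed
  ultimately have "(\<Sum>n. ?b n) * (\<Sum>n. ?a n) = (\<Sum>n. ?a n) - 1" using sums_unique2 by force
  then show ?thesis by (simp add: algebra_simps)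
qed

lemma dir_cnp: "normalized_cnp_kernel (points dirichlet_space) dir_kernel"
  unfolding normalized_cnp_kernel_def
proof (intro exI conjI ballI)
  \<comment> \<open>The index shift drops the coefficient \<open>kal 0 = 0\<close>.\<close>
  let ?u = "\<lambda>z n. of_real (sqrt (kal (Suc n))) * z ^ Suc n"
  have B: "(\<lambda>n. of_real (kal (Suc n)) * t ^ Suc n) sums (\<Sum>n. of_real (kal n) * t ^ n)"
    if "cmod t < 1" for t
  proof -
    have "(\<lambda>n. of_real (kal n) * t ^ n) sums ((\<Sum>n. of_real (kal n) * t ^ n) + of_real (kal 0) * t ^ 0)"
      using summable_sums[OF summable_norm_cancel[OF kal_summable[OF that]]] by (simp add: kal_0)
    then show ?thesis by (subst sums_Suc_iff)
  qed
  have prod: "?u z n * cnj (?u w n) = of_real (kal (Suc n)) * (z * cnj w) ^ Suc n" for z w n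
    by (subst sqrt_mult_cnj) (simp_all add: kal_nonneg power_mult_distrib)
  have lt: "cmod (z * cnj w) < 1" if "cmod z < 1" "cmod w < 1" for z w
    using mult_strict_mono'[OF that] by (simp add: norm_mult)
  fix z assume z: "z \<in> points dirichlet_space"
  then have z1: "cmod z < 1" by simp
  let ?t = "z * cnj z"
  have t: "?t = of_real ((cmod z)\<^sup>2)" by (rule complex_norm_square[symmetric])
  have sq: "complex_of_real ((cmod (?u z n))\<^sup>2) = of_real (kal (Suc n)) * ?t ^ Suc n" for n
    unfolding complex_norm_square by (rule prod)
  have "(\<lambda>n. complex_of_real ((cmod (?u z n))\<^sup>2)) sums (\<Sum>n. of_real (kal n) * ?t ^ n)"
    unfolding sq by (rule B[OF lt[OF z1 z1]])
  from sums_Re[OF this] have s: "(\<lambda>n. (cmod (?u z n))\<^sup>2) sums Re (\<Sum>n. of_real (kal n) * ?t ^ n)"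
    by (simp only: Re_complex_of_real)
  then show "summable (\<lambda>n. (cmod (?u z n))\<^sup>2)" by (rule sums_summable)
  \<comment> \<open>At |z|^2 both series are real; the kernel value is positive and its product with
    1 minus this sum is 1.\<close>
  have "Re (\<Sum>n. of_real (kal n) * ?t ^ n) < 1"
  proof (rule ccontr)
    assume ge: "\<not> Re (\<Sum>n. of_real (kal n) * ?t ^ n) < 1"
    have r1: "(cmod z)\<^sup>2 < 1" using z1 by (simp add: abs_square_less_1)
    have bs: "(\<Sum>n. of_real (kal n) * ?t ^ n) = of_real (\<Sum>n. kal n * ((cmod z)\<^sup>2) ^ n)"
      using kal_summable[OF lt[OF z1 z1]] unfolding t
      by (subst suminf_of_real) (auto dest: summable_norm_cancel simp flip: of_real_mult of_real_power simp: norm_mult kal_nonneg)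
    have as: "(\<Sum>n. ?t ^ n / of_nat (n + 1)) = of_real (\<Sum>n. ((cmod z)\<^sup>2) ^ n / real (n + 1))"
      and as_summable: "summable (\<lambda>n. ((cmod z)\<^sup>2) ^ n / real (n + 1))"
    proof -
      show sm: "summable (\<lambda>n. ((cmod z)\<^sup>2) ^ n / real (n + 1))"
        by (rule summable_comparison_test'[of "\<lambda>n. ((cmod z)\<^sup>2) ^ n"])
          (use r1 in \<open>auto simp: summable_geometric divide_le_eq mult_le_cancel_left1\<close>)
      show "(\<Sum>n. ?t ^ n / of_nat (n + 1)) = of_real (\<Sum>n. ((cmod z)\<^sup>2) ^ n / real (n + 1))"
        unfolding t suminf_of_real[OF sm] by simp
    qed
    have "0 < (\<Sum>n. ((cmod z)\<^sup>2) ^ n / real (n + 1))"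
      by (rule suminf_pos2[OF as_summable, of 0]) auto
    moreover have "complex_of_real ((\<Sum>n. ((cmod z)\<^sup>2) ^ n / real (n + 1)) *
        (1 - (\<Sum>n. kal n * ((cmod z)\<^sup>2) ^ n))) = 1"
      using kal_kernel[OF lt[OF z1 z1]] unfolding as bs of_real_mult of_real_diff of_real_1 .
    then have "(\<Sum>n. ((cmod z)\<^sup>2) ^ n / real (n + 1)) * (1 - (\<Sum>n. kal n * ((cmod z)\<^sup>2) ^ n)) = 1"
      by (simp only: of_real_eq_1_iff)
    moreover have "1 - (\<Sum>n. kal n * ((cmod z)\<^sup>2) ^ n) \<le> 0" using ge unfolding bs by simp
    ultimately show False
      using mult_nonneg_nonpos[OF less_imp_le, of "\<Sum>n. ((cmod z)\<^sup>2) ^ n / real (n + 1)" "1 - (\<Sum>n. kal n * ((cmod z)\<^sup>2) ^ n)"]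
      by simp
  qed
  then show "(\<Sum>n. (cmod (?u z n))\<^sup>2) < 1" using s by (simp add: sums_iff)
  fix w assume "w \<in> points dirichlet_space"
  then have w1: "cmod w < 1" by simp
  have "(\<Sum>n. ?u z n * cnj (?u w n)) = (\<Sum>n. of_real (kal n) * (z * cnj w) ^ n)"
    unfolding prod using B[OF lt[OF z1 w1]] by (simp add: sums_iff)
  moreover have "dir_kernel z w * (1 - (\<Sum>n. of_real (kal n) * (z * cnj w) ^ n)) = 1"
    unfolding dir_kernel_def by (rule kal_kernel[OF lt[OF z1 w1]])
  ultimately have "dir_kernel z w * (1 - (\<Sum>n. ?u z n * cnj (?u w n))) = 1" by (simp only:)
  then show "dir_kernel z w = 1 / (1 - (\<Sum>n. ?u z n * cnj (?u w n)))"
    by (subst nonzero_eq_divide_eq) auto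
qed

section \<open>The column-row constant of the Dirichlet space\<close>

interpretation dir: power_series_space "\<lambda>n::nat. n" dirichlet_space dir_kernel "\<lambda>n z. z ^ n" "\<lambda>n. real (n + 1)"
proof (intro power_series_space.intro graded_monoid.intro dir_hilbert power_series_space_axioms.intro)
  show "finite {A::nat. A \<le> n}" for n by simp
  fix f assume "f \<in> elems dirichlet_space"
  then have f: "dir_coeffs f (taylor_coeff f)" by (simp add: dir_elems_iff)
  have "((\<lambda>n. taylor_coeff f n * z ^ n) has_sum f z) UNIV" if "cmod z < 1" for z
    by (rule power_series_abs_summable[OF _ that]) (use f in \<open>simp add: dir_coeffs_def\<close>)
  moreover have "((\<lambda>n. real (n + 1) * (cmod (taylor_coeff f n))\<^sup>2) has_sum (hnorm dirichlet_space f)\<^sup>2) UNIV"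
    using ell2_has_sum_norm[of "dir_vec (taylor_coeff f)"] f
    unfolding dir_vec_norm dir_hnorm[OF f] by (simp add: dir_coeffs_def)
  ultimately show "\<exists>a. (\<forall>x\<in>points dirichlet_space. ((\<lambda>A. a A * x ^ A) has_sum f x) UNIV) \<and>
      ((\<lambda>A. real (A + 1) * (cmod (a A))\<^sup>2) has_sum (hnorm dirichlet_space f)\<^sup>2) UNIV"
    by (intro exI[of _ "taylor_coeff f"] conjI ballI) simp_all
next
  fix a :: "nat \<Rightarrow> complex"
  assume "(\<lambda>A. real (A + 1) * (cmod (a A))\<^sup>2) summable_on UNIV"
  then have "dir_vec a \<in> elems ell2" unfolding ell2_iff dir_vec_norm .
  from dir_coeffs_exists[OF this] obtain f where f: "dir_coeffs f a" ..
  have "((\<lambda>n. a n * z ^ n) has_sum f z) UNIV" if "cmod z < 1" for z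
    by (rule power_series_abs_summable[OF _ that]) (use f in \<open>simp add: dir_coeffs_def\<close>)
  then show "\<exists>f\<in>elems dirichlet_space. \<forall>x\<in>points dirichlet_space. ((\<lambda>A. a A * x ^ A) has_sum f x) UNIV"
    using dir_coeffs_elem[OF f] by (intro bexI[of _ f] ballI) simp_all
next
  fix a :: "nat \<Rightarrow> complex" and A
  assume "\<And>x. x \<in> points dirichlet_space \<Longrightarrow> ((\<lambda>A. a A * x ^ A) has_sum 0) UNIV"
  then have "cmod t < 1 \<Longrightarrow> (\<lambda>n. a n * t ^ n) sums 0" for t
    using has_sum_imp_sums by auto
  then show "a A = 0" by (rule power_series_unique)
qed (auto simp: power_add)

text \<open>Dividing n + 1 by (n + 1)^2 leaves 1/(n + 1), the moments of Lebesgue measure on [0, 1].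
  So N = 1 and \<rho> = 1, and the constant obtained is sqrt 10.\<close>

lemma dir_column_row: "\<exists>c. column_row_constant dirichlet_space c"
proof -
  have "dir.row_weight (\<lambda>n. 1 / real (n + 1))"
  proof (rule dir.row_weight_integral)
    show "dir.row_weight (\<lambda>n. 1 * t ^ n)" if "t \<in> {0..1}" for t :: real
      by (rule dir.row_weight_scale[OF dir.row_weight_const]) (use that in \<open>auto simp: power_add\<close>)
    show "((\<lambda>t::real. 1 * t ^ n) has_integral 1 / real (n + 1)) {0..1}" for n
    proof -
      have "((\<lambda>t::real. t ^ n) has_integral (1 ^ Suc n / real (Suc n) - 0 ^ Suc n / real (Suc n))) {0..1}"
        by (rule fundamental_theorem_of_calculus)
          (auto intro!: derivative_eq_intros simp: has_real_derivative_iff_has_vector_derivative[symmetric] simp del: of_nat_Suc power_Suc)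
      then show ?thesis by simp
    qed
  qed
  moreover have "dir.wt (\<lambda>n. real (n + 1)) 1 n = 1 / real (n + 1)" for n
    unfolding dir.wt_def by (simp add: power2_eq_square del: of_nat_Suc)
  ultimately show ?thesis
    using dir.column_row_constant_power_series[of "\<lambda>n. 1 / real (n + 1)" 1 1] by auto
qed

section \<open>The Drury--Arveson space\<close>

lemma finite_size_le: "finite {A :: 'd::finite multiset. size A \<le> n}"
proof -
  have "{A :: 'd multiset. size A \<le> n} \<subseteq> mset ` {xs. set xs \<subseteq> UNIV \<and> length xs \<le> n}"
  proof
    fix A :: "'d multiset"
    assume "A \<in> {A. size A \<le> n}"
    moreover obtain xs where "mset xs = A" using ex_mset by blast
    ultimately show "A \<in> mset ` {xs. set xs \<subseteq> UNIV \<and> length xs \<le> n}"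
      by (intro image_eqI[of _ _ xs]) auto
  qed
  then show ?thesis by (rule finite_subset[OF _ finite_imageI[OF finite_lists_length_le]]) simp
qed

interpretation graded_mset: graded_monoid "size :: 'd::finite multiset \<Rightarrow> nat"
  by unfold_locales (simp_all add: finite_size_le)

lemma (in graded_monoid) row_weight_cmult: "row_weight \<gamma> \<Longrightarrow> c \<ge> 0 \<Longrightarrow> row_weight (\<lambda>A. c * \<gamma> A)"
  unfolding row_weight_def nrm_cmult_weight sum_distrib_left[symmetric]
  by (intro allI impI mult_left_mono) auto

text \<open>Integration by parts: the derivative of t^(a+1) (1 - t)^(b+1) trades one power of 1 - t
  for one of t.\<close>

lemma has_integral_beta:
  "((\<lambda>t::real. t ^ a * (1 - t) ^ b) has_integral fact a * fact b / fact (a + b + 1)) {0..1}"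
proof (induction b arbitrary: a)
  case 0
  have "((\<lambda>t::real. t ^ a) has_integral (1 ^ Suc a / real (Suc a) - 0 ^ Suc a / real (Suc a))) {0..1}"
    by (rule fundamental_theorem_of_calculus)
      (auto intro!: derivative_eq_intros simp: has_real_derivative_iff_has_vector_derivative[symmetric] simp del: of_nat_Suc power_Suc)
  then show ?case by (simp add: field_simps del: of_nat_Suc)
next
  case (Suc b)
  let ?X = "\<lambda>t::real. t ^ a * (1 - t) ^ Suc b" and ?Y = "\<lambda>t::real. t ^ Suc a * (1 - t) ^ b"
  let ?F = "\<lambda>t::real. t ^ Suc a * (1 - t) ^ Suc b"
  have D: "(?F has_real_derivative real (Suc a) * ?X t - real (Suc b) * ?Y t) (at t within T)" for t T
  proof -
    have 1: "((\<lambda>t. t ^ Suc a) has_real_derivative real (Suc a) * t ^ a) (at t within T)"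
      by (auto intro!: derivative_eq_intros simp del: power_Suc of_nat_Suc)
    have 2: "((\<lambda>t. (1 - t) ^ Suc b) has_real_derivative - (real (Suc b) * (1 - t) ^ b)) (at t within T)"
      by (auto intro!: derivative_eq_intros simp del: power_Suc of_nat_Suc)
    show ?thesis
      by (rule DERIV_cong[OF DERIV_mult[OF 1 2]]) (simp add: mult_ac del: power_Suc of_nat_Suc)
  qed
  have "((\<lambda>t. real (Suc a) * ?X t - real (Suc b) * ?Y t) has_integral ?F 1 - ?F 0) {0..1}"
    by (rule fundamental_theorem_of_calculus)
      (use D in \<open>auto simp: has_real_derivative_iff_has_vector_derivative[symmetric]\<close>)
  from has_integral_add[OF this has_integral_mult_right[OF Suc.IH[of "Suc a"], of "real (Suc b)"]]
  have "((\<lambda>t. real (Suc a) * ?X t) has_integral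
      real (Suc b) * (fact (Suc a) * fact b / fact (Suc a + b + 1))) {0..1}"
    by simp
  from has_integral_mult_right[OF this, of "1 / real (Suc a)"]
  have "(?X has_integral
      1 / real (Suc a) * (real (Suc b) * (fact (Suc a) * fact b / fact (Suc a + b + 1)))) {0..1}"
    by (simp del: of_nat_Suc fact_Suc power_Suc)
  moreover have "1 / real (Suc a) * (real (Suc b) * (fact (Suc a) * fact b / fact (Suc a + b + 1))) =
      fact a * fact (Suc b) / fact (a + Suc b + 1)"
    by (simp add: mult_ac del: of_nat_Suc fact_Suc add: fact_Suc[of a] fact_Suc[of b])
  ultimately show ?case by (simp only:)
qed

text \<open>A Dirichlet integral over the simplex, one coordinate at a time. In the beta integral
  for coordinate j, the powers with exponents \<open>count A j\<close> and \<open>?m A\<close> are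
  multiplicative in A, and \<open>(1 - t) ^ card S\<close> is a nonnegative constant.\<close>

lemma row_weight_fact:
  fixes S :: "'d::finite set"
  assumes "finite S"
  shows "graded_mset.row_weight (\<lambda>A. (\<Prod>i\<in>S. fact (count A i)) / fact ((\<Sum>i\<in>S. count A i) + card S))"
  using assms
proof (induction S rule: finite_induct)
  case empty
  then show ?case using graded_mset.row_weight_const by simp
next
  case (insert j S)
  let ?m = "\<lambda>A. \<Sum>i\<in>S. count A i"
  let ?G = "\<lambda>A. (\<Prod>i\<in>S. fact (count A i)) / fact (?m A + card S) :: real"
  show ?case
  proof (rule graded_mset.row_weight_integral)
    fix t :: real assume t: "t \<in> {0..1}"
    show "graded_mset.row_weight (\<lambda>A. (1 - t) ^ card S * (?G A * (t ^ count A j * (1 - t) ^ ?m A)))"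
      by (intro graded_mset.row_weight_cmult graded_mset.row_weight_scale insert.IH)
        (use t in \<open>auto simp: power_add sum.distrib\<close>)
  next
    fix A :: "'d multiset"
    have "((\<lambda>t. ?G A * (t ^ count A j * (1 - t) ^ (?m A + card S))) has_integral
        ?G A * (fact (count A j) * fact (?m A + card S) / fact (count A j + (?m A + card S) + 1))) {0..1}"
      by (rule has_integral_mult_right[OF has_integral_beta])
    moreover have "?G A * (fact (count A j) * fact (?m A + card S) / fact (count A j + (?m A + card S) + 1)) =
        (\<Prod>i\<in>insert j S. fact (count A i)) / fact ((\<Sum>i\<in>insert j S. count A i) + card (insert j S))"
      using insert.hyps by (simp add: add_ac del: fact_Suc)
    ultimately show "((\<lambda>t. (1 - t) ^ card S * (?G A * (t ^ count A j * (1 - t) ^ ?m A))) has_integral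
        (\<Prod>i\<in>insert j S. fact (count A i)) / fact ((\<Sum>i\<in>insert j S. count A i) + card (insert j S))) {0..1}"
      by (simp add: power_add mult_ac)
  qed
qed

text \<open>The squared norm \<alpha>! / |\<alpha>|! of a monomial in the Drury-Arveson space,
  written as the reciprocal number of words with content \<open>A\<close> to fit the Fock
  space.\<close>

definition multiplicity_weight :: "'d multiset \<Rightarrow> real" where
  "multiplicity_weight A = 1 / real (card (permutations_of_multiset A))"

lemma card_permutations_pos: "card (permutations_of_multiset A) > 0"
  by (simp add: card_gt_0_iff)

lemma multiplicity_weight_fact:
  fixes A :: "'d::finite multiset"
  shows "multiplicity_weight A = (\<Prod>i\<in>UNIV. fact (count A i)) / fact (size A)"
proof -
  have "card (permutations_of_multiset A) * (\<Prod>x\<in>set_mset A. fact (count A x)) = fact (size A)"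
    by (rule card_permutations_of_multiset_aux)
  also have "(\<Prod>x\<in>set_mset A. fact (count A x)) = (\<Prod>x\<in>UNIV. fact (count A x) :: nat)"
    by (rule prod.mono_neutral_left) (auto simp: not_in_iff)
  finally have "real (card (permutations_of_multiset A) * (\<Prod>x\<in>UNIV. fact (count A x))) = real (fact (size A))"
    by (rule arg_cong)
  then have "real (card (permutations_of_multiset A)) * (\<Prod>x\<in>UNIV. fact (count A x)) = fact (size A)"
    unfolding of_nat_mult of_nat_prod of_nat_fact .
  moreover have "real (card (permutations_of_multiset A)) \<noteq> 0"
    using card_permutations_pos[of A] by simp
  moreover have "(\<Prod>x\<in>UNIV. fact (count A x) :: real) \<noteq> 0" by simp
  ultimately show ?thesis unfolding multiplicity_weight_def by (simp add: field_simps)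
qed

lemma size_eq_sum_count: "size (A :: 'd::finite multiset) = (\<Sum>i\<in>UNIV. count A i)"
  unfolding size_multiset_overloaded_eq by (rule sum.mono_neutral_left) (auto simp: not_in_iff)

text \<open>The simplex integral divides the weight by a polynomial of degree d in the size. A beta
  integral in the size alone supplies the same quotient again, giving the even exponent 2 d that
  \<open>wt\<close> has.\<close>

lemma row_weight_multiplicity:
  fixes d :: nat
  defines "d \<equiv> CARD('d::finite)"
  shows "graded_mset.row_weight (\<lambda>A :: 'd multiset.
    multiplicity_weight A * (real d ^ d * fact (size A) / fact (size A + d))\<^sup>2)"
proof -
  have d: "d > 0" by (simp add: d_def)
  have eq: "(\<Prod>i\<in>UNIV. fact (count A i)) / fact ((\<Sum>i\<in>UNIV. count A i) + card (UNIV :: 'd set)) =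
      multiplicity_weight A * (fact (size A) / fact (size A + d))" for A :: "'d multiset"
    unfolding multiplicity_weight_fact size_eq_sum_count[symmetric] d_def by simp
  have g: "graded_mset.row_weight (\<lambda>A :: 'd multiset. multiplicity_weight A * (fact (size A) / fact (size A + d)))"
    using row_weight_fact[of "UNIV :: 'd set"] unfolding eq by simp
  have "graded_mset.row_weight (\<lambda>A :: 'd multiset. multiplicity_weight A * (fact (size A) / fact (size A + d)) *
      (fact (size A) * fact (d - 1) / fact (size A + (d - 1) + 1)))"
  proof (rule graded_mset.row_weight_integral)
    fix t :: real assume t: "t \<in> {0..1}"
    show "graded_mset.row_weight (\<lambda>A :: 'd multiset. (1 - t) ^ (d - 1) *
        (multiplicity_weight A * (fact (size A) / fact (size A + d)) * t ^ size A))"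
      by (intro graded_mset.row_weight_cmult graded_mset.row_weight_scale g) (use t in \<open>auto simp: power_add\<close>)
  next
    fix A :: "'d multiset"
    show "((\<lambda>t. (1 - t) ^ (d - 1) * (multiplicity_weight A * (fact (size A) / fact (size A + d)) * t ^ size A)) has_integral
      multiplicity_weight A * (fact (size A) / fact (size A + d)) *
      (fact (size A) * fact (d - 1) / fact (size A + (d - 1) + 1))) {0..1}"
      using has_integral_mult_right[OF has_integral_beta[of "size A" "d - 1"],
        of "multiplicity_weight A * (fact (size A) / fact (size A + d))"]
      by (simp add: mult_ac)
  qed
  \<comment> \<open>Removes the factor (d - 1)! of the beta integral and normalizes each quotient of
    factorials by d^d.\<close>
  from graded_mset.row_weight_cmult[OF this, of "real d ^ d * real d ^ d / fact (d - 1)"]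
  show ?thesis using d by (simp add: power2_eq_square mult_ac)
qed

lemma fact_add_le: "m \<le> d \<Longrightarrow> fact (n + m) \<le> fact n * (d * (n + 1)) ^ m"
proof (induction m)
  case (Suc m)
  have "n + Suc m \<le> d * (n + 1)"
  proof -
    have "n + d \<le> d * (n + 1)" using Suc.prems by (cases d) auto
    then show ?thesis using Suc.prems by linarith
  qed
  then have "(n + Suc m) * fact (n + m) \<le> (d * (n + 1)) * (fact n * (d * (n + 1)) ^ m)"
    using Suc by (intro mult_le_mono) auto
  then show ?case by (simp add: mult_ac)
qed simp

lemma fact_add_ge: "fact n * (n + 1) ^ m \<le> (fact (n + m) :: nat)"
proof (induction m)
  case (Suc m)
  have "(n + 1) * (fact n * (n + 1) ^ m) \<le> (n + Suc m) * fact (n + m)"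
    using Suc by (intro mult_le_mono) auto
  then show ?case by (simp add: mult_ac)
qed simp

text \<open>Rests on (n + 1)^d <= (n + d)! / n! <= d^d (n + 1)^d, the origin of the comparison
  constant (d^d)^2.\<close>

lemma row_weight_bounds:
  fixes d n :: nat and w :: real
  assumes w: "w \<ge> 0" and d: "d > 0"
  defines "q \<equiv> real d ^ d * fact n / fact (n + d)"
  shows "w * (1 / real (n + 1) ^ (2 * d)) \<le> w * q\<^sup>2"
    and "w * q\<^sup>2 \<le> (real d ^ d)\<^sup>2 * (w * (1 / real (n + 1) ^ (2 * d)))"
proof -
  define r where "r = 1 / real (n + 1) ^ d"
  have r0: "r \<ge> 0" by (simp add: r_def)
  have r2: "1 / real (n + 1) ^ (2 * d) = r\<^sup>2"
    unfolding r_def by (simp add: power_divide power_mult mult.commute[of 2])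
  have "real (fact (n + d)) \<le> real (fact n * (d * (n + 1)) ^ d)"
    using fact_add_le[of d d n] by (simp only: of_nat_le_iff order_refl)
  then have le: "fact (n + d) \<le> (real d ^ d * fact n) * real (n + 1) ^ d"
    unfolding of_nat_mult of_nat_power of_nat_fact power_mult_distrib by (simp only: mult_ac)
  have "real (fact n * (n + 1) ^ d) \<le> real (fact (n + d))"
    using fact_add_ge[of n d] by (simp only: of_nat_le_iff)
  then have ge: "fact n * real (n + 1) ^ d \<le> fact (n + d)" by simp
  have pos: "real (n + 1) ^ d > 0" by simp
  have "r \<le> q" unfolding r_def q_def using le pos by (simp add: divide_simps)
  then have "r\<^sup>2 \<le> q\<^sup>2" using r0 by (rule power_mono)
  then show "w * (1 / real (n + 1) ^ (2 * d)) \<le> w * q\<^sup>2" unfolding r2 using w by (rule mult_left_mono)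
  have "fact n / fact (n + d) \<le> r" unfolding r_def using ge pos by (simp add: divide_simps)
  then have "q \<le> real d ^ d * r" unfolding q_def times_divide_eq_right[symmetric] by (rule mult_left_mono) simp
  then have "q\<^sup>2 \<le> (real d ^ d * r)\<^sup>2" by (rule power_mono) (simp add: q_def)
  then have "w * q\<^sup>2 \<le> w * (real d ^ d * r)\<^sup>2" using w by (rule mult_left_mono)
  then show "w * q\<^sup>2 \<le> (real d ^ d)\<^sup>2 * (w * (1 / real (n + 1) ^ (2 * d)))"
    unfolding r2 by (simp add: power_mult_distrib mult_ac)
qed

section \<open>Monomials on the ball and uniqueness of their coefficients\<close>

definition emon :: "'d multiset \<Rightarrow> complex ^ 'd \<Rightarrow> complex" where
  "emon A z = (\<Prod>i\<in>#A. z $ i)"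

lemma emon_empty [simp]: "emon {#} z = 1"
  and emon_add_mset [simp]: "emon (add_mset i A) z = z $ i * emon A z"
  and emon_union: "emon (A + B) z = emon A z * emon B z"
  by (simp_all add: emon_def)

lemma emon_mult: "emon A (\<chi> i. y $ i * z $ i) = emon A y * emon A z"
  by (induction A) auto

lemma emon_const: "emon A (\<chi> i. t * z $ i) = t ^ size A * emon A z"
  by (induction A) auto

lemma emon_nonzero: "(\<And>i. z $ i \<noteq> 0) \<Longrightarrow> emon A z \<noteq> 0"
  by (induction A) auto

lemma norm_vec_mult_le:
  fixes z :: "complex ^ 'd"
  assumes "\<And>i. cmod (y i) \<le> 1"
  shows "norm (\<chi> i. y i * z $ i) \<le> norm z"
  unfolding norm_vec_def
  by (rule L2_set_mono) (auto simp: norm_mult intro!: mult_left_le_one_le assms)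

lemma ball_small:
  fixes z :: "complex ^ 'd"
  assumes "\<And>i. cmod (z $ i) < 1 / real CARD('d)"
  shows "z \<in> ball 0 1"
proof -
  have "norm z \<le> (\<Sum>i\<in>UNIV. cmod (z $ i))"
    unfolding norm_vec_def by (rule L2_set_le_sum) simp
  also have "\<dots> < (\<Sum>i\<in>(UNIV :: 'd set). 1 / real CARD('d))"
    by (rule sum_strict_mono) (use assms in auto)
  also have "\<dots> = 1" by simp
  finally show ?thesis by simp
qed

text \<open>Compares a constant vector with the one whose j-th coordinate is halved: the values of a
  monomial differ by the factor (1/2) to the multiplicity of j.\<close>

lemma emon_separates:
  fixes A B :: "('d::finite) multiset"
  assumes "A \<noteq> B"
  shows "\<exists>y\<in>ball 0 1. emon A y \<noteq> emon B y"
proof (rule ccontr)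
  assume "\<not> ?thesis"
  then have eq: "emon A y = emon B y" if "y \<in> ball 0 1" for y using that by blast
  from assms obtain j where j: "count A j \<noteq> count B j" by (auto simp: multiset_eq_iff)
  define c :: complex where "c = of_real (1 / (2 * real CARD('d)))"
  have c: "c \<noteq> 0" "cmod c < 1 / real CARD('d)"
    unfolding c_def norm_of_real by (auto simp: divide_simps)
  define y :: "bool \<Rightarrow> complex ^ 'd" where "y = (\<lambda>b. \<chi> i. if b \<and> i = j then c / 2 else c)"
  have y: "y b \<in> ball 0 1" for b
  proof (rule ball_small)
    have "cmod (c / 2) \<le> cmod c" by (simp add: norm_divide)
    then have "cmod (c / 2) < 1 / real CARD('d)" using c(2) by (rule le_less_trans)
    then show "cmod (y b $ i) < 1 / real CARD('d)" for i using c(2) by (auto simp: y_def)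
  qed
  have "emon C (y False) = c ^ size C" for C by (induction C) (auto simp: y_def)
  moreover have "emon C (y True) = c ^ size C * (1 / 2) ^ count C j" for C
    by (induction C) (auto simp: y_def)
  ultimately have "(1 / 2 :: complex) ^ count A j = (1 / 2) ^ count B j"
    using eq[OF y[of False]] eq[OF y[of True]] c(1) by simp
  then have "cmod ((1 / 2) ^ count A j) = cmod ((1 / 2) ^ count B j)" by (rule arg_cong)
  then have "(1 / 2 :: real) ^ count A j = (1 / 2) ^ count B j"
    by (simp add: norm_power norm_divide)
  then show False using j by (simp add: power_inject_exp')
qed

text \<open>Artin's argument for the independence of characters: the monomials are multiplicative
  for the coordinatewise product, under which the ball is closed.\<close>

lemma emon_independent:
  fixes S :: "('d::finite) multiset set"
  assumes "finite S" "\<And>z. z \<in> ball 0 1 \<Longrightarrow> (\<Sum>A\<in>S. a A * emon A z) = 0" "A \<in> S"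
  shows "a A = 0"
  using assms
proof (induction S arbitrary: a A rule: finite_induct)
  case (insert B S)
  have S: "a C = 0" if C: "C \<in> S" for C
  proof -
    from C insert.hyps have "C \<noteq> B" by auto
    then obtain y where y: "y \<in> ball 0 1" "emon C y \<noteq> emon B y" using emon_separates by blast
    have "a C * (emon C y - emon B y) = 0"
    proof (rule insert.IH[OF _ C])
      fix z :: "complex ^ 'd" assume z: "z \<in> ball 0 1"
      have "norm (\<chi> i. y $ i * z $ i) \<le> norm z"
        using y(1) by (intro norm_vec_mult_le order_trans[OF Finite_Cartesian_Product.norm_nth_le]) simp
      then have yz: "(\<chi> i. y $ i * z $ i) \<in> ball 0 1" using z by simp
      have "(\<Sum>A\<in>S. a A * (emon A y - emon B y) * emon A z) =
          (\<Sum>A\<in>insert B S. a A * (emon A y - emon B y) * emon A z)"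
        using insert.hyps by simp
      also have "\<dots> = (\<Sum>A\<in>insert B S. a A * emon A (\<chi> i. y $ i * z $ i)) -
          emon B y * (\<Sum>A\<in>insert B S. a A * emon A z)"
        unfolding sum_distrib_left sum_subtractf[symmetric] emon_mult by (intro sum.cong refl) (simp add: algebra_simps)
      finally show "(\<Sum>A\<in>S. a A * (emon A y - emon B y) * emon A z) = 0"
        using insert.prems(1)[OF yz] insert.prems(1)[OF z] by simp
    qed
    then show ?thesis using y(2) by simp
  qed
  define z :: "complex ^ 'd" where "z = (\<chi> i. of_real (1 / (2 * real CARD('d))))"
  have z: "z \<in> ball 0 1"
    by (rule ball_small) (simp only: z_def vec_lambda_beta norm_of_real, simp add: divide_simps)
  have "emon B z \<noteq> 0" by (rule emon_nonzero) (simp add: z_def)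
  moreover have "a B * emon B z = 0" using insert.prems(1)[OF z] insert.hyps S by simp
  ultimately show ?case using S insert.prems(2) by auto
qed simp

text \<open>Along t z the series is a power series in t whose coefficients are the homogeneous
  parts. One-variable uniqueness kills each of them, and each is a finite sum of monomials.\<close>

lemma emon_series_zero:
  fixes a :: "('d::finite) multiset \<Rightarrow> complex"
  assumes s: "\<And>z. z \<in> ball 0 1 \<Longrightarrow> ((\<lambda>A. a A * emon A z) has_sum 0) UNIV"
  shows "a A = 0"
proof (rule emon_independent[of "{B. size B = size A}"])
  show "finite {B :: 'd multiset. size B = size A}"
    by (rule finite_subset[OF _ finite_size_le[of "size A"]]) auto
  fix z :: "complex ^ 'd" assume z: "z \<in> ball 0 1"
  have "(\<lambda>n. (\<Sum>B\<in>{B. size B = n}. a B * emon B z) * t ^ n) sums 0" if t: "cmod t < 1" for t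
  proof -
    let ?tz = "\<chi> i. t * z $ i"
    have "norm ?tz \<le> norm z" by (rule norm_vec_mult_le) (use t in simp)
    then have "?tz \<in> ball 0 1" using z by simp
    from s[OF this] have s0: "((\<lambda>B. a B * emon B ?tz) has_sum 0) UNIV" .
    have bij: "bij_betw snd (Sigma UNIV (\<lambda>n. {B :: 'd multiset. size B = n})) UNIV"
      by (rule bij_betwI[where g = "\<lambda>B. (size B, B)"]) auto
    have "((\<lambda>q. a (snd q) * emon (snd q) ?tz) has_sum 0) (Sigma UNIV (\<lambda>n. {B :: 'd multiset. size B = n}))"
      using has_sum_reindex_bij_betw[OF bij, of "\<lambda>B. a B * emon B ?tz"] s0 by simp
    then have "((\<lambda>n. (\<Sum>B\<in>{B. size B = n}. a B * emon B z) * t ^ n) has_sum 0) UNIV"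
    proof (rule has_sum_SigmaD)
      fix n
      have "finite {B :: 'd multiset. size B = n}"
        by (rule finite_subset[OF _ finite_size_le[of n]]) auto
      moreover have "(\<Sum>B\<in>{B. size B = n}. a B * emon B ?tz) = (\<Sum>B\<in>{B. size B = n}. a B * emon B z) * t ^ n"
        unfolding sum_distrib_right emon_const by (intro sum.cong refl) auto
      ultimately show "((\<lambda>B. a (snd (n, B)) * emon (snd (n, B)) ?tz) has_sum
          (\<Sum>B\<in>{B. size B = n}. a B * emon B z) * t ^ n) {B. size B = n}"
        by (simp add: has_sum_finiteI)
    qed
    then show ?thesis by (rule has_sum_imp_sums)
  qed
  then show "(\<Sum>B\<in>{B. size B = size A}. a B * emon B z) = 0" by (rule power_series_unique)
qed simp

lemma words_mset_has_sum:
  fixes g :: "'d list \<Rightarrow> 'b::{topological_comm_monoid_add, t3_space}"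
  assumes "(g has_sum s) UNIV"
  shows "((\<lambda>A. \<Sum>w\<in>permutations_of_multiset A. g w) has_sum s) UNIV"
proof -
  let ?S = "Sigma UNIV (permutations_of_multiset :: 'd multiset \<Rightarrow> 'd list set)"
  have bij: "bij_betw snd ?S UNIV"
    by (rule bij_betwI[where g = "\<lambda>w. (mset w, w)"]) (auto simp: permutations_of_multiset_def)
  have "((\<lambda>q. g (snd q)) has_sum s) ?S"
    using has_sum_reindex_bij_betw[OF bij, of g] assms by simp
  then show ?thesis by (rule has_sum_SigmaD) (simp add: has_sum_finiteI)
qed

section \<open>Monomial expansions in the Drury-Arveson space\<close>

locale drury_arveson = hilbert_function_space H drury_arveson_kernel
  for H :: "(complex ^ 'd) hfs" +
  assumes points_ball: "points H = ball 0 1"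
begin

text \<open>The letters are the d coordinates themselves, so words evaluate to ordinary
  monomials.\<close>

sublocale cnp_space H drury_arveson_kernel vec_nth
proof
  fix z :: "complex ^ 'd" assume z: "z \<in> points H"
  show "(\<lambda>i. (cmod (z $ i))\<^sup>2) summable_on UNIV" by simp
  have "sqrt (\<Sum>i\<in>UNIV. (cmod (z $ i))\<^sup>2) < 1" using z by (simp add: points_ball norm_vec_def L2_set_def)
  then show "(\<Sum>\<^sub>\<infinity>i. (cmod (z $ i))\<^sup>2) < 1" by simp
  fix w :: "complex ^ 'd"
  show "drury_arveson_kernel z w = 1 / (1 - (\<Sum>\<^sub>\<infinity>i. z $ i * cnj (w $ i)))"
    by (simp add: drury_arveson_kernel_def divide_inverse)
qed

lemma mon_emon: "mon z w = emon (mset w) z"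
  unfolding mon_def by (induction w) auto

text \<open>Spreading the coefficient of a monomial evenly over the words with its content gives the
  lift of least norm.\<close>

lemma weighted_series:
  fixes \<alpha> :: "'d multiset \<Rightarrow> complex"
  assumes s: "((\<lambda>A. multiplicity_weight A * (cmod (\<alpha> A))\<^sup>2) has_sum T) UNIV"
  shows "\<exists>f\<in>elems H. (hnorm H f)\<^sup>2 \<le> T \<and> (\<forall>z\<in>points H. ((\<lambda>A. \<alpha> A * emon A z) has_sum f z) UNIV)"
proof -
  define a where "a = (\<lambda>w. \<alpha> (mset w) / of_nat (card (permutations_of_multiset (mset w))))"
  have T0: "T \<ge> 0" by (rule has_sum_nonneg[OF s]) (simp add: multiplicity_weight_def)
  have fibre: "(\<Sum>w\<in>permutations_of_multiset A. (cmod (a w))\<^sup>2) = multiplicity_weight A * (cmod (\<alpha> A))\<^sup>2" for A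
  proof -
    have "(\<Sum>w\<in>permutations_of_multiset A. (cmod (a w))\<^sup>2) =
        (\<Sum>w\<in>permutations_of_multiset A. (cmod (\<alpha> A) / real (card (permutations_of_multiset A)))\<^sup>2)"
      by (intro sum.cong refl) (auto simp: a_def norm_divide permutations_of_multiset_def)
    then show ?thesis
      by (simp add: multiplicity_weight_def power2_eq_square)
  qed
  have bound: "(\<Sum>w\<in>S. (cmod (a w))\<^sup>2) \<le> T" if "finite S" for S
  proof -
    have "(\<Sum>w\<in>S. (cmod (a w))\<^sup>2) = (\<Sum>A\<in>mset ` S. \<Sum>w\<in>{w\<in>S. mset w = A}. (cmod (a w))\<^sup>2)"
      by (rule sum.image_gen[OF that])
    also have "\<dots> \<le> (\<Sum>A\<in>mset ` S. \<Sum>w\<in>permutations_of_multiset A. (cmod (a w))\<^sup>2)"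
      by (intro sum_mono sum_mono2 finite_permutations_of_multiset) (auto simp: permutations_of_multiset_def)
    also have "\<dots> \<le> T"
      unfolding fibre by (rule finite_sum_le_has_sum[OF s])
        (use that in \<open>auto simp: multiplicity_weight_def\<close>)
    finally show ?thesis .
  qed
  have a: "a \<in> elems ell2" "hnorm ell2 a \<le> sqrt T"
    using ell2_boundI[of a T "sqrt T"] bound T0 by auto
  have "((\<lambda>A. \<alpha> A * emon A z) has_sum ab a z) UNIV" if z: "z \<in> points H" for z
  proof -
    have "(\<Sum>w\<in>permutations_of_multiset A. a w * mon z w) = \<alpha> A * emon A z" for A
    proof -
      have "(\<Sum>w\<in>permutations_of_multiset A. a w * mon z w) =
          (\<Sum>w\<in>permutations_of_multiset A. \<alpha> A / of_nat (card (permutations_of_multiset A)) * emon A z)"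
        by (intro sum.cong refl) (auto simp: a_def mon_emon permutations_of_multiset_def)
      then show ?thesis using card_permutations_pos[of A] by simp
    qed
    then show ?thesis using words_mset_has_sum[OF ab_has_sum[OF a(1) z]] by simp
  qed
  moreover have "(hnorm H (ab a))\<^sup>2 \<le> T"
  proof -
    have "hnorm H (ab a) \<le> sqrt T" using ab_in(2)[OF a(1)] a(2) by (rule order_trans)
    then have "(hnorm H (ab a))\<^sup>2 \<le> (sqrt T)\<^sup>2" by (rule power_mono) (rule hnorm_nonneg[OF ab_in(1)[OF a(1)]])
    then show ?thesis using T0 by simp
  qed
  ultimately show ?thesis by (intro bexI[OF _ ab_in(1)[OF a(1)]]) auto
qed

text \<open>Collecting the words of a lift by content gives the coefficients, and Cauchy-Schwarz on
  each fibre bounds their weighted norm by that of \<open>f\<close>. Conversely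
  \<open>weighted_series\<close> yields an element with the same series and no larger norm; it
  equals \<open>f\<close>, so the norms agree.\<close>

lemma emon_series:
  assumes f: "f \<in> elems H"
  shows "\<exists>\<alpha>. (\<forall>z\<in>points H. ((\<lambda>A. \<alpha> A * emon A z) has_sum f z) UNIV) \<and>
    ((\<lambda>A. multiplicity_weight A * (cmod (\<alpha> A))\<^sup>2) has_sum (hnorm H f)\<^sup>2) UNIV"
proof -
  from ab_lift[OF f] obtain a where a: "a \<in> elems ell2" "hnorm ell2 a \<le> hnorm H f" "ab a = f" by blast
  define \<alpha> where "\<alpha> = (\<lambda>A. \<Sum>w\<in>permutations_of_multiset A. a w)"
  have ser: "((\<lambda>A. \<alpha> A * emon A z) has_sum f z) UNIV" if z: "z \<in> points H" for z
  proof -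
    have "(\<Sum>w\<in>permutations_of_multiset A. a w * mon z w) = \<alpha> A * emon A z" for A
      unfolding \<alpha>_def sum_distrib_right
      by (intro sum.cong refl) (auto simp: mon_emon permutations_of_multiset_def)
    then show ?thesis using words_mset_has_sum[OF ab_has_sum[OF a(1) z]] a(3) by simp
  qed
  have n: "((\<lambda>A. \<Sum>w\<in>permutations_of_multiset A. (cmod (a w))\<^sup>2) has_sum (hnorm ell2 a)\<^sup>2) UNIV"
    by (rule words_mset_has_sum[OF ell2_has_sum_norm[OF a(1)]])
  have le: "multiplicity_weight A * (cmod (\<alpha> A))\<^sup>2 \<le> (\<Sum>w\<in>permutations_of_multiset A. (cmod (a w))\<^sup>2)" for A
  proof -
    have "(cmod (\<alpha> A))\<^sup>2 \<le> real (card (permutations_of_multiset A)) * (\<Sum>w\<in>permutations_of_multiset A. (cmod (a w))\<^sup>2)"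
      unfolding \<alpha>_def by (rule cmod_sum_sq_le) simp
    then show ?thesis using card_permutations_pos[of A]
      by (simp add: multiplicity_weight_def divide_le_eq mult.commute)
  qed
  have "(\<lambda>A. multiplicity_weight A * (cmod (\<alpha> A))\<^sup>2) summable_on UNIV"
    by (rule summable_on_comparison_test[OF has_sum_imp_summable[OF n] le]) (simp add: multiplicity_weight_def)
  then obtain T where T: "((\<lambda>A. multiplicity_weight A * (cmod (\<alpha> A))\<^sup>2) has_sum T) UNIV"
    by (auto simp: summable_on_def)
  have "T \<le> (hnorm ell2 a)\<^sup>2" by (rule has_sum_mono[OF T n le])
  also have "\<dots> \<le> (hnorm H f)\<^sup>2" by (rule power_mono[OF a(2)]) simp
  finally have T_le: "T \<le> (hnorm H f)\<^sup>2" .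
  from weighted_series[OF T] obtain g where g: "g \<in> elems H" "(hnorm H g)\<^sup>2 \<le> T"
      "\<forall>z\<in>points H. ((\<lambda>A. \<alpha> A * emon A z) has_sum g z) UNIV"
    by blast
  have "g = f"
  proof
    fix z show "g z = f z"
    proof (cases "z \<in> points H")
      case True
      then show ?thesis using g(3) ser has_sum_unique by blast
    next
      case False
      then show ?thesis using elems_support[OF f] elems_support[OF g(1)] by simp
    qed
  qed
  with g(2) T_le have "T = (hnorm H f)\<^sup>2" by simp
  with T ser show ?thesis by blast
qed

sublocale power_series_space "size :: 'd multiset \<Rightarrow> nat" H drury_arveson_kernel emon multiplicity_weight
proof (intro power_series_space.intro graded_mset.graded_monoid_axioms power_series_space_axioms.intro)
  show "hilbert_function_space H drury_arveson_kernel" by unfold_locales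
  fix a :: "'d multiset \<Rightarrow> complex"
  assume "(\<lambda>A. multiplicity_weight A * (cmod (a A))\<^sup>2) summable_on UNIV"
  then obtain T where "((\<lambda>A. multiplicity_weight A * (cmod (a A))\<^sup>2) has_sum T) UNIV"
    by (auto simp: summable_on_def)
  from weighted_series[OF this]
  show "\<exists>f\<in>elems H. \<forall>z\<in>points H. ((\<lambda>A. a A * emon A z) has_sum f z) UNIV" by blast
next
  fix a :: "'d multiset \<Rightarrow> complex" and A
  assume "\<And>z. z \<in> points H \<Longrightarrow> ((\<lambda>A. a A * emon A z) has_sum 0) UNIV"
  then show "a A = 0" by (intro emon_series_zero) (simp add: points_ball)
next
  fix f assume "f \<in> elems H"
  then show "\<exists>a. (\<forall>z\<in>points H. ((\<lambda>A. a A * emon A z) has_sum f z) UNIV) \<and>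
    ((\<lambda>A. multiplicity_weight A * (cmod (a A))\<^sup>2) has_sum (hnorm H f)\<^sup>2) UNIV"
    by (rule emon_series)
qed (simp_all add: multiplicity_weight_def emon_union)

lemma column_row_constant_drury_arveson:
  "column_row_constant H (sqrt (graded_mset.row_const CARD('d) ((real CARD('d) ^ CARD('d))\<^sup>2)))"
proof (rule column_row_constant_power_series[OF row_weight_multiplicity])
  fix A :: "'d multiset"
  have w: "multiplicity_weight A \<ge> 0" by (simp add: multiplicity_weight_def)
  show "graded_mset.wt multiplicity_weight CARD('d) A \<le>
      multiplicity_weight A * (real CARD('d) ^ CARD('d) * fact (size A) / fact (size A + CARD('d)))\<^sup>2"
    unfolding graded_mset.wt_def by (rule row_weight_bounds(1)[OF w]) simp
  show "multiplicity_weight A * (real CARD('d) ^ CARD('d) * fact (size A) / fact (size A + CARD('d)))\<^sup>2 \<le>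
      (real CARD('d) ^ CARD('d))\<^sup>2 * graded_mset.wt multiplicity_weight CARD('d) A"
    unfolding graded_mset.wt_def by (rule row_weight_bounds(2)[OF w]) simp
qed simp

end

text \<open>Passes from ordered series over the naturals to the unordered sums used with words;
  square summability makes them agree.\<close>

lemma normalized_cnp_space:
  assumes H: "hilbert_function_space H k" and cnp: "normalized_cnp_kernel (points H) k"
  obtains u :: "'a \<Rightarrow> nat \<Rightarrow> complex" where "cnp_space H k u"
proof -
  interpret hilbert_function_space H k by (rule H)
  from cnp obtain u :: "'a \<Rightarrow> nat \<Rightarrow> complex" where
    u1: "\<forall>x\<in>points H. summable (\<lambda>n. (cmod (u x n))\<^sup>2) \<and> (\<Sum>n. (cmod (u x n))\<^sup>2) < 1" and
    u2: "\<forall>x\<in>points H. \<forall>y\<in>points H. k x y = 1 / (1 - (\<Sum>n. u x n * cnj (u y n)))"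
    unfolding normalized_cnp_kernel_def by (elim exE conjE)
  have su: "(\<lambda>n. (cmod (u x n))\<^sup>2) summable_on UNIV" if "x \<in> points H" for x
    using u1 that by (subst summable_on_UNIV_nonneg_real_iff) auto
  have "cnp_space H k u"
  proof
    fix x assume x: "x \<in> points H"
    show "(\<lambda>n. (cmod (u x n))\<^sup>2) summable_on UNIV" by (rule su[OF x])
    show "(\<Sum>\<^sub>\<infinity>n. (cmod (u x n))\<^sup>2) < 1"
      using bspec[OF u1 x] has_sum_imp_sums[OF has_sum_infsum[OF su[OF x]]] by (simp add: sums_iff)
    fix y assume y: "y \<in> points H"
    have "((\<lambda>n. u x n * cnj (u y n)) has_sum (\<Sum>\<^sub>\<infinity>n. u x n * cnj (u y n))) UNIV"
      by (rule has_sum_infsum[OF ell2_prod_summable[OF _ ell2_cnj]]) (simp_all add: ell2_iff su x y)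
    from sums_unique[OF has_sum_imp_sums[OF this]]
    show "k x y = 1 / (1 - (\<Sum>\<^sub>\<infinity>n. u x n * cnj (u y n)))" unfolding bspec[OF bspec[OF u2 x] y] by (simp only:)
  qed
  then show thesis by (rule that)
qed

theorem theorem1p3:
  shows "(\<forall>(H :: 'a hfs) k.
            hilbert_function_space H k \<longrightarrow> normalized_cnp_kernel (points H) k \<longrightarrow>
            column_row_property H \<longrightarrow>
              (\<forall>h\<in>weak_product H. \<exists>f\<in>elems H. \<exists>g\<in>elems H. h = (\<lambda>x. f x * g x)) \<and>
              (\<forall>c. column_row_constant H c \<longrightarrow>
                (\<forall>h\<in>weak_product H. \<exists>f\<in>elems H. \<exists>g\<in>elems H. h = (\<lambda>x. f x * g x) \<and>
                   hnorm H f * hnorm H g \<le> c * weak_product_norm H h))) \<and>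
         (\<exists>c. column_row_constant dirichlet_space c \<and>
            (\<forall>h\<in>weak_product dirichlet_space.
               \<exists>f\<in>elems dirichlet_space. \<exists>g\<in>elems dirichlet_space. h = (\<lambda>z. f z * g z) \<and>
                 hnorm dirichlet_space f * hnorm dirichlet_space g
                   \<le> c * weak_product_norm dirichlet_space h)) \<and>
         (\<exists>c. \<forall>H :: (complex ^ 'd) hfs. is_drury_arveson_space H \<longrightarrow>
            column_row_constant H c \<and>
            (\<forall>h\<in>weak_product H. \<exists>f\<in>elems H. \<exists>g\<in>elems H. h = (\<lambda>z. f z * g z) \<and>
               hnorm H f * hnorm H g \<le> c * weak_product_norm H h))"
proof (intro conjI)
  show "\<forall>(H :: 'a hfs) k.
            hilbert_function_space H k \<longrightarrow> normalized_cnp_kernel (points H) k \<longrightarrow>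
            column_row_property H \<longrightarrow>
              (\<forall>h\<in>weak_product H. \<exists>f\<in>elems H. \<exists>g\<in>elems H. h = (\<lambda>x. f x * g x)) \<and>
              (\<forall>c. column_row_constant H c \<longrightarrow>
                (\<forall>h\<in>weak_product H. \<exists>f\<in>elems H. \<exists>g\<in>elems H. h = (\<lambda>x. f x * g x) \<and>
                   hnorm H f * hnorm H g \<le> c * weak_product_norm H h))"
  proof (intro allI impI conjI ballI)
    fix H :: "'a hfs" and k h
    assume H: "hilbert_function_space H k" "normalized_cnp_kernel (points H) k"
      and cr: "column_row_property H" and h: "h \<in> weak_product H"
    from normalized_cnp_space[OF H] obtain u :: "'a \<Rightarrow> nat \<Rightarrow> complex" where u: "cnp_space H k u" .
    show "\<exists>f\<in>elems H. \<exists>g\<in>elems H. h = (\<lambda>x. f x * g x)"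
      by (rule cnp_space.factorization[OF u cr h])
    show "\<exists>f\<in>elems H. \<exists>g\<in>elems H. h = (\<lambda>x. f x * g x) \<and>
        hnorm H f * hnorm H g \<le> c * weak_product_norm H h" if "column_row_constant H c" for c
      by (rule cnp_space.factorization_norm[OF u that h])
  qed
next
  from dir_column_row obtain c where c: "column_row_constant dirichlet_space c" ..
  from normalized_cnp_space[OF dir_hilbert dir_cnp] obtain u :: "complex \<Rightarrow> nat \<Rightarrow> complex"
    where u: "cnp_space dirichlet_space dir_kernel u" .
  show "\<exists>c. column_row_constant dirichlet_space c \<and>
            (\<forall>h\<in>weak_product dirichlet_space.
               \<exists>f\<in>elems dirichlet_space. \<exists>g\<in>elems dirichlet_space. h = (\<lambda>z. f z * g z) \<and>
                 hnorm dirichlet_space f * hnorm dirichlet_space g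
                   \<le> c * weak_product_norm dirichlet_space h)"
    by (intro exI[of _ c] conjI c ballI cnp_space.factorization_norm[OF u c])
next
  show "\<exists>c. \<forall>H :: (complex ^ 'd) hfs. is_drury_arveson_space H \<longrightarrow>
            column_row_constant H c \<and>
            (\<forall>h\<in>weak_product H. \<exists>f\<in>elems H. \<exists>g\<in>elems H. h = (\<lambda>z. f z * g z) \<and>
               hnorm H f * hnorm H g \<le> c * weak_product_norm H h)"
  \<comment> \<open>The constant depends on d alone, so it can be chosen before
    \<open>H\<close>.\<close>
  proof (intro exI allI impI conjI ballI)
    fix H :: "(complex ^ 'd) hfs" and h
    assume H: "is_drury_arveson_space H"
    interpret drury_arveson H
      using H by (simp add: drury_arveson_def drury_arveson_axioms_def is_drury_arveson_space_def)
    show c: "column_row_constant H (sqrt (graded_mset.row_const CARD('d) ((real CARD('d) ^ CARD('d))\<^sup>2)))"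
      by (rule column_row_constant_drury_arveson)
    show "\<exists>f\<in>elems H. \<exists>g\<in>elems H. h = (\<lambda>z. f z * g z) \<and> hnorm H f * hnorm H g \<le>
        sqrt (graded_mset.row_const CARD('d) ((real CARD('d) ^ CARD('d))\<^sup>2)) * weak_product_norm H h"
      if "h \<in> weak_product H"
      by (rule factorization_norm[OF c that])
  qed
qed

end
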